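(* There is an absolute constant $C$ such that for every positive integer $k$ there exist a 3-side grid $G$ of size at most $Ck$ and a function $h_0:F\to\mathbb{Z}$, where $F$ is the set of edges of two sides of $G$, such that the polyhedron $\mathcal{C}(G,h_0)$ has a vertex $h$ satisfying: (a) $h(e)$ has denominator $k$ for some edge $e\in E(G)$, and (b) $h$ takes integer values on all boundary edges of $G$.
   Context: Fix the vectors $\xi_1=(1,0)$, $\xi_2=(-1,\sqrt3)/2$, $\xi_3=(-1,-\sqrt3)/2$ in $\mathbb{R}^2$ (so $\xi_1+\xi_2+\xi_3=0$). A convex (triangular) grid is a finite planar digraph $G=(V(G),E(G))$ embedded in the plane (edges are straight segments) such that (a) each bounded face is a triangle surrounded by three edges and each edge $(u,v)$ satisfies $v-u\in\{\xi_1,\xi_2,\xi_3\}$; and (b) the region $\mathcal{R}=\mathcal{R}(G)$ spanned by $G$ (the union of its bounded faces) is a convex polygon. Each bounded face (little triangle) is surrounded by a directed circuit with three edges (a 3-circuit). The boundary edges of $G$ are the edges lying on the boundary of $\mathcal{R}$. A 3-side grid is a convex grid for which $\mathcal{R}$ is a triangle; its sides (regarded as edge sets) are the sets of edges lying on the three sides of this triangle. The size of $G$ is its maximum side length, i.e. the maximum number of edges in a side. A function $h:E(G)\to\mathbb{R}$ is a cocirculation if $h(e)+h(e')+h(e'')=0$ for each 3-circuit formed by edges $e,e',e''$. Equivalently, there is a function $g:\mathcal{R}\to\mathbb{R}$, affinely linear within each bounded face, with $h(e)=g(v)-g(u)$ for each edge $e=(u,v)$; such a $g$ is unique up to adding a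 constant. The cocirculation $h$ is called concave if $g$ is concave on $\mathcal{R}$. For $F\subseteq E(G)$ and $h_0:F\to\mathbb{R}$, $\mathcal{C}(G,h_0)$ denotes the set of concave cocirculations $h$ in $G$ with $h(e)=h_0(e)$ for all $e\in F$; it is a (possibly empty) polyhedron in $\mathbb{R}^{E(G)}$. The denominator of a rational number is its denominator in lowest terms. *)

theory Defs
  imports
    "HOL-Analysis.Analysis"
    "HOL-Analysis.Finite_Function_Topology"
    "Graph_Theory.Pair_Digraph"
begin

text \<open>
  A straight-line digraph in the plane is a digraph whose vertices are points of the plane;
  an arc \<open>(u, v)\<close> is drawn as the segment from \<open>u\<close> to \<open>v\<close>.
\<close>

type_synonym point = "real ^ 2"
type_synonym edge = "point \<times> point"
type_synonym grid = "point pair_pre_digraph"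

definition xi1 :: point where "xi1 = vector [1, 0]"
definition xi2 :: point where "xi2 = vector [- 1 / 2, sqrt 3 / 2]"
definition xi3 :: point where "xi3 = vector [- 1 / 2, - sqrt 3 / 2]"

definition seg :: "edge \<Rightarrow> point set" where
  "seg e = closed_segment (fst e) (snd e)"

definition open_seg :: "edge \<Rightarrow> point set" where
  "open_seg e = open_segment (fst e) (snd e)"

definition straight_embedding :: "grid \<Rightarrow> bool" where
  "straight_embedding G \<longleftrightarrow>
     (\<forall>e\<in>parcs G. open_seg e \<inter> pverts G = {}) \<and>
     (\<forall>e\<in>parcs G. \<forall>e'\<in>parcs G. e \<noteq> e' \<longrightarrow> open_seg e \<inter> open_seg e' = {})"

definition drawing :: "grid \<Rightarrow> point set" where
  "drawing G = pverts G \<union> (\<Union>e\<in>parcs G. seg e)"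

definition bounded_faces :: "grid \<Rightarrow> point set set" where
  "bounded_faces G = {f \<in> components (- drawing G). bounded f}"

text \<open>Faces are open sets, so the region they span is the union of their closures.\<close>

definition region :: "grid \<Rightarrow> point set" where
  "region G = (\<Union>f\<in>bounded_faces G. closure f)"

definition circuit3 :: "grid \<Rightarrow> point \<Rightarrow> point \<Rightarrow> point \<Rightarrow> bool" where
  "circuit3 G u v w \<longleftrightarrow> (u, v) \<in> parcs G \<and> (v, w) \<in> parcs G \<and> (w, u) \<in> parcs G"

text \<open>
  Three unit segments with directions among \<open>\<plusminus>xi1\<close>, \<open>\<plusminus>xi2\<close>, \<open>\<plusminus>xi3\<close> close up to a triangle only
  if they are traversed consistently, so the three edges around a face form a directed circuit.
  The condition \<open>pverts G \<subseteq> region G\<close> expresses that \<open>G\<close> spans the region: no part of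
  the graph sticks out into the outer face.
\<close>

definition convex_grid :: "grid \<Rightarrow> bool" where
  "convex_grid G \<longleftrightarrow>
     pair_fin_digraph G \<and> straight_embedding G \<and>
     (\<forall>(u, v)\<in>parcs G. v - u \<in> {xi1, xi2, xi3}) \<and>
     (\<forall>f\<in>bounded_faces G. \<exists>u v w. circuit3 G u v w \<and> f = interior (convex hull {u, v, w})) \<and>
     polytope (region G) \<and> aff_dim (region G) = 2 \<and>
     pverts G \<subseteq> region G"

definition boundary_edges :: "grid \<Rightarrow> edge set" where
  "boundary_edges G = {e \<in> parcs G. seg e \<subseteq> frontier (region G)}"

definition three_side_grid :: "grid \<Rightarrow> bool" where
  "three_side_grid G \<longleftrightarrow> convex_grid G \<and> 2 simplex region G"

definition sides :: "grid \<Rightarrow> edge set set" where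
  "sides G = {{e \<in> parcs G. seg e \<subseteq> s} | s. s facet_of region G}"

definition grid_size :: "grid \<Rightarrow> nat" where
  "grid_size G = Max (card ` sides G)"

text \<open>
  The space of real functions on the edge set of \<open>G\<close> is represented by the finitely supported
  functions on \<open>edge\<close> that vanish off \<open>parcs G\<close>; they form a subspace of a type of class
  \<open>real_vector\<close>, so that the notion of extreme point applies.
\<close>

definition edge_functions :: "grid \<Rightarrow> (edge \<Rightarrow>\<^sub>0 real) set" where
  "edge_functions G = {h. Poly_Mapping.keys h \<subseteq> parcs G}"

definition cocirculation :: "grid \<Rightarrow> (edge \<Rightarrow>\<^sub>0 real) \<Rightarrow> bool" where
  "cocirculation G h \<longleftrightarrow> h \<in> edge_functions G \<and>
     (\<forall>u v w. circuit3 G u v w \<longrightarrow>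
        Poly_Mapping.lookup h (u, v) + Poly_Mapping.lookup h (v, w) + Poly_Mapping.lookup h (w, u) = 0)"

definition potential_of :: "grid \<Rightarrow> (edge \<Rightarrow>\<^sub>0 real) \<Rightarrow> (point \<Rightarrow> real) \<Rightarrow> bool" where
  "potential_of G h g \<longleftrightarrow>
     (\<forall>f\<in>bounded_faces G. \<exists>a b. \<forall>x\<in>closure f. g x = a \<bullet> x + b) \<and>
     (\<forall>(u, v)\<in>parcs G. Poly_Mapping.lookup h (u, v) = g v - g u)"

definition concave_cocirculation :: "grid \<Rightarrow> (edge \<Rightarrow>\<^sub>0 real) \<Rightarrow> bool" where
  "concave_cocirculation G h \<longleftrightarrow>
     cocirculation G h \<and> (\<exists>g. potential_of G h g \<and> concave_on (region G) g)"

definition cocirc_polyhedron :: "grid \<Rightarrow> edge set \<Rightarrow> (edge \<Rightarrow> real) \<Rightarrow> (edge \<Rightarrow>\<^sub>0 real) set" where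
  "cocirc_polyhedron G F h0 =
     {h. concave_cocirculation G h \<and> (\<forall>e\<in>F. Poly_Mapping.lookup h e = h0 e)}"

definition has_denominator :: "real \<Rightarrow> nat \<Rightarrow> bool" where
  "has_denominator x k \<longleftrightarrow> (\<exists>r::rat. x = of_rat r \<and> snd (quotient_of r) = int k)"

end

theory Submission
  imports Defs
begin

text \<open>
  A concave cocirculation on a triangular grid is given by the values of its potential at the
  lattice points, and concavity is a local condition, one inequality for each unit rhombus
  (\<open>lattice_concave\<close>, \<open>concave_interpolant\<close>). Suppose that the
  cocirculation of a lattice function \<open>\<phi>\<close> lies inside a segment between two
  members of the polyhedron. Then the difference \<open>D\<close> of their potentials is affine
  on every set on which \<open>\<phi>\<close> is affine, provided the set contains a little
  triangle (\<open>affine_on_contact_set\<close>), and \<open>D\<close> is constant on the two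
  fixed sides. So it suffices to find \<open>\<phi>\<close> whose cells of linearity are so
  interlocked that this forces \<open>D\<close> to be constant
  (\<open>rigid_extreme_point\<close>), whose values on the boundary differ by integers, and
  which has an edge with difference \<open>1 / k\<close>.

  The source of the denominator is a cell that is bounded by a segment of length
  \<open>k\<close> along a grid line whose ends have values differing by 1. The cells on both
  sides of the segment then need further edges with fractional slopes, and these must close up
  inside the grid without leaving \<open>D\<close> any freedom. A hexagonal spiral achieves
  this. Wind a path around a lattice point, turn by turn, with six sides in each turn, and let
  \<open>\<phi>\<close> change along the path with a slope that only depends on the direction of
  the side. Between consecutive turns \<open>\<phi>\<close> is linear on trapezoids of height 1,
  one for each sector and turn. If \<open>D\<close> vanishes on the outermost turn, then it
  vanishes everywhere inside: going backwards along the path, each trapezoid has a known outer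
  base and a known end of its inner base (\<open>spiral_unwinds\<close>). Five of the six slopes
  are taken integral, the sixth one is \<open>1 / k\<close>; after \<open>k\<close> turns the
  sixth side has length \<open>k\<close>, and all cells around the other sides have integral
  gradients (\<open>spiral_outer\<close>).

  The long side with slope \<open>1 / k\<close> is shared with a second spiral, the point
  reflection of the first one (\<open>double_spiral\<close>). Outside of both spirals ten large
  cells fill a triangle of size \<open>5 * k\<close>, and starting from the corner of the two
  fixed sides, \<open>D\<close> is seen to vanish on one of them after the other
  (\<open>double_spiral_rigid\<close>). This includes the ends of the common side, where
  \<open>D\<close> is linear, and therefore the outermost turns of both spirals.
\<close>

section \<open>Lattice coordinates in the plane\<close>

text \<open>
  In the basis \<open>xi1\<close>, \<open>- xi3\<close> the grid points are the integer vectors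
  and the three edge directions become \<open>(1, 0)\<close>, \<open>(-1, 1)\<close> and
  \<open>(0, -1)\<close>. The grid lines are then the level sets of \<open>cx\<close>,
  \<open>cy\<close> and \<open>cx + cy\<close> at integers.
\<close>

definition lat :: "real \<Rightarrow> real \<Rightarrow> point" where
  "lat a b = a *\<^sub>R xi1 - b *\<^sub>R xi3"

definition cx :: "point \<Rightarrow> real" where "cx p = p $ 1 - p $ 2 / sqrt 3"
definition cy :: "point \<Rightarrow> real" where "cy p = 2 * p $ 2 / sqrt 3"

lemma lat_nth: "lat a b $ 1 = a + b / 2" "lat a b $ 2 = b * sqrt 3 / 2"
  by (simp_all add: lat_def xi1_def xi3_def)

lemma cx_lat [simp]: "cx (lat a b) = a" and cy_lat [simp]: "cy (lat a b) = b"
  by (simp_all add: cx_def cy_def lat_nth)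

lemma lat_coords [simp]: "lat (cx p) (cy p) = p"
  by (simp add: vec_eq_iff forall_2 lat_nth cx_def cy_def)

lemma point_eq_iff: "p = q \<longleftrightarrow> cx p = cx q \<and> cy p = cy q"
  by (metis lat_coords)

lemma coords_linear [simp]:
  "cx (p + q) = cx p + cx q" "cx (p - q) = cx p - cx q" "cx (r *\<^sub>R p) = r * cx p"
  "cy (p + q) = cy p + cy q" "cy (p - q) = cy p - cy q" "cy (r *\<^sub>R p) = r * cy p"
  by (simp_all add: cx_def cy_def add_divide_distrib diff_divide_distrib algebra_simps)

lemma lat_eq_iff [simp]: "lat a b = lat c d \<longleftrightarrow> a = c \<and> b = d"
  by (simp add: point_eq_iff)

lemma xi_lat: "xi1 = lat 1 0" "xi2 = lat (- 1) 1" "xi3 = lat 0 (- 1)"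
  by (simp_all add: vec_eq_iff forall_2 lat_nth xi1_def xi2_def xi3_def)

lemma affine_coords_inner: "\<exists>v. \<forall>x. \<alpha> * cx x + \<beta> * cy x = v \<bullet> x"
proof (intro exI allI)
  fix x :: point
  show "\<alpha> * cx x + \<beta> * cy x = (vector [\<alpha>, (2 * \<beta> - \<alpha>) / sqrt 3] :: point) \<bullet> x"
    by (simp add: inner_vec_def sum_2 cx_def cy_def field_simps)
qed

lemma inner_affine_coords: "\<exists>\<alpha> \<beta>. \<forall>x. v \<bullet> x = \<alpha> * cx x + \<beta> * cy x" for v :: point
proof (intro exI allI)
  fix x :: point
  show "v \<bullet> x = (v \<bullet> lat 1 0) * cx x + (v \<bullet> lat 0 1) * cy x"
  proof -
    have "x = cx x *\<^sub>R lat 1 0 + cy x *\<^sub>R lat 0 1" by (simp add: point_eq_iff)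
    then have "v \<bullet> x = v \<bullet> (cx x *\<^sub>R lat 1 0 + cy x *\<^sub>R lat 0 1)" by simp
    then show ?thesis by (simp add: inner_add_right)
  qed
qed

text \<open>
  The legs have signed length \<open>s\<close>: a positive \<open>s\<close> gives a triangle
  pointing upward, a negative one a triangle pointing downward, so one family covers the whole
  grid region and both kinds of little triangles.
\<close>

definition tri :: "real \<Rightarrow> real \<Rightarrow> real \<Rightarrow> point set" where
  "tri a b s = convex hull {lat a b, lat (a + s) b, lat a (b + s)}"

lemma mem_tri:
  assumes "s \<noteq> 0"
  shows "x \<in> tri a b s \<longleftrightarrow>
    0 \<le> (cx x - a) / s \<and> 0 \<le> (cy x - b) / s \<and> (cx x - a) / s + (cy x - b) / s \<le> 1"
proof
  assume "x \<in> tri a b s"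
  then obtain u v w where "0 \<le> u" "0 \<le> v" "0 \<le> w" "u + v + w = 1"
    and x: "x = u *\<^sub>R lat a b + v *\<^sub>R lat (a + s) b + w *\<^sub>R lat a (b + s)"
    by (auto simp: tri_def convex_hull_3)
  then have u: "u = 1 - v - w" by simp
  have "cx x = a + v * s" "cy x = b + w * s" by (simp_all add: x u algebra_simps)
  then show "0 \<le> (cx x - a) / s \<and> 0 \<le> (cy x - b) / s \<and> (cx x - a) / s + (cy x - b) / s \<le> 1"
    using assms \<open>0 \<le> u\<close> \<open>0 \<le> v\<close> \<open>0 \<le> w\<close> u by simp
next
  assume r: "0 \<le> (cx x - a) / s \<and> 0 \<le> (cy x - b) / s \<and> (cx x - a) / s + (cy x - b) / s \<le> 1"
  define v w where "v = (cx x - a) / s" and "w = (cy x - b) / s"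
  have "x = (1 - v - w) *\<^sub>R lat a b + v *\<^sub>R lat (a + s) b + w *\<^sub>R lat a (b + s)"
    using assms by (simp add: point_eq_iff v_def w_def algebra_simps) (simp add: field_simps)
  moreover have "0 \<le> 1 - v - w" "0 \<le> v" "0 \<le> w" "1 - v - w + v + w = 1" using r by (simp_all add: v_def w_def)
  ultimately show "x \<in> tri a b s"
    unfolding tri_def convex_hull_3 mem_Collect_eq by metis
qed

lemma not_collinear_tri:
  assumes "s \<noteq> 0"
  shows "\<not> collinear {lat a b, lat (a + s) b, lat a (b + s)}"
proof
  assume "collinear {lat a b, lat (a + s) b, lat a (b + s)}"
  then obtain u where u: "\<And>x y. x \<in> {lat a b, lat (a + s) b, lat a (b + s)} \<Longrightarrow>
      y \<in> {lat a b, lat (a + s) b, lat a (b + s)} \<Longrightarrow> \<exists>c. x - y = c *\<^sub>R u"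
    unfolding collinear_def by blast
  obtain c d where "lat (a + s) b - lat a b = c *\<^sub>R u" "lat a (b + s) - lat a b = d *\<^sub>R u"
    using u by (metis insertCI)
  then have "s = c * cx u" "0 = c * cy u" "s = d * cy u"
    by (simp_all add: point_eq_iff)
  then show False using assms by auto
qed

lemma interior_tri:
  assumes "s \<noteq> 0"
  shows "interior (tri a b s) =
    {x. 0 < (cx x - a) / s \<and> 0 < (cy x - b) / s \<and> (cx x - a) / s + (cy x - b) / s < 1}"
proof -
  have "interior (tri a b s) = {x. \<exists>u v w. 0 < u \<and> 0 < v \<and> 0 < w \<and> u + v + w = 1 \<and>
      u *\<^sub>R lat a b + v *\<^sub>R lat (a + s) b + w *\<^sub>R lat a (b + s) = x}"
    unfolding tri_def by (rule interior_convex_hull_3_minimal) (use not_collinear_tri assms in auto)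
  also have "\<dots> = {x. 0 < (cx x - a) / s \<and> 0 < (cy x - b) / s \<and> (cx x - a) / s + (cy x - b) / s < 1}"
  proof (intro set_eqI iffI; clarify)
    fix x u v w
    assume *: "(0::real) < u" "0 < v" "0 < w" "u + v + w = 1"
    define x where "x = u *\<^sub>R lat a b + v *\<^sub>R lat (a + s) b + w *\<^sub>R lat a (b + s)"
    have u: "u = 1 - v - w" using * by simp
    have "cx x = a + v * s" "cy x = b + w * s" by (simp_all add: x_def u algebra_simps)
    then show "0 < (cx x - a) / s \<and> 0 < (cy x - b) / s \<and> (cx x - a) / s + (cy x - b) / s < 1"
      using assms * u by simp
  next
    fix x
    assume r: "0 < (cx x - a) / s" "0 < (cy x - b) / s" "(cx x - a) / s + (cy x - b) / s < 1"
    define v w where "v = (cx x - a) / s" and "w = (cy x - b) / s"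
    have "x = (1 - v - w) *\<^sub>R lat a b + v *\<^sub>R lat (a + s) b + w *\<^sub>R lat a (b + s)"
      using assms by (simp add: point_eq_iff v_def w_def algebra_simps) (simp add: field_simps)
    moreover have "0 < 1 - v - w" "0 < v" "0 < w" "1 - v - w + v + w = 1" using r by (simp_all add: v_def w_def)
    ultimately show "\<exists>u v w. 0 < u \<and> 0 < v \<and> 0 < w \<and> u + v + w = 1 \<and>
        u *\<^sub>R lat a b + v *\<^sub>R lat (a + s) b + w *\<^sub>R lat a (b + s) = x"
      by metis
  qed
  finally show ?thesis .
qed

lemma compact_tri: "compact (tri a b s)" and convex_tri: "convex (tri a b s)"
  by (simp_all add: tri_def finite_imp_compact_convex_hull)

lemma interior_tri_nonempty:
  assumes "s \<noteq> 0" shows "interior (tri a b s) \<noteq> {}"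
proof -
  have "lat (a + s / 3) (b + s / 3) \<in> interior (tri a b s)"
    using assms by (simp add: interior_tri)
  then show ?thesis by blast
qed

lemma closure_interior_tri: "s \<noteq> 0 \<Longrightarrow> closure (interior (tri a b s)) = tri a b s"
  by (simp add: convex_closure_interior convex_tri interior_tri_nonempty compact_tri compact_imp_closed)

section \<open>The triangular grid and its faces\<close>

definition pt :: "int \<Rightarrow> int \<Rightarrow> point" where
  "pt m n = lat (of_int m) (of_int n)"

lemma cx_pt [simp]: "cx (pt m n) = of_int m" and cy_pt [simp]: "cy (pt m n) = of_int n"
  by (simp_all add: pt_def)

lemma pt_eq_iff [simp]: "pt m n = pt p q \<longleftrightarrow> m = p \<and> n = q"
  by (simp add: pt_def)

definition lattice_pts :: "nat \<Rightarrow> (int \<times> int) set" where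
  "lattice_pts N = {(m, n). 0 \<le> m \<and> 0 \<le> n \<and> m + n \<le> int N}"

text \<open>
  Every edge of the grid lies on exactly one upward little triangle. Hence the lower left
  corners of these triangles index the edges of each of the three directions.
\<close>

definition up_cells :: "nat \<Rightarrow> (int \<times> int) set" where
  "up_cells N = {(m, n). 0 \<le> m \<and> 0 \<le> n \<and> m + n + 1 \<le> int N}"

definition arcs1 :: "nat \<Rightarrow> edge set" where
  "arcs1 N = (\<lambda>(m, n). (pt m n, pt (m + 1) n)) ` up_cells N"
definition arcs2 :: "nat \<Rightarrow> edge set" where
  "arcs2 N = (\<lambda>(m, n). (pt (m + 1) n, pt m (n + 1))) ` up_cells N"
definition arcs3 :: "nat \<Rightarrow> edge set" where
  "arcs3 N = (\<lambda>(m, n). (pt m (n + 1), pt m n)) ` up_cells N"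

definition tgrid :: "nat \<Rightarrow> grid" where
  "tgrid N = \<lparr> pverts = (\<lambda>(m, n). pt m n) ` lattice_pts N, parcs = arcs1 N \<union> arcs2 N \<union> arcs3 N \<rparr>"

lemma pverts_tgrid: "pverts (tgrid N) = (\<lambda>(m, n). pt m n) ` lattice_pts N"
  and parcs_tgrid: "parcs (tgrid N) = arcs1 N \<union> arcs2 N \<union> arcs3 N"
  by (simp_all add: tgrid_def)

lemma parcs_cases:
  assumes "e \<in> parcs (tgrid N)"
  obtains (1) m n where "(m, n) \<in> up_cells N" "e = (pt m n, pt (m + 1) n)"
    | (2) m n where "(m, n) \<in> up_cells N" "e = (pt (m + 1) n, pt m (n + 1))"
    | (3) m n where "(m, n) \<in> up_cells N" "e = (pt m (n + 1), pt m n)"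
  using assms by (auto simp: parcs_tgrid arcs1_def arcs2_def arcs3_def)

lemma parcsI:
  "(m, n) \<in> up_cells N \<Longrightarrow> (pt m n, pt (m + 1) n) \<in> parcs (tgrid N)"
  "(m, n) \<in> up_cells N \<Longrightarrow> (pt (m + 1) n, pt m (n + 1)) \<in> parcs (tgrid N)"
  "(m, n) \<in> up_cells N \<Longrightarrow> (pt m (n + 1), pt m n) \<in> parcs (tgrid N)"
  by (auto simp: parcs_tgrid arcs1_def arcs2_def arcs3_def)

lemma finite_lattice_pts: "finite (lattice_pts N)"
  by (rule finite_subset[of _ "{0..int N} \<times> {0..int N}"]) (auto simp: lattice_pts_def)

lemma finite_up_cells: "finite (up_cells N)"
  by (rule finite_subset[of _ "{0..int N} \<times> {0..int N}"]) (auto simp: up_cells_def)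

lemma pair_fin_digraph_tgrid: "pair_fin_digraph (tgrid N)"
proof unfold_locales
  fix e assume "e \<in> parcs (tgrid N)"
  then show "fst e \<in> pverts (tgrid N)" "snd e \<in> pverts (tgrid N)"
    by (cases rule: parcs_cases; force simp: pverts_tgrid lattice_pts_def up_cells_def)+
next
  show "finite (pverts (tgrid N))" "finite (parcs (tgrid N))"
    by (simp_all add: pverts_tgrid parcs_tgrid finite_lattice_pts finite_up_cells arcs1_def arcs2_def arcs3_def)
qed

lemma parcs_directions: "(u, v) \<in> parcs (tgrid N) \<Longrightarrow> v - u \<in> {xi1, xi2, xi3}"
  by (elim parcs_cases) (auto simp: xi_lat point_eq_iff)

lemma mem_seg1:
  "x \<in> seg (pt m n, pt (m + 1) n) \<longleftrightarrow>
    cy x = of_int n \<and> of_int m \<le> cx x \<and> cx x \<le> of_int m + 1"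
  unfolding seg_def in_segment point_eq_iff
  by (auto simp: algebra_simps intro!: exI[of _ "cx x - of_int m"])

lemma mem_seg2:
  "x \<in> seg (pt (m + 1) n, pt m (n + 1)) \<longleftrightarrow>
    cx x + cy x = of_int m + of_int n + 1 \<and> of_int m \<le> cx x \<and> of_int n \<le> cy x"
  unfolding seg_def in_segment point_eq_iff
  by (auto simp: algebra_simps intro!: exI[of _ "cy x - of_int n"])

lemma mem_seg3:
  "x \<in> seg (pt m (n + 1), pt m n) \<longleftrightarrow>
    cx x = of_int m \<and> of_int n \<le> cy x \<and> cy x \<le> of_int n + 1"
  unfolding seg_def in_segment point_eq_iff
  by (auto simp: algebra_simps intro!: exI[of _ "of_int n + 1 - cy x"])

lemma mem_open_seg1:
  "x \<in> open_seg (pt m n, pt (m + 1) n) \<longleftrightarrow>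
    cy x = of_int n \<and> of_int m < cx x \<and> cx x < of_int m + 1"
  unfolding open_seg_def in_segment point_eq_iff
  by (auto simp: algebra_simps intro!: exI[of _ "cx x - of_int m"])

lemma mem_open_seg2:
  "x \<in> open_seg (pt (m + 1) n, pt m (n + 1)) \<longleftrightarrow>
    cx x + cy x = of_int m + of_int n + 1 \<and> of_int m < cx x \<and> of_int n < cy x"
  unfolding open_seg_def in_segment point_eq_iff
  by (auto simp: algebra_simps intro!: exI[of _ "cy x - of_int n"])

lemma mem_open_seg3:
  "x \<in> open_seg (pt m (n + 1), pt m n) \<longleftrightarrow>
    cx x = of_int m \<and> of_int n < cy x \<and> cy x < of_int n + 1"
  unfolding open_seg_def in_segment point_eq_iff
  by (auto simp: algebra_simps intro!: exI[of _ "of_int n + 1 - cy x"])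

lemma int_between:
  assumes "of_int m < x" "x < of_int m + 1" shows "(x :: real) \<notin> \<int>"
proof
  assume "x \<in> \<int>"
  then obtain k where "x = of_int k" by (rule Ints_cases)
  then have "of_int m < (of_int k :: real)" "of_int k < (of_int (m + 1) :: real)" using assms by simp_all
  then show False by (simp only: of_int_less_iff)
qed

lemma straight_embedding_tgrid: "straight_embedding (tgrid N)"
proof -
  have 1: "open_seg e \<inter> pverts (tgrid N) = {}" if e: "e \<in> parcs (tgrid N)" for e
  proof -
    have "cx x \<notin> \<int> \<or> cy x \<notin> \<int>" if x: "x \<in> open_seg e" for x
      using e
    proof (cases rule: parcs_cases)
      case (1 m n)
      then show ?thesis using x int_between[of m "cx x"] by (simp add: mem_open_seg1)
    next
      case (2 m n)
      then have "of_int m < cx x" "cx x < of_int m + 1" using x by (auto simp: mem_open_seg2)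
      then show ?thesis using int_between by blast
    next
      case (3 m n)
      then show ?thesis using x int_between[of n "cy x"] by (simp add: mem_open_seg3)
    qed
    then show ?thesis by (force simp: pverts_tgrid)
  qed
  have 2: "open_seg e \<inter> open_seg e' = {}" if "e \<in> parcs (tgrid N)" "e' \<in> parcs (tgrid N)" "e \<noteq> e'" for e e'
  proof (rule ccontr)
    assume "open_seg e \<inter> open_seg e' \<noteq> {}"
    then obtain x where x: "x \<in> open_seg e" "x \<in> open_seg e'" by blast
    \<comment> \<open>An edge is determined by any inner point \<open>x\<close>: its direction by which of the three functions is integral at \<open>x\<close>.\<close>
    define k l r where "k = \<lfloor>cx x\<rfloor>" and "l = \<lfloor>cy x\<rfloor>" and "r = \<lfloor>cx x + cy x\<rfloor>"
    have key: "(cy x \<in> \<int> \<and> cx x \<notin> \<int> \<and> cx x + cy x \<notin> \<int> \<and> e = (pt k l, pt (k + 1) l)) \<or>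
        (cy x \<notin> \<int> \<and> cx x \<notin> \<int> \<and> cx x + cy x \<in> \<int> \<and> e = (pt (k + 1) l, pt k (l + 1))) \<or>
        (cy x \<notin> \<int> \<and> cx x \<in> \<int> \<and> cx x + cy x \<notin> \<int> \<and> e = (pt k (l + 1), pt k l))"
      if "e \<in> parcs (tgrid N)" "x \<in> open_seg e" for e
      using that(1)
    proof (cases rule: parcs_cases)
      case (1 m n)
      then have x: "cy x = of_int n" "of_int m < cx x" "cx x < of_int m + 1"
        using that(2) by (simp_all add: mem_open_seg1)
      then have "k = m" "l = n" unfolding k_def l_def by linarith+
      moreover have "cx x \<notin> \<int>" using int_between x by blast
      moreover have "cx x + cy x \<notin> \<int>" using int_between[of "m + n" "cx x + cy x"] x by simp
      ultimately show ?thesis using 1 x by simp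
    next
      case (2 m n)
      then have x: "cx x + cy x = of_int m + of_int n + 1" "of_int m < cx x" "of_int n < cy x"
        using that(2) by (simp_all add: mem_open_seg2)
      then have "k = m" "l = n" unfolding k_def l_def by linarith+
      moreover have "cx x \<notin> \<int>" using int_between[of m "cx x"] x by linarith
      moreover have "cy x \<notin> \<int>" using int_between[of n "cy x"] x by linarith
      ultimately show ?thesis using 2 x by simp
    next
      case (3 m n)
      then have x: "cx x = of_int m" "of_int n < cy x" "cy x < of_int n + 1"
        using that(2) by (simp_all add: mem_open_seg3)
      then have "k = m" "l = n" unfolding k_def l_def by linarith+
      moreover have "cy x \<notin> \<int>" using int_between x by blast
      moreover have "cx x + cy x \<notin> \<int>" using int_between[of "m + n" "cx x + cy x"] x by simp
      ultimately show ?thesis using 3 x by simp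
    qed
    show False using key[OF that(1) x(1)] key[OF that(2) x(2)] that(3) by metis
  qed
  show ?thesis unfolding straight_embedding_def using 1 2 by blast
qed

definition unit_triangles :: "nat \<Rightarrow> point set set" where
  "unit_triangles N = (\<lambda>(m, n). tri (of_int m) (of_int n) 1) ` up_cells N \<union>
     (\<lambda>(m, n). tri (of_int m + 1) (of_int n + 1) (- 1)) ` {(m, n). 0 \<le> m \<and> 0 \<le> n \<and> m + n + 2 \<le> int N}"

lemma mem_big: "N > 0 \<Longrightarrow> x \<in> tri 0 0 (real N) \<longleftrightarrow> 0 \<le> cx x \<and> 0 \<le> cy x \<and> cx x + cy x \<le> N"
  by (simp add: mem_tri zero_le_divide_iff add_divide_distrib[symmetric] pos_divide_le_eq)

lemma drawing_tgrid:
  assumes "N > 0"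
  shows "drawing (tgrid N) = {x \<in> tri 0 0 N. cx x \<in> \<int> \<or> cy x \<in> \<int> \<or> cx x + cy x \<in> \<int>}"
    (is "_ = ?R")
proof
  have seg: "seg e \<subseteq> ?R" if "e \<in> parcs (tgrid N)" for e
    using that
  proof (cases rule: parcs_cases)
    case (1 m n)
    then have "0 \<le> m" "0 \<le> n" "m + n + 1 \<le> int N" by (auto simp: up_cells_def)
    then show ?thesis using assms by (auto simp: 1 mem_seg1 mem_big)
  next
    case (2 m n)
    then have "0 \<le> m" "0 \<le> n" "m + n + 1 \<le> int N" by (auto simp: up_cells_def)
    then show ?thesis using assms by (auto simp: 2 mem_seg2 mem_big)
  next
    case (3 m n)
    then have "0 \<le> m" "0 \<le> n" "m + n + 1 \<le> int N" by (auto simp: up_cells_def)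
    then show ?thesis using assms by (auto simp: 3 mem_seg3 mem_big)
  qed
  moreover have "pverts (tgrid N) \<subseteq> ?R"
    using assms by (auto simp: pverts_tgrid lattice_pts_def mem_big simp flip: of_int_add)
  ultimately show "drawing (tgrid N) \<subseteq> ?R" unfolding drawing_def by blast
next
  show "?R \<subseteq> drawing (tgrid N)"
  proof
    fix x assume "x \<in> ?R"
    then have x: "0 \<le> cx x" "0 \<le> cy x" "cx x + cy x \<le> N"
      and i: "cx x \<in> \<int> \<or> cy x \<in> \<int> \<or> cx x + cy x \<in> \<int>"
      using assms by (auto simp: mem_big)
    show "x \<in> drawing (tgrid N)"
    proof (cases "cx x \<in> \<int> \<and> cy x \<in> \<int>")
      case True
      then obtain m n where mn: "cx x = of_int m" "cy x = of_int n" by (metis Ints_cases)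
      then have "(m, n) \<in> lattice_pts N" using x by (simp add: lattice_pts_def flip: of_int_add)
      moreover have "x = pt m n" using mn by (simp add: point_eq_iff)
      ultimately show ?thesis unfolding drawing_def pverts_tgrid by force
    next
      case False
      define m n where "m = \<lfloor>cx x\<rfloor>" and "n = \<lfloor>cy x\<rfloor>"
      have mn: "of_int m \<le> cx x" "cx x < of_int m + 1" "of_int n \<le> cy x" "cy x < of_int n + 1"
        unfolding m_def n_def by linarith+
      have pos: "0 \<le> m" "0 \<le> n" using x by (simp_all add: m_def n_def)
      have "\<exists>e \<in> parcs (tgrid N). x \<in> seg e"
        using i
      proof (elim disjE)
        assume "cx x \<in> \<int>"
        then have "cx x = of_int m" by (simp add: m_def)
        moreover have "cy x \<noteq> of_int n" using False calculation by auto
        ultimately have "m + n + 1 \<le> int N" using mn x by linarith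
        then show ?thesis using parcsI(3)[of m n N] pos mn \<open>cx x = _\<close>
          by (force simp: up_cells_def mem_seg3)
      next
        assume "cy x \<in> \<int>"
        then have "cy x = of_int n" by (simp add: n_def)
        moreover have "cx x \<noteq> of_int m" using False calculation by auto
        ultimately have "m + n + 1 \<le> int N" using mn x by linarith
        then show ?thesis using parcsI(1)[of m n N] pos mn \<open>cy x = _\<close>
          by (force simp: up_cells_def mem_seg1)
      next
        assume "cx x + cy x \<in> \<int>"
        then obtain r where r: "cx x + cy x = of_int r" by (metis Ints_cases)
        have "r \<noteq> m + n"
        proof
          assume "r = m + n"
          then have "cx x = of_int m" "cy x = of_int n" using mn r by simp_all
          then show False using False by simp
        qed
        then have "r = m + n + 1" using mn r by linarith
        then have "m + n + 1 \<le> int N" using x r by linarith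
        then show ?thesis using parcsI(2)[of m n N] pos mn r \<open>r = _\<close>
          by (force simp: up_cells_def mem_seg2)
      qed
      then show ?thesis unfolding drawing_def by blast
    qed
  qed
qed

lemma unit_triangles_cases:
  assumes "F \<in> unit_triangles N"
  obtains (up) m n where "(m, n) \<in> up_cells N" "F = tri (of_int m) (of_int n) 1"
    | (down) m n where "0 \<le> m" "0 \<le> n" "m + n + 2 \<le> int N" "F = tri (of_int m + 1) (of_int n + 1) (- 1)"
  using assms by (auto simp: unit_triangles_def)

lemma unit_triangles_shape:
  assumes "F \<in> unit_triangles N" obtains a b s where "s \<noteq> 0" "F = tri a b s"
  using assms by (cases rule: unit_triangles_cases) (use that[of 1] that[of "- 1"] in simp_all)

text \<open>
  Along the boundary of a little triangle one of \<open>cx\<close>, \<open>cy\<close>, \<open>cx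
  + cy\<close> is an integer, and inside each of them lies strictly between two consecutive
  integers.
\<close>

lemma unit_triangle_interior:
  assumes "N > 0" "F \<in> unit_triangles N"
  shows "F \<subseteq> tri 0 0 N" "interior F \<inter> drawing (tgrid N) = {}" "F - interior F \<subseteq> drawing (tgrid N)"
proof -
  consider (up) m n where "0 \<le> m" "0 \<le> n" "m + n + 1 \<le> int N" "F = tri (of_int m) (of_int n) 1"
    | (down) m n where "0 \<le> m" "0 \<le> n" "m + n + 2 \<le> int N" "F = tri (of_int m + 1) (of_int n + 1) (- 1)"
    using assms(2) by (cases rule: unit_triangles_cases) (auto simp: up_cells_def)
  then have "F \<subseteq> tri 0 0 N \<and> interior F \<inter> drawing (tgrid N) = {} \<and> F - interior F \<subseteq> drawing (tgrid N)"
  proof cases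
    case up
    have F: "x \<in> F \<longleftrightarrow> of_int m \<le> cx x \<and> of_int n \<le> cy x \<and> cx x + cy x \<le> of_int m + of_int n + 1" for x
      unfolding up(4) by (auto simp: mem_tri)
    have I: "x \<in> interior F \<longleftrightarrow> of_int m < cx x \<and> of_int n < cy x \<and> cx x + cy x < of_int m + of_int n + 1" for x
      unfolding up(4) by (auto simp: interior_tri)
    have big: "x \<in> tri 0 0 N" if "x \<in> F" for x
      using that up(1-3) assms(1) by (auto simp: F mem_big)
    have "x \<notin> drawing (tgrid N)" if "x \<in> interior F" for x
      using that int_between[of m "cx x"] int_between[of n "cy x"] int_between[of "m + n" "cx x + cy x"]
      by (auto simp: I drawing_tgrid assms)
    moreover have "x \<in> drawing (tgrid N)" if "x \<in> F" "x \<notin> interior F" for x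
    proof -
      have "cx x = of_int m \<or> cy x = of_int n \<or> cx x + cy x = of_int (m + n + 1)"
        using that by (simp add: F I) linarith
      then show ?thesis using big[OF that(1)] by (auto simp: drawing_tgrid assms)
    qed
    ultimately show ?thesis using big by blast
  next
    case down
    have F: "x \<in> F \<longleftrightarrow> cx x \<le> of_int m + 1 \<and> cy x \<le> of_int n + 1 \<and> of_int m + of_int n + 1 \<le> cx x + cy x" for x
      unfolding down(4) by (auto simp: mem_tri)
    have I: "x \<in> interior F \<longleftrightarrow> cx x < of_int m + 1 \<and> cy x < of_int n + 1 \<and> of_int m + of_int n + 1 < cx x + cy x" for x
      unfolding down(4) by (auto simp: interior_tri)
    have big: "x \<in> tri 0 0 N" if "x \<in> F" for x
      using that down(1-3) assms(1) by (auto simp: F mem_big)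
    have "x \<notin> drawing (tgrid N)" if "x \<in> interior F" for x
      using that int_between[of m "cx x"] int_between[of n "cy x"] int_between[of "m + n + 1" "cx x + cy x"]
      by (auto simp: I drawing_tgrid assms)
    moreover have "x \<in> drawing (tgrid N)" if "x \<in> F" "x \<notin> interior F" for x
    proof -
      have "cx x = of_int (m + 1) \<or> cy x = of_int (n + 1) \<or> cx x + cy x = of_int (m + n + 1)"
        using that by (simp add: F I) linarith
      then show ?thesis using big[OF that(1)] by (auto simp: drawing_tgrid assms)
    qed
    ultimately show ?thesis using big by blast
  qed
  then show "F \<subseteq> tri 0 0 N" "interior F \<inter> drawing (tgrid N) = {}" "F - interior F \<subseteq> drawing (tgrid N)"
    by blast+
qed

lemma unit_triangles_cover:
  assumes "N > 0" shows "\<Union>(unit_triangles N) = tri 0 0 N"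
proof
  show "\<Union>(unit_triangles N) \<subseteq> tri 0 0 N" using unit_triangle_interior(1)[OF assms] by blast
next
  show "tri 0 0 N \<subseteq> \<Union>(unit_triangles N)"
  proof
    fix x assume "x \<in> tri 0 0 N"
    then have x: "0 \<le> cx x" "0 \<le> cy x" "cx x + cy x \<le> N" using assms by (auto simp: mem_big)
    define m n where "m = \<lfloor>cx x\<rfloor>" and "n = \<lfloor>cy x\<rfloor>"
    have mn: "of_int m \<le> cx x" "cx x < of_int m + 1" "of_int n \<le> cy x" "cy x < of_int n + 1"
      unfolding m_def n_def by linarith+
    have pos: "0 \<le> m" "0 \<le> n" using x by (simp_all add: m_def n_def)
    consider "cx x + cy x \<le> of_int m + of_int n + 1" "m + n + 1 \<le> int N" | "cx x + cy x > of_int m + of_int n + 1"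
      | "cx x + cy x \<le> of_int m + of_int n + 1" "m + n = int N"
      using mn x by linarith
    then show "x \<in> \<Union>(unit_triangles N)"
    proof cases
      case 1
      then have "x \<in> tri (of_int m) (of_int n) 1" using mn by (simp add: mem_tri)
      moreover have "(m, n) \<in> up_cells N" using 1 pos by (simp add: up_cells_def)
      ultimately show ?thesis unfolding unit_triangles_def by blast
    next
      case 2
      then have "x \<in> tri (of_int m + 1) (of_int n + 1) (- 1)" using mn by (simp add: mem_tri)
      moreover have "m + n + 2 \<le> int N" using 2 x by linarith
      ultimately show ?thesis unfolding unit_triangles_def using pos by fastforce
    next
      case 3
      then have e: "cx x = of_int m" "cy x = of_int n" using mn x by linarith+
      show ?thesis
      proof (cases "m = 0")
        case False
        have "x \<in> tri (of_int (m - 1)) (of_int n) 1" using e by (simp add: mem_tri)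
        moreover have "(m - 1, n) \<in> up_cells N" using 3 pos False by (simp add: up_cells_def)
        ultimately show ?thesis unfolding unit_triangles_def by blast
      next
        case True
        have "x \<in> tri (of_int m) (of_int (n - 1)) 1" using e by (simp add: mem_tri)
        moreover have "(m, n - 1) \<in> up_cells N" using 3 pos True assms by (simp add: up_cells_def)
        ultimately show ?thesis unfolding unit_triangles_def by blast
      qed
    qed
  qed
qed

text \<open>
  A connected set which contains \<open>S\<close> properly meets the frontier of
  \<open>S\<close>.
\<close>

lemma connected_no_frontier_component:
  fixes S :: "'a::topological_space set"
  assumes "connected S" "S \<noteq> {}" "S \<inter> D = {}" "frontier S \<subseteq> D"
  shows "S \<in> components (- D)"
proof -
  obtain C where C: "C \<in> components (- D)" "S \<subseteq> C"
    using exists_component_superset[of S "- D"] assms by blast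
  have "C = S"
  proof (rule ccontr)
    assume "C \<noteq> S"
    then have "C \<inter> frontier S \<noteq> {}"
      using C assms(2) by (intro connected_Int_frontier in_components_connected[OF C(1)]) auto
    then show False using assms(4) in_components_subset[OF C(1)] by blast
  qed
  then show ?thesis using C by simp
qed

text \<open>
  The open little triangles are faces because their frontiers are drawn. Any other face contains
  a point outside of the big triangle, hence the whole complement of the big triangle, which is
  connected and unbounded.
\<close>

lemma bounded_faces_tgrid:
  assumes "N > 0"
  shows "bounded_faces (tgrid N) = interior ` unit_triangles N"
proof
  have comp: "interior F \<in> components (- drawing (tgrid N))" if F: "F \<in> unit_triangles N" for F
  proof -
    obtain a b s where s: "s \<noteq> 0" "F = tri a b s" using F by (rule unit_triangles_shape)
    have "frontier (interior F) \<subseteq> F - interior F"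
      using s by (simp add: frontier_def closure_interior_tri)
    then show ?thesis
      using unit_triangle_interior[OF assms F] s interior_tri_nonempty
      by (intro connected_no_frontier_component convex_connected convex_interior) (auto simp: convex_tri)
  qed
  show "interior ` unit_triangles N \<subseteq> bounded_faces (tgrid N)"
  proof clarify
    fix F assume F: "F \<in> unit_triangles N"
    then have "bounded F" by (elim unit_triangles_shape) (simp add: compact_tri compact_imp_bounded)
    then have "bounded (interior F)" using bounded_subset interior_subset by blast
    then show "interior F \<in> bounded_faces (tgrid N)" using comp F by (simp add: bounded_faces_def)
  qed
  show "bounded_faces (tgrid N) \<subseteq> interior ` unit_triangles N"
  proof
    fix C assume "C \<in> bounded_faces (tgrid N)"
    then have C: "C \<in> components (- drawing (tgrid N))" and b: "bounded C" by (auto simp: bounded_faces_def)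
    let ?K = "tri 0 0 N :: point set"
    have bK: "bounded ?K" by (simp add: compact_tri compact_imp_bounded)
    have DK: "drawing (tgrid N) \<subseteq> ?K" using drawing_tgrid[OF assms] by blast
    have "C \<subseteq> ?K"
    proof (rule ccontr)
      assume "\<not> C \<subseteq> ?K"
      then have "C \<inter> - ?K \<noteq> {}" by blast
      moreover have "connected (- ?K)"
        by (rule connected_complement_bounded_convex[OF bK convex_tri]) simp
      ultimately have "- ?K \<subseteq> C" using components_maximal[OF C] DK by blast
      then have "bounded (- ?K)" using b bounded_subset by blast
      then show False using bK by (metis cobounded_imp_unbounded double_complement)
    qed
    moreover obtain x where x: "x \<in> C" using in_components_nonempty[OF C] by blast
    ultimately obtain F where F: "F \<in> unit_triangles N" "x \<in> F" using unit_triangles_cover[OF assms] by blast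
    have "x \<in> interior F"
      using unit_triangle_interior(3)[OF assms F(1)] F(2) x in_components_subset[OF C] by blast
    then have "C = interior F" using comp[OF F(1)] C x components_nonoverlap by blast
    then show "C \<in> interior ` unit_triangles N" using F by blast
  qed
qed

lemma region_tgrid: "N > 0 \<Longrightarrow> region (tgrid N) = tri 0 0 N"
proof -
  assume N: "N > 0"
  have "closure (interior F) = F" if "F \<in> unit_triangles N" for F
    using that by (elim unit_triangles_shape) (simp add: closure_interior_tri)
  then have "region (tgrid N) = \<Union>(unit_triangles N)"
    unfolding region_def bounded_faces_tgrid[OF N] by auto
  then show ?thesis using unit_triangles_cover N by simp
qed

lemma circuit3_up: "(m, n) \<in> up_cells N \<Longrightarrow> circuit3 (tgrid N) (pt m n) (pt (m + 1) n) (pt m (n + 1))"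
  by (auto simp: circuit3_def parcsI)

lemma circuit3_down:
  assumes "0 \<le> m" "0 \<le> n" "m + n + 2 \<le> int N"
  shows "circuit3 (tgrid N) (pt (m + 1) (n + 1)) (pt (m + 1) n) (pt m (n + 1))"
  using parcsI(3)[of "m + 1" n N] parcsI(2)[of m n N] parcsI(1)[of m "n + 1" N] assms
  by (auto simp: circuit3_def up_cells_def)

lemma convex_grid_tgrid:
  assumes "N > 0" shows "convex_grid (tgrid N)"
proof -
  have faces: "\<exists>u v w. circuit3 (tgrid N) u v w \<and> f = interior (convex hull {u, v, w})"
    if f: "f \<in> bounded_faces (tgrid N)" for f
  proof -
    obtain F where F: "F \<in> unit_triangles N" "f = interior F" using f bounded_faces_tgrid[OF assms] by blast
    from F(1) show ?thesis
    proof (cases rule: unit_triangles_cases)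
      case (up m n)
      then have "F = convex hull {pt m n, pt (m + 1) n, pt m (n + 1)}" by (simp add: tri_def pt_def)
      then show ?thesis using circuit3_up[OF up(1)] F(2) by blast
    next
      case (down m n)
      then have "F = convex hull {pt (m + 1) (n + 1), pt m (n + 1), pt (m + 1) n}" by (simp add: tri_def pt_def)
      also have "\<dots> = convex hull {pt (m + 1) (n + 1), pt (m + 1) n, pt m (n + 1)}"
        by (simp add: insert_commute)
      finally show ?thesis using circuit3_down[OF down(1-3)] F(2) by blast
    qed
  qed
  have "interior (region (tgrid N)) \<noteq> {}"
    using region_tgrid interior_tri_nonempty assms by simp
  then have "aff_dim (region (tgrid N)) = 2" by (simp add: aff_dim_nonempty_interior)
  moreover have "polytope (region (tgrid N))"
    using region_tgrid[OF assms] unfolding tri_def polytope_def by (metis finite.emptyI finite_insert)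
  moreover have "pverts (tgrid N) \<subseteq> region (tgrid N)"
    using region_tgrid[OF assms] drawing_tgrid[OF assms] unfolding drawing_def by blast
  ultimately show ?thesis
    unfolding convex_grid_def
    using pair_fin_digraph_tgrid straight_embedding_tgrid faces parcs_directions by blast
qed

lemma tri_affine_independent: "s \<noteq> 0 \<Longrightarrow> \<not> affine_dependent {lat a b, lat (a + s) b, lat a (b + s)}"
  using not_collinear_tri[of s a b] by (auto simp: collinear_3_eq_affine_dependent)

lemma three_side_grid_tgrid:
  assumes "N > 0" shows "three_side_grid (tgrid N)"
proof -
  let ?C = "{lat 0 0, lat (real N) 0, lat 0 (real N)}"
  have "\<not> affine_dependent ?C" using tri_affine_independent[of "real N" 0 0] assms by simp
  moreover have "int (card ?C) = 2 + 1" using assms by simp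
  moreover have "region (tgrid N) = convex hull ?C" using region_tgrid[OF assms] by (simp add: tri_def)
  ultimately have "2 simplex region (tgrid N)" unfolding simplex_def by blast
  then show ?thesis using convex_grid_tgrid[OF assms] by (simp add: three_side_grid_def)
qed

section \<open>Sides and boundary of the grid\<close>

definition left_side :: "nat \<Rightarrow> edge set" where
  "left_side N = (\<lambda>n. (pt 0 (n + 1), pt 0 n)) ` {0..<int N}"
definition bottom_side :: "nat \<Rightarrow> edge set" where
  "bottom_side N = (\<lambda>m. (pt m 0, pt (m + 1) 0)) ` {0..<int N}"
definition right_side :: "nat \<Rightarrow> edge set" where
  "right_side N = (\<lambda>m. (pt (m + 1) (int N - m - 1), pt m (int N - m))) ` {0..<int N}"

lemma edges_on_left:
  assumes "N > 0" shows "{e \<in> parcs (tgrid N). seg e \<subseteq> closed_segment (lat 0 0) (lat 0 N)} = left_side N"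
proof -
  have S: "x \<in> closed_segment (lat 0 0) (lat 0 N) \<longleftrightarrow> cx x = 0 \<and> 0 \<le> cy x \<and> cy x \<le> N" for x
    unfolding in_segment point_eq_iff using assms by (auto intro!: exI[of _ "cy x / N"])
  have "e \<in> left_side N" if e: "e \<in> parcs (tgrid N)" and s: "seg e \<subseteq> closed_segment (lat 0 0) (lat 0 N)" for e
    using e
  proof -
    have "fst e \<in> seg e" "snd e \<in> seg e" by (simp_all add: seg_def)
    then have c: "cx (fst e) = 0" "cx (snd e) = 0" using s S by blast+
    obtain m n where 3: "(m, n) \<in> up_cells N" "e = (pt m (n + 1), pt m n)" "m = 0"
      using e by (cases rule: parcs_cases) (use c in auto)
    moreover have "n \<in> {0..<int N}" using 3 by (simp add: up_cells_def)
    ultimately show ?thesis unfolding left_side_def by blast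
  qed
  moreover have "e \<in> parcs (tgrid N) \<and> seg e \<subseteq> closed_segment (lat 0 0) (lat 0 N)" if e: "e \<in> left_side N" for e
  proof -
    obtain n where n: "0 \<le> n" "n < int N" "e = (pt 0 (n + 1), pt 0 n)" using e by (auto simp: left_side_def)
    have "e \<in> parcs (tgrid N)" unfolding n(3) by (rule parcsI) (use n in \<open>simp add: up_cells_def\<close>)
    moreover have "seg e \<subseteq> closed_segment (lat 0 0) (lat 0 N)"
      unfolding n(3) by (rule subsetI, unfold mem_seg3 S) (use n in auto)
    ultimately show ?thesis by blast
  qed
  ultimately show ?thesis by blast
qed

lemma edges_on_bottom:
  assumes "N > 0" shows "{e \<in> parcs (tgrid N). seg e \<subseteq> closed_segment (lat 0 0) (lat N 0)} = bottom_side N"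
proof -
  have S: "x \<in> closed_segment (lat 0 0) (lat N 0) \<longleftrightarrow> cy x = 0 \<and> 0 \<le> cx x \<and> cx x \<le> N" for x
    unfolding in_segment point_eq_iff using assms by (auto intro!: exI[of _ "cx x / N"])
  have "e \<in> bottom_side N" if e: "e \<in> parcs (tgrid N)" and s: "seg e \<subseteq> closed_segment (lat 0 0) (lat N 0)" for e
    using e
  proof -
    have "fst e \<in> seg e" "snd e \<in> seg e" by (simp_all add: seg_def)
    then have c: "cy (fst e) = 0" "cy (snd e) = 0" using s S by blast+
    obtain m n where 1: "(m, n) \<in> up_cells N" "e = (pt m n, pt (m + 1) n)" "n = 0"
      using e by (cases rule: parcs_cases) (use c in auto)
    moreover have "m \<in> {0..<int N}" using 1 by (simp add: up_cells_def)
    ultimately show ?thesis unfolding bottom_side_def by blast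
  qed
  moreover have "e \<in> parcs (tgrid N) \<and> seg e \<subseteq> closed_segment (lat 0 0) (lat N 0)" if e: "e \<in> bottom_side N" for e
  proof -
    obtain m where m: "0 \<le> m" "m < int N" "e = (pt m 0, pt (m + 1) 0)" using e by (auto simp: bottom_side_def)
    have "e \<in> parcs (tgrid N)" unfolding m(3) by (rule parcsI) (use m in \<open>simp add: up_cells_def\<close>)
    moreover have "seg e \<subseteq> closed_segment (lat 0 0) (lat N 0)"
      unfolding m(3) by (rule subsetI, unfold mem_seg1 S) (use m in auto)
    ultimately show ?thesis by blast
  qed
  ultimately show ?thesis by blast
qed

lemma edges_on_right:
  assumes "N > 0" shows "{e \<in> parcs (tgrid N). seg e \<subseteq> closed_segment (lat N 0) (lat 0 N)} = right_side N"
proof -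
  have S: "x \<in> closed_segment (lat N 0) (lat 0 N) \<longleftrightarrow> cx x + cy x = N \<and> 0 \<le> cx x \<and> 0 \<le> cy x" for x
  proof
    assume "x \<in> closed_segment (lat N 0) (lat 0 N)"
    then obtain u :: real where "0 \<le> u" "u \<le> 1" "cx x = (1 - u) * N" "cy x = u * N"
      unfolding in_segment point_eq_iff by auto
    moreover from this have "0 \<le> (1 - u) * N" "0 \<le> u * N" by simp_all
    ultimately show "cx x + cy x = N \<and> 0 \<le> cx x \<and> 0 \<le> cy x" by (simp add: algebra_simps)
  next
    assume x: "cx x + cy x = N \<and> 0 \<le> cx x \<and> 0 \<le> cy x"
    then have "cx x = N - cy x" by simp
    then have "cx x = (1 - cy x / N) * N" using assms by (simp add: algebra_simps)
    then show "x \<in> closed_segment (lat N 0) (lat 0 N)"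
      unfolding in_segment point_eq_iff using assms x by (auto intro!: exI[of _ "cy x / N"])
  qed
  have "e \<in> right_side N" if e: "e \<in> parcs (tgrid N)" and s: "seg e \<subseteq> closed_segment (lat N 0) (lat 0 N)" for e
    using e
  proof -
    have "fst e \<in> seg e" "snd e \<in> seg e" by (simp_all add: seg_def)
    then have c: "cx (fst e) + cy (fst e) = N" "cx (snd e) + cy (snd e) = N" using s S by blast+
    obtain m n where 2: "(m, n) \<in> up_cells N" "e = (pt (m + 1) n, pt m (n + 1))"
      using e by (cases rule: parcs_cases) (use c in auto)
    have "of_int (m + n + 1) = (of_int (int N) :: real)" using c(1) 2 by simp
    then have "m + n + 1 = int N" by (simp only: of_int_eq_iff)
    then have "n = int N - m - 1" by simp
    moreover have "m \<in> {0..<int N}" using 2 by (simp add: up_cells_def)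
    ultimately show ?thesis using 2 unfolding right_side_def by auto
  qed
  moreover have "e \<in> parcs (tgrid N) \<and> seg e \<subseteq> closed_segment (lat N 0) (lat 0 N)" if e: "e \<in> right_side N" for e
  proof -
    obtain m n where m: "0 \<le> m" "m < int N" "n = int N - m - 1" "e = (pt (m + 1) n, pt m (n + 1))"
      using e by (auto simp: right_side_def)
    have "e \<in> parcs (tgrid N)" unfolding m(4) by (rule parcsI) (use m in \<open>simp add: up_cells_def\<close>)
    moreover have "seg e \<subseteq> closed_segment (lat N 0) (lat 0 N)"
      unfolding m(4) by (rule subsetI, unfold mem_seg2 S) (use m in auto)
    ultimately show ?thesis by blast
  qed
  ultimately show ?thesis by blast
qed

lemma sides_tgrid:
  assumes "N > 0" shows "sides (tgrid N) = {left_side N, bottom_side N, right_side N}"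
proof -
  let ?C = "{lat 0 0, lat (real N) 0, lat 0 (real N)}"
  have ind: "\<not> affine_dependent ?C" using tri_affine_independent[of "real N" 0 0] assms by simp
  have R: "region (tgrid N) = convex hull ?C" using region_tgrid[OF assms] by (simp add: tri_def)
  have d: "?C - {lat 0 0} = {lat N 0, lat 0 N}" "?C - {lat N 0} = {lat 0 0, lat 0 N}"
    "?C - {lat 0 N} = {lat 0 0, lat N 0}" using assms by auto
  have "{s. s facet_of region (tgrid N)} =
      {convex hull (?C - {lat 0 0}), convex hull (?C - {lat N 0}), convex hull (?C - {lat 0 N})}"
  proof -
    have "convex hull (?C - {u}) \<noteq> {}" if "u \<in> ?C" for u
      using that d by (elim insertE) (simp_all del: insert_Diff_single)
    then show ?thesis
      unfolding R facet_of_convex_hull_affine_independent[OF ind] by blast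
  qed
  also have "\<dots> = {closed_segment (lat N 0) (lat 0 N), closed_segment (lat 0 0) (lat 0 N),
      closed_segment (lat 0 0) (lat N 0)}"
    unfolding d segment_convex_hull ..
  finally have *: "{s. s facet_of region (tgrid N)} = \<dots>" .
  have "sides (tgrid N) = (\<lambda>s. {e \<in> parcs (tgrid N). seg e \<subseteq> s}) ` {s. s facet_of region (tgrid N)}"
    unfolding sides_def by blast
  also have "\<dots> = {right_side N, left_side N, bottom_side N}"
    unfolding * image_insert image_empty edges_on_left[OF assms] edges_on_bottom[OF assms]
      edges_on_right[OF assms] ..
  finally show ?thesis by blast
qed

lemma grid_size_tgrid:
  assumes "N > 0" shows "grid_size (tgrid N) \<le> N"
proof -
  have "card (left_side N) \<le> N" "card (bottom_side N) \<le> N" "card (right_side N) \<le> N"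
    unfolding left_side_def bottom_side_def right_side_def
    by (rule order.trans[OF card_image_le]; simp)+
  then show ?thesis unfolding grid_size_def sides_tgrid[OF assms] by simp
qed

lemma boundary_edges_tgrid:
  assumes "N > 0" shows "boundary_edges (tgrid N) \<subseteq> left_side N \<union> bottom_side N \<union> right_side N"
proof
  fix e assume "e \<in> boundary_edges (tgrid N)"
  then have e: "e \<in> parcs (tgrid N)" and s: "seg e \<subseteq> frontier (tri 0 0 N)"
    using region_tgrid[OF assms] by (auto simp: boundary_edges_def)
  have fr: "cx x = 0 \<or> cy x = 0 \<or> cx x + cy x = N" if "x \<in> frontier (tri 0 0 N)" for x
  proof -
    have x: "x \<in> tri 0 0 N" "x \<notin> interior (tri 0 0 N)"
      using that compact_imp_closed[OF compact_tri] by (auto simp: frontier_def)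
    show ?thesis
    proof (rule ccontr)
      assume "\<not> ?thesis"
      then have "0 < cx x" "0 < cy x" "cx x + cy x < N" using x(1) assms by (auto simp: mem_big)
      then have "x \<in> interior (tri 0 0 N)"
        using assms by (simp add: interior_tri flip: add_divide_distrib)
      then show False using x by blast
    qed
  qed
  \<comment> \<open>The midpoint of an edge has a half-integral coordinate, so it lies on at most one side.\<close>
  have half: "of_int m + 1 / 2 \<noteq> (of_int r :: real)" for m r
  proof
    assume "of_int m + 1 / 2 = (of_int r :: real)"
    then have "of_int (2 * m + 1) = (of_int (2 * r) :: real)" by simp
    then have "2 * m + 1 = 2 * r" by (simp only: of_int_eq_iff)
    then show False by presburger
  qed
  show "e \<in> left_side N \<union> bottom_side N \<union> right_side N"
    using e
  proof (cases rule: parcs_cases)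
    case (1 m n)
    have "lat (of_int m + 1 / 2) (of_int n) \<in> seg e" by (simp add: 1 mem_seg1)
    then have "of_int m + 1 / 2 = (0::real) \<or> n = 0 \<or> of_int m + 1 / 2 + of_int n = real N"
      using s fr by fastforce
    then have "n = 0" using half[of m 0] half[of m "int N - n"] by auto
    then show ?thesis using 1 by (auto simp: bottom_side_def up_cells_def)
  next
    case (2 m n)
    have "lat (of_int m + 1 / 2) (of_int n + 1 / 2) \<in> seg e" by (simp add: 2 mem_seg2)
    then have "of_int m + 1 / 2 = (0::real) \<or> of_int n + 1 / 2 = (0::real) \<or> of_int m + of_int n + 1 = real N"
      using s fr by fastforce
    then have "n = int N - m - 1" using half[of m 0] half[of n 0] by auto
    then show ?thesis using 2 by (auto simp: right_side_def up_cells_def)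
  next
    case (3 m n)
    have "lat (of_int m) (of_int n + 1 / 2) \<in> seg e" by (simp add: 3 mem_seg3)
    then have "m = 0 \<or> of_int n + 1 / 2 = (0::real) \<or> of_int n + 1 / 2 + of_int m = real N"
      using s fr by fastforce
    then have "m = 0" using half[of n 0] half[of n "int N - m"] by auto
    then show ?thesis using 3 by (auto simp: left_side_def up_cells_def)
  qed
qed

section \<open>Concave interpolation of lattice functions\<close>

text \<open>
  For each of the three kinds of unit rhombi, the sum over the ends of the short diagonal, which
  is a grid edge, is at least the sum over the ends of the long one. This says that the
  piecewise linear interpolation bends downward across every grid edge. The functions live on
  the whole lattice, so that paths between lattice points never leave the domain.
\<close>

definition lattice_concave :: "(int \<Rightarrow> int \<Rightarrow> real) \<Rightarrow> bool" where
  "lattice_concave \<phi> \<longleftrightarrow>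
     (\<forall>i j. \<phi> i j + \<phi> (i + 1) (j + 1) \<le> \<phi> (i + 1) j + \<phi> i (j + 1)) \<and>
     (\<forall>i j. \<phi> i (j + 1) + \<phi> (i + 1) (j - 1) \<le> \<phi> i j + \<phi> (i + 1) j) \<and>
     (\<forall>i j. \<phi> (i - 1) (j + 1) + \<phi> (i + 1) j \<le> \<phi> i j + \<phi> i (j + 1))"

lemma lattice_concave_swap: "lattice_concave \<phi> \<Longrightarrow> lattice_concave (\<lambda>i j. \<phi> j i)"
  unfolding lattice_concave_def
proof (elim conjE, intro conjI allI, goal_cases)
  case (1 i j) then show ?case by (metis add.commute)
next
  case (2 i j)
  from 2(3)[rule_format, of j i] show ?case by linarith
next
  case (3 i j)
  from 3(2)[rule_format, of j i] show ?case by linarith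
qed

lemma lattice_concave_neg: "lattice_concave \<phi> \<Longrightarrow> lattice_concave (\<lambda>i j. \<phi> (- i) (- j))"
  unfolding lattice_concave_def
proof (elim conjE, intro conjI allI, goal_cases)
  case (1 i j)
  from 1(1)[rule_format, of "- i - 1" "- j - 1"] show ?case by (simp add: algebra_simps minus_diff_commute)
next
  case (2 i j)
  from 2(2)[rule_format, of "- i - 1" "- j"] show ?case by (simp add: algebra_simps minus_diff_commute)
next
  case (3 i j)
  from 3(3)[rule_format, of "- i" "- j - 1"] show ?case by (simp add: algebra_simps minus_diff_commute)
qed

lemma lattice_concave_shift: "lattice_concave \<phi> \<Longrightarrow> lattice_concave (\<lambda>i j. \<phi> (i - a) (j - b))"
  unfolding lattice_concave_def
proof (elim conjE, intro conjI allI, goal_cases)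
  case (1 i j)
  from 1(1)[rule_format, of "i - a" "j - b"] show ?case by (simp add: algebra_simps)
next
  case (2 i j)
  from 2(2)[rule_format, of "i - a" "j - b"] show ?case by (simp add: algebra_simps)
next
  case (3 i j)
  from 3(3)[rule_format, of "i - a" "j - b"] show ?case by (simp add: algebra_simps)
qed

text \<open>
  By the first and the third kind of rhombi, the slope in direction \<open>(1, 0)\<close> does
  not increase under translation by \<open>(0, 1)\<close> and by \<open>(1, -1)\<close>; these
  two vectors generate the cone of all \<open>(x, y)\<close> with \<open>0 \<le> x\<close> and
  \<open>0 \<le> x + y\<close>.
\<close>

lemma slope_mono:
  assumes "lattice_concave \<phi>" "0 \<le> x" "0 \<le> x + y"
  shows "\<phi> (m + x + 1) (n + y) - \<phi> (m + x) (n + y) \<le> \<phi> (m + 1) n - \<phi> m n"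
proof -
  have I: "\<phi> (i + 1) (j + 1) - \<phi> i (j + 1) \<le> \<phi> (i + 1) j - \<phi> i j" for i j
    using assms(1) unfolding lattice_concave_def by (smt (verit))
  have III: "\<phi> (i + 1) j - \<phi> i j \<le> \<phi> i (j + 1) - \<phi> (i - 1) (j + 1)" for i j
    using assms(1) unfolding lattice_concave_def by (smt (verit))
  have diag: "\<phi> (m + int p + 1) (n - int p) - \<phi> (m + int p) (n - int p) \<le> \<phi> (m + 1) n - \<phi> m n" for p
  proof (induction p)
    case (Suc p)
    then show ?case using III[of "m + int (Suc p)" "n - int (Suc p)"] by (simp add: algebra_simps)
  qed simp
  have up: "\<phi> (i + 1) (j + int q) - \<phi> i (j + int q) \<le> \<phi> (i + 1) j - \<phi> i j" for i j q
  proof (induction q)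
    case (Suc q)
    then show ?case using I[of i "j + int q"] by (simp add: algebra_simps)
  qed simp
  have "n - int (nat x) + int (nat (x + y)) = n + y" using assms by simp
  then show ?thesis
    using diag[of "nat x"] up[of "m + x" "n - int (nat x)" "nat (x + y)"] assms(2,3) by simp
qed

text \<open>
  From the local to the global condition. Each lattice point other than \<open>(m, n)\<close>
  has a neighbour closer to \<open>(m, n)\<close> from which it is reached by a step in
  direction \<open>(\<plusminus>1, 0)\<close> or \<open>(0, \<plusminus>1)\<close> whose
  increment is bounded by \<open>slope_mono\<close>. The sign of \<open>x + y\<close> decides
  which steps are allowed.
\<close>

lemma lattice_concave_le_tangent:
  assumes "lattice_concave \<phi>"
  shows "\<phi> (m + x) (n + y) \<le> \<phi> m n + (\<phi> (m + 1) n - \<phi> m n) * of_int x + (\<phi> m (n + 1) - \<phi> m n) * of_int y"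
proof (induction "nat (\<bar>x\<bar> + \<bar>y\<bar>)" arbitrary: x y rule: less_induct)
  case less
  let ?a = "\<phi> (m + 1) n - \<phi> m n" and ?b = "\<phi> m (n + 1) - \<phi> m n"
  note sw = slope_mono[OF lattice_concave_swap[OF assms]]
  consider "1 \<le> x" "1 \<le> x + y" | "1 \<le> y" "1 \<le> x + y" | "x < 0" "x + y \<le> 0" | "y < 0" "x + y \<le> 0" | "x = 0" "y = 0"
    by linarith
  then show ?case
  proof cases
    case 1
    have "\<phi> (m + (x - 1)) (n + y) \<le> \<phi> m n + ?a * of_int (x - 1) + ?b * of_int y"
      using 1 by (intro less) linarith
    moreover have "\<phi> (m + x) (n + y) - \<phi> (m + (x - 1)) (n + y) \<le> ?a"
      using slope_mono[OF assms, of "x - 1" y m n] 1 by (simp add: algebra_simps)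
    ultimately show ?thesis by (simp add: algebra_simps)
  next
    case 2
    have "\<phi> (m + x) (n + (y - 1)) \<le> \<phi> m n + ?a * of_int x + ?b * of_int (y - 1)"
      using 2 by (intro less) linarith
    moreover have "\<phi> (m + x) (n + y) - \<phi> (m + x) (n + (y - 1)) \<le> ?b"
      using sw[of "y - 1" x m n] 2 by (simp add: algebra_simps)
    ultimately show ?thesis by (simp add: algebra_simps)
  next
    case 3
    have "\<phi> (m + (x + 1)) (n + y) \<le> \<phi> m n + ?a * of_int (x + 1) + ?b * of_int y"
      using 3 by (intro less) linarith
    moreover have "?a \<le> \<phi> (m + (x + 1)) (n + y) - \<phi> (m + x) (n + y)"
      using slope_mono[OF assms, of "- x" "- y" "m + x" "n + y"] 3 by (simp add: algebra_simps)
    ultimately show ?thesis by (simp add: algebra_simps)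
  next
    case 4
    have "\<phi> (m + x) (n + (y + 1)) \<le> \<phi> m n + ?a * of_int x + ?b * of_int (y + 1)"
      using 4 by (intro less) linarith
    moreover have "?b \<le> \<phi> (m + x) (n + (y + 1)) - \<phi> (m + x) (n + y)"
      using sw[of "- y" "- x" "m + x" "n + y"] 4 by (simp add: algebra_simps)
    ultimately show ?thesis by (simp add: algebra_simps)
  qed simp
qed

text \<open>
  The affine function through the values at the corners of a little triangle. For \<open>s =
  1\<close> the triangle points upward and \<open>(m, n)\<close> is its lower left corner, for
  \<open>s = -1\<close> it points downward and \<open>(m, n)\<close> is its upper right corner.
\<close>

definition tangent :: "(int \<Rightarrow> int \<Rightarrow> real) \<Rightarrow> int \<Rightarrow> int \<Rightarrow> int \<Rightarrow> point \<Rightarrow> real" where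
  "tangent \<phi> s m n x = \<phi> m n + of_int s * (\<phi> (m + s) n - \<phi> m n) * (cx x - of_int m)
     + of_int s * (\<phi> m (n + s) - \<phi> m n) * (cy x - of_int n)"

lemma tangent_ge:
  assumes "lattice_concave \<phi>" "s \<in> {1, - 1}"
  shows "\<phi> p q \<le> tangent \<phi> s m n (pt p q)"
proof -
  have "\<phi> p q \<le> tangent \<phi> 1 m n (pt p q)"
    using lattice_concave_le_tangent[OF assms(1), of m "p - m" n "q - n"] by (simp add: tangent_def)
  moreover have "\<phi> p q \<le> tangent \<phi> (- 1) m n (pt p q)"
    using lattice_concave_le_tangent[OF lattice_concave_neg[OF assms(1)], of "- m" "m - p" "- n" "n - q"]
    by (simp add: tangent_def algebra_simps)
  ultimately show ?thesis using assms(2) by auto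
qed

lemma tangent_corners:
  assumes "s \<in> {1, - 1}"
  shows "tangent \<phi> s m n (pt m n) = \<phi> m n" "tangent \<phi> s m n (pt (m + s) n) = \<phi> (m + s) n"
    "tangent \<phi> s m n (pt m (n + s)) = \<phi> m (n + s)"
  using assms by (auto simp: tangent_def)

lemma tangent_affine: "tangent \<phi> s m n ((1 - t) *\<^sub>R x + t *\<^sub>R y) = (1 - t) * tangent \<phi> s m n x + t * tangent \<phi> s m n y"
  by (simp add: tangent_def algebra_simps)

lemma tangent_combination:
  assumes "u + v + w = 1"
  shows "tangent \<phi> s m n (u *\<^sub>R x + v *\<^sub>R y + w *\<^sub>R z) = u * tangent \<phi> s m n x + v * tangent \<phi> s m n y + w * tangent \<phi> s m n z"
proof -
  have u: "u = 1 - v - w" using assms by simp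
  show ?thesis unfolding u by (simp add: tangent_def algebra_simps)
qed

definition unit_tri :: "int \<Rightarrow> int \<Rightarrow> int \<Rightarrow> point set" where
  "unit_tri s m n = tri (of_int m) (of_int n) (of_int s)"

text \<open>
  At \<open>x\<close>, the tangent of the little triangle around \<open>x\<close> is a convex
  combination of values of \<open>\<phi>\<close> at the corners, where every tangent is at least
  \<open>\<phi>\<close>.
\<close>

lemma tangent_minimal:
  assumes "lattice_concave \<phi>" "s \<in> {1, - 1}" "s' \<in> {1, - 1}" "x \<in> unit_tri s m n"
  shows "tangent \<phi> s m n x \<le> tangent \<phi> s' m' n' x"
proof -
  have "unit_tri s m n = convex hull {pt m n, pt (m + s) n, pt m (n + s)}"
    by (simp add: unit_tri_def tri_def pt_def)
  then obtain u v w where uvw: "0 \<le> u" "0 \<le> v" "0 \<le> w" "u + v + w = 1"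
    and x: "x = u *\<^sub>R pt m n + v *\<^sub>R pt (m + s) n + w *\<^sub>R pt m (n + s)"
    using assms(4) by (auto simp: convex_hull_3)
  show ?thesis unfolding x tangent_combination[OF uvw(4)] tangent_corners[OF assms(2)]
    using uvw by (intro add_mono mult_left_mono tangent_ge assms)
qed

lemma unit_tri_cover: "\<exists>s\<in>{1, - 1}. \<exists>m n. x \<in> unit_tri s m n"
proof -
  define m n where "m = \<lfloor>cx x\<rfloor>" and "n = \<lfloor>cy x\<rfloor>"
  have mn: "of_int m \<le> cx x" "cx x < of_int m + 1" "of_int n \<le> cy x" "cy x < of_int n + 1"
    unfolding m_def n_def by linarith+
  show ?thesis
  proof (cases "cx x + cy x \<le> of_int m + of_int n + 1")
    case True
    then have "x \<in> unit_tri 1 m n" using mn by (simp add: unit_tri_def mem_tri)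
    then show ?thesis by blast
  next
    case False
    then have "x \<in> unit_tri (- 1) (m + 1) (n + 1)" using mn by (simp add: unit_tri_def mem_tri)
    then show ?thesis by blast
  qed
qed

text \<open>
  As an infimum of affine functions it is concave; that it is the piecewise linear interpolation
  is then the content of \<open>interpolant_eq\<close>.
\<close>

definition interpolant :: "(int \<Rightarrow> int \<Rightarrow> real) \<Rightarrow> point \<Rightarrow> real" where
  "interpolant \<phi> x = (INF (s, m, n) \<in> {1, - 1} \<times> UNIV. tangent \<phi> s m n x)"

lemma interpolant_eq:
  assumes "lattice_concave \<phi>" "s \<in> {1, - 1}" "x \<in> unit_tri s m n"
  shows "interpolant \<phi> x = tangent \<phi> s m n x"
  unfolding interpolant_def
proof (rule cInf_eq_minimum)
  show "tangent \<phi> s m n x \<in> (\<lambda>(s, m, n). tangent \<phi> s m n x) ` ({1, - 1} \<times> UNIV)"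
    using assms(2) by (intro image_eqI[of _ _ "(s, m, n)"]) auto
qed (use tangent_minimal[OF assms(1,2) _ assms(3)] in auto)

lemma interpolant_pt: "lattice_concave \<phi> \<Longrightarrow> interpolant \<phi> (pt m n) = \<phi> m n"
  using interpolant_eq[of \<phi> 1 "pt m n" m n] by (simp add: unit_tri_def mem_tri tangent_def)

lemma concave_interpolant:
  assumes "lattice_concave \<phi>" "convex S" shows "concave_on S (interpolant \<phi>)"
proof -
  have le: "interpolant \<phi> x \<le> tangent \<phi> s m n x" if "s \<in> {1, - 1}" for s m n x
  proof -
    obtain s' m' n' where "s' \<in> {1, - 1}" "x \<in> unit_tri s' m' n'" using unit_tri_cover by blast
    then show ?thesis using interpolant_eq[OF assms(1)] tangent_minimal[OF assms(1) _ that] by simp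
  qed
  show ?thesis
  proof (unfold concave_on_iff, intro conjI ballI allI impI assms(2))
    fix x y :: point and u v :: real
    assume uv: "0 \<le> u" "0 \<le> v" "u + v = 1"
    obtain s m n where s: "s \<in> {1, - 1}" "u *\<^sub>R x + v *\<^sub>R y \<in> unit_tri s m n"
      using unit_tri_cover[of "u *\<^sub>R x + v *\<^sub>R y"] by blast
    have u: "u = 1 - v" using uv by simp
    have "u * interpolant \<phi> x + v * interpolant \<phi> y \<le> u * tangent \<phi> s m n x + v * tangent \<phi> s m n y"
      using uv le[OF s(1)] by (intro add_mono mult_left_mono) auto
    also have "\<dots> = interpolant \<phi> (u *\<^sub>R x + v *\<^sub>R y)"
      using interpolant_eq[OF assms(1) s] by (simp add: u tangent_affine)
    finally show "u * interpolant \<phi> x + v * interpolant \<phi> y \<le> interpolant \<phi> (u *\<^sub>R x + v *\<^sub>R y)" .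
  qed
qed

section \<open>Vertices from rigid cell structures\<close>

definition coboundary :: "nat \<Rightarrow> (point \<Rightarrow> real) \<Rightarrow> edge \<Rightarrow>\<^sub>0 real" where
  "coboundary N g = Abs_poly_mapping (\<lambda>e. if e \<in> parcs (tgrid N) then g (snd e) - g (fst e) else 0)"

lemma lookup_coboundary:
  "Poly_Mapping.lookup (coboundary N g) e = (if e \<in> parcs (tgrid N) then g (snd e) - g (fst e) else 0)"
proof -
  interpret pair_fin_digraph "tgrid N" by (rule pair_fin_digraph_tgrid)
  have "finite {e. (if e \<in> parcs (tgrid N) then g (snd e) - g (fst e) else 0) \<noteq> 0}"
    by (rule finite_subset[OF _ pair_finite_arcs]) auto
  then show ?thesis unfolding coboundary_def by (subst Abs_poly_mapping_inverse) auto
qed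

lemma lookup_scaleR: "Poly_Mapping.lookup (c *\<^sub>R f) e = c * Poly_Mapping.lookup f e"
  for f :: "'a \<Rightarrow>\<^sub>0 real"
proof -
  have "finite {i. c * Poly_Mapping.lookup f i \<noteq> 0}"
    by (rule finite_subset[OF _ finite_keys[of f]]) (auto simp: in_keys_iff)
  then show ?thesis unfolding scaleR_poly_mapping_def by (simp add: Abs_poly_mapping_inverse)
qed

lemma unit_triangles_unit_tri:
  assumes "F \<in> unit_triangles N"
  obtains s m n where "s \<in> {1, - 1}" "F = unit_tri s m n"
  using assms
proof (cases rule: unit_triangles_cases)
  case (up m n) then show ?thesis using that[of 1 m n] by (simp add: unit_tri_def)
next
  case (down m n) then show ?thesis using that[of "- 1" "m + 1" "n + 1"] by (simp add: unit_tri_def)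
qed

lemma concave_cocirculation_coboundary:
  assumes "lattice_concave \<phi>" "N > 0"
  shows "concave_cocirculation (tgrid N) (coboundary N (interpolant \<phi>))"
proof -
  have "cocirculation (tgrid N) (coboundary N (interpolant \<phi>))"
    unfolding cocirculation_def edge_functions_def circuit3_def
    by (auto simp: lookup_coboundary in_keys_iff split: if_splits)
  moreover have "potential_of (tgrid N) (coboundary N (interpolant \<phi>)) (interpolant \<phi>)"
    unfolding potential_of_def
  proof (intro conjI ballI)
    fix f assume "f \<in> bounded_faces (tgrid N)"
    then obtain F where F: "F \<in> unit_triangles N" "f = interior F" using bounded_faces_tgrid[OF assms(2)] by blast
    obtain s m n where s: "s \<in> {1, - 1}" "F = unit_tri s m n" using F(1) by (rule unit_triangles_unit_tri)
    have "closure f = unit_tri s m n"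
      using s unfolding F(2) unit_tri_def by (auto intro!: closure_interior_tri)
    then have "interpolant \<phi> x = tangent \<phi> s m n x" if "x \<in> closure f" for x
      using interpolant_eq[OF assms(1) s(1)] that by simp
    moreover obtain v where "\<And>x. of_int s * (\<phi> (m + s) n - \<phi> m n) * cx x +
        of_int s * (\<phi> m (n + s) - \<phi> m n) * cy x = v \<bullet> x"
      using affine_coords_inner by metis
    then have "tangent \<phi> s m n x = v \<bullet> x + (\<phi> m n - of_int s * (\<phi> (m + s) n - \<phi> m n) * of_int m -
        of_int s * (\<phi> m (n + s) - \<phi> m n) * of_int n)" for x
      unfolding tangent_def by (simp add: right_diff_distrib flip: \<open>\<And>x. _ = v \<bullet> x\<close>)
    ultimately show "\<exists>a b. \<forall>x\<in>closure f. interpolant \<phi> x = a \<bullet> x + b" by metis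
  qed (auto simp: lookup_coboundary)
  moreover have "concave_on (region (tgrid N)) (interpolant \<phi>)"
    using concave_interpolant[OF assms(1)] region_tgrid[OF assms(2)] convex_tri by simp
  ultimately show ?thesis unfolding concave_cocirculation_def by blast
qed

text \<open>
  Otherwise concavity fails between \<open>y\<close> and a point in the interior of
  \<open>T\<close>.
\<close>

lemma concave_le_tangent:
  fixes g :: "'a::euclidean_space \<Rightarrow> real"
  assumes "concave_on S g" "T \<subseteq> S" "interior T \<noteq> {}" "y \<in> S"
    and g: "\<And>x. x \<in> T \<Longrightarrow> g x = v \<bullet> x + b"
  shows "g y \<le> v \<bullet> y + b"
proof -
  obtain c e where e: "e > 0" "ball c e \<subseteq> T" using assms(3) mem_interior by blast
  define t where "t = min (1 / 2) (e / (2 * (norm (y - c) + 1)))"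
  have n: "norm (y - c) + 1 > 0" by (simp add: add_nonneg_pos)
  have t: "0 < t" "t < 1" using e n by (auto simp: t_def)
  have "t * norm (y - c) < e"
  proof -
    have "t * norm (y - c) \<le> (e / (2 * (norm (y - c) + 1))) * (norm (y - c) + 1)"
      using e n by (intro mult_mono) (auto simp: t_def)
    also have "\<dots> = e / 2" using n by (simp add: field_simps)
    finally show ?thesis using e by simp
  qed
  define z where "z = (1 - t) *\<^sub>R c + t *\<^sub>R y"
  have "z - c = t *\<^sub>R (y - c)" by (simp add: z_def algebra_simps)
  then have "dist c z < e" using \<open>t * norm (y - c) < e\<close> t by (metis dist_commute dist_norm norm_scaleR abs_of_pos)
  then have zT: "z \<in> T" using e by auto
  have cT: "c \<in> T" using e by auto
  have "(1 - t) * g c + t * g y \<le> g z"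
    using assms(1,2,4) cT t unfolding z_def concave_on_iff by auto
  also have "\<dots> = (1 - t) * (v \<bullet> c + b) + t * (v \<bullet> y + b)"
    unfolding g[OF zT] by (simp add: z_def inner_add_right algebra_simps)
  finally have "t * g y \<le> t * (v \<bullet> y + b)" unfolding g[OF cT] by simp
  then show ?thesis using t by simp
qed

definition affine_fun_on :: "(int \<times> int) set \<Rightarrow> (int \<Rightarrow> int \<Rightarrow> real) \<Rightarrow> bool" where
  "affine_fun_on X f \<longleftrightarrow> (\<exists>\<alpha> \<beta> \<gamma>. \<forall>(p, q) \<in> X. f p q = \<alpha> * of_int p + \<beta> * of_int q + \<gamma>)"

definition has_unit_triangle :: "(int \<times> int) set \<Rightarrow> bool" where
  "has_unit_triangle X \<longleftrightarrow> (\<exists>s\<in>{1, - 1}. \<exists>m n. {(m, n), (m + s, n), (m, n + s)} \<subseteq> X)"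

lemma unit_tri_in_unit_triangles:
  assumes "s \<in> {1, - 1}" "{(m, n), (m + s, n), (m, n + s)} \<subseteq> lattice_pts N"
  shows "unit_tri s m n \<in> unit_triangles N"
proof (cases "s = 1")
  case True
  then have "(m, n) \<in> up_cells N" using assms(2) by (auto simp: lattice_pts_def up_cells_def)
  then show ?thesis using True unfolding unit_triangles_def unit_tri_def by force
next
  case False
  then have s: "s = - 1" using assms by simp
  then have "0 \<le> m - 1 \<and> 0 \<le> n - 1 \<and> (m - 1) + (n - 1) + 2 \<le> int N" using assms(2) by (auto simp: lattice_pts_def)
  then have "(\<lambda>(m, n). tri (of_int m + 1) (of_int n + 1) (- 1)) (m - 1, n - 1) \<in> unit_triangles N"
    unfolding unit_triangles_def by blast
  then show ?thesis by (simp add: unit_tri_def s)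
qed

lemma grid_connected:
  fixes f :: "int \<Rightarrow> int \<Rightarrow> real"
  assumes "\<And>m n. (m, n) \<in> up_cells N \<Longrightarrow> f (m + 1) n = f m n \<and> f m (n + 1) = f m n" "(p, q) \<in> lattice_pts N"
  shows "f p q = f 0 0"
proof -
  have 1: "f (int i) q = f 0 q" if "int i + q \<le> int N" "0 \<le> q" for i q
    using that
  proof (induction i)
    case (Suc i)
    then show ?case using assms(1)[of "int i" q] by (simp add: up_cells_def add.commute)
  qed simp
  have 2: "f 0 (int j) = f 0 0" if "int j \<le> int N" for j
    using that
  proof (induction j)
    case (Suc j)
    then show ?case using assms(1)[of 0 "int j"] by (simp add: up_cells_def add.commute)
  qed simp
  show ?thesis using 1[of "nat p" q] 2[of "nat q"] assms(2) by (simp add: lattice_pts_def)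
qed

lemma pt_in_region: "N > 0 \<Longrightarrow> (p, q) \<in> lattice_pts N \<Longrightarrow> pt p q \<in> region (tgrid N)"
  by (auto simp: region_tgrid mem_big lattice_pts_def simp flip: of_int_add)

lemma potential_tangent:
  assumes N: "N > 0" and "potential_of (tgrid N) h g" "concave_on (region (tgrid N)) g"
    and s: "s \<in> {1, - 1}" "{(m, n), (m + s, n), (m, n + s)} \<subseteq> lattice_pts N"
  shows "\<exists>\<alpha> \<beta> \<gamma>. (\<forall>p q. (p, q) \<in> lattice_pts N \<longrightarrow> g (pt p q) \<le> \<alpha> * of_int p + \<beta> * of_int q + \<gamma>) \<and>
    (\<forall>p q. (p, q) \<in> {(m, n), (m + s, n), (m, n + s)} \<longrightarrow> g (pt p q) = \<alpha> * of_int p + \<beta> * of_int q + \<gamma>)"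
proof -
  let ?T = "unit_tri s m n"
  have s0: "of_int s \<noteq> (0 :: real)" using s by auto
  have T: "?T \<in> unit_triangles N" by (rule unit_tri_in_unit_triangles[OF s])
  then have "interior ?T \<in> bounded_faces (tgrid N)" using bounded_faces_tgrid[OF N] by blast
  then obtain v b where v: "\<And>x. x \<in> closure (interior ?T) \<Longrightarrow> g x = v \<bullet> x + b"
    using assms(2) unfolding potential_of_def by metis
  have clo: "closure (interior ?T) = ?T" unfolding unit_tri_def using closure_interior_tri s0 by blast
  obtain \<alpha> \<beta> where ab: "\<And>x. v \<bullet> x = \<alpha> * cx x + \<beta> * cy x" using inner_affine_coords by metis
  have "?T \<subseteq> region (tgrid N)" using unit_triangle_interior(1)[OF N T] region_tgrid[OF N] by simp
  then have "g (pt p q) \<le> v \<bullet> pt p q + b" if "(p, q) \<in> lattice_pts N" for p q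
    using concave_le_tangent[OF assms(3), of ?T] interior_tri_nonempty[OF s0] v clo pt_in_region[OF N that]
    by (simp add: unit_tri_def)
  moreover have "pt p q \<in> ?T" if "(p, q) \<in> {(m, n), (m + s, n), (m, n + s)}" for p q
    using that s0 by (auto simp: unit_tri_def mem_tri)
  ultimately show ?thesis using v clo ab by (intro exI[of _ \<alpha>] exI[of _ \<beta>] exI[of _ b]) simp
qed

text \<open>
  The key step towards extremality. Each of \<open>g1\<close> and \<open>g2\<close> lies below
  its tangent on a little triangle contained in \<open>X\<close>. The weighted average of the
  two tangents agrees with \<open>\<phi>\<close> on that triangle, hence it is the affine
  function which \<open>\<phi>\<close> equals on \<open>X\<close>. So on \<open>X\<close> both
  inequalities are equalities, and the difference of the potentials is the difference of two
  tangents.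
\<close>

lemma affine_on_contact_set:
  assumes N: "N > 0"
    and g1: "potential_of (tgrid N) h1 g1" "concave_on (region (tgrid N)) g1"
    and g2: "potential_of (tgrid N) h2 g2" "concave_on (region (tgrid N)) g2"
    and u: "0 < u" "u < 1"
    and avg: "\<And>p q. (p, q) \<in> lattice_pts N \<Longrightarrow> (1 - u) * g1 (pt p q) + u * g2 (pt p q) = \<phi> p q"
    and X: "X \<subseteq> lattice_pts N" "has_unit_triangle X" "affine_fun_on X \<phi>"
  shows "affine_fun_on X (\<lambda>p q. g1 (pt p q) - g2 (pt p q))"
proof -
  obtain s m n where s: "s \<in> {1, - 1}" "{(m, n), (m + s, n), (m, n + s)} \<subseteq> X"
    using X(2) unfolding has_unit_triangle_def by blast
  then have sd: "{(m, n), (m + s, n), (m, n + s)} \<subseteq> lattice_pts N" using X(1) by blast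
  obtain a b c where phi: "\<And>p q. (p, q) \<in> X \<Longrightarrow> \<phi> p q = a * of_int p + b * of_int q + c"
    using X(3) unfolding affine_fun_on_def by blast
  obtain a1 b1 c1 where 1: "\<And>p q. (p, q) \<in> lattice_pts N \<Longrightarrow> g1 (pt p q) \<le> a1 * of_int p + b1 * of_int q + c1"
    "\<And>p q. (p, q) \<in> {(m, n), (m + s, n), (m, n + s)} \<Longrightarrow> g1 (pt p q) = a1 * of_int p + b1 * of_int q + c1"
    using potential_tangent[OF N g1 s(1) sd] by blast
  obtain a2 b2 c2 where 2: "\<And>p q. (p, q) \<in> lattice_pts N \<Longrightarrow> g2 (pt p q) \<le> a2 * of_int p + b2 * of_int q + c2"
    "\<And>p q. (p, q) \<in> {(m, n), (m + s, n), (m, n + s)} \<Longrightarrow> g2 (pt p q) = a2 * of_int p + b2 * of_int q + c2"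
    using potential_tangent[OF N g2 s(1) sd] by blast
  define A B C where "A = (1 - u) * a1 + u * a2 - a" and "B = (1 - u) * b1 + u * b2 - b"
    and "C = (1 - u) * c1 + u * c2 - c"
  have "A * of_int p + B * of_int q + C = 0" if "(p, q) \<in> {(m, n), (m + s, n), (m, n + s)}" for p q
    using avg[of p q] phi[of p q] 1(2)[OF that] 2(2)[OF that] that s(2) sd
    by (auto simp: A_def B_def C_def algebra_simps)
  from this[of m n] this[of "m + s" n] this[of m "n + s"]
  have e: "A * of_int m + B * of_int n + C = 0" "A * of_int (m + s) + B * of_int n + C = 0"
    "A * of_int m + B * of_int (n + s) + C = 0" by simp_all
  then have "A * of_int s = 0" "B * of_int s = 0"
    unfolding of_int_add distrib_left by linarith+
  with e(1) have ABC: "A = 0" "B = 0" "C = 0" using s(1) by auto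
  have "g1 (pt p q) = a1 * of_int p + b1 * of_int q + c1 \<and> g2 (pt p q) = a2 * of_int p + b2 * of_int q + c2"
    if pq: "(p, q) \<in> X" for p q
  proof -
    have d: "(p, q) \<in> lattice_pts N" using pq X(1) by blast
    define x y where "x = a1 * of_int p + b1 * of_int q + c1 - g1 (pt p q)"
      and "y = a2 * of_int p + b2 * of_int q + c2 - g2 (pt p q)"
    have pos: "0 \<le> x" "0 \<le> y" using 1(1)[OF d] 2(1)[OF d] by (simp_all add: x_def y_def)
    have "(1 - u) * x + u * y = A * of_int p + B * of_int q + C"
      using avg[OF d] phi[OF pq] by (simp add: x_def y_def A_def B_def C_def algebra_simps)
    then have "(1 - u) * x + u * y = 0" using ABC by simp
    moreover have "0 \<le> (1 - u) * x" "0 \<le> u * y" using pos u by simp_all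
    ultimately have "(1 - u) * x = 0" "u * y = 0" by linarith+
    then show ?thesis using u by (simp add: x_def y_def)
  qed
  then have "\<forall>(p, q) \<in> X. g1 (pt p q) - g2 (pt p q) = (a1 - a2) * of_int p + (b1 - b2) * of_int q + (c1 - c2)"
    by (auto simp: algebra_simps)
  then show ?thesis unfolding affine_fun_on_def by blast
qed

text \<open>
  \<open>D\<close> stands for the difference of the potentials of two members of the polyhedron
  whose segment contains the cocirculation of \<open>\<phi>\<close>. Its values on the two sides
  are fixed, and it is affine wherever \<open>\<phi>\<close> is.
\<close>

definition rigid :: "nat \<Rightarrow> (int \<Rightarrow> int \<Rightarrow> real) \<Rightarrow> bool" where
  "rigid N \<phi> \<longleftrightarrow> (\<forall>D. (\<forall>q. (0, q) \<in> lattice_pts N \<longrightarrow> D 0 q = 0) \<longrightarrow> (\<forall>p. (p, 0) \<in> lattice_pts N \<longrightarrow> D p 0 = 0) \<longrightarrow>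
     (\<forall>X. X \<subseteq> lattice_pts N \<longrightarrow> has_unit_triangle X \<longrightarrow> affine_fun_on X \<phi> \<longrightarrow> affine_fun_on X D) \<longrightarrow>
     (\<forall>(p, q) \<in> lattice_pts N. D p q = 0))"

lemma affine_fun_on_diff_const:
  assumes "affine_fun_on X f" shows "affine_fun_on X (\<lambda>p q. f p q - c)"
proof -
  obtain \<alpha> \<beta> \<gamma> where "\<forall>(p, q) \<in> X. f p q = \<alpha> * of_int p + \<beta> * of_int q + \<gamma>"
    using assms unfolding affine_fun_on_def by blast
  then have "\<forall>(p, q) \<in> X. f p q - c = \<alpha> * of_int p + \<beta> * of_int q + (\<gamma> - c)" by auto
  then show ?thesis unfolding affine_fun_on_def by blast
qed

lemma rigid_extreme_point:
  assumes N: "N > 0" and phi: "lattice_concave \<phi>" and rigid: "rigid N \<phi>"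
    and h0: "\<And>e. e \<in> left_side N \<union> bottom_side N \<Longrightarrow> Poly_Mapping.lookup (coboundary N (interpolant \<phi>)) e = h0 e"
  shows "coboundary N (interpolant \<phi>) extreme_point_of cocirc_polyhedron (tgrid N) (left_side N \<union> bottom_side N) h0"
    (is "?h extreme_point_of ?P")
  unfolding extreme_point_of_def
proof (intro conjI ballI notI)
  show "?h \<in> ?P"
    unfolding cocirc_polyhedron_def using concave_cocirculation_coboundary[OF phi N] h0 by blast
next
  fix a b assume a: "a \<in> ?P" and b: "b \<in> ?P" and "?h \<in> open_segment a b"
  then obtain u where ab: "a \<noteq> b" and u: "0 < u" "u < 1" and h: "?h = (1 - u) *\<^sub>R a + u *\<^sub>R b"
    by (auto simp: in_segment)
  let ?l = "Poly_Mapping.lookup"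
  obtain ga where ga: "potential_of (tgrid N) a ga" "concave_on (region (tgrid N)) ga"
    using a by (auto simp: cocirc_polyhedron_def concave_cocirculation_def)
  obtain gb where gb: "potential_of (tgrid N) b gb" "concave_on (region (tgrid N)) gb"
    using b by (auto simp: cocirc_polyhedron_def concave_cocirculation_def)
  have la: "?l a (x, y) = ga y - ga x" and lb: "?l b (x, y) = gb y - gb x"
    if "(x, y) \<in> parcs (tgrid N)" for x y
    using ga(1) gb(1) that by (auto simp: potential_of_def)
  have scale: "?l (c *\<^sub>R f) e = c * ?l f e" for c and f :: "edge \<Rightarrow>\<^sub>0 real" and e
    by (rule lookup_scaleR)
  have lh: "?l ?h e = (1 - u) * ?l a e + u * ?l b e" for e
    by (subst h) (simp add: lookup_add scale)
  define c where "c = (1 - u) * ga (pt 0 0) + u * gb (pt 0 0) - \<phi> 0 0"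
  have step: "(1 - u) * (ga y - ga x) + u * (gb y - gb x) = interpolant \<phi> y - interpolant \<phi> x"
    if "(x, y) \<in> parcs (tgrid N)" for x y
    using lh[of "(x, y)"] la[OF that] lb[OF that] that by (simp add: lookup_coboundary)
  have avg: "(1 - u) * ga (pt p q) + u * gb (pt p q) - \<phi> p q = c" if "(p, q) \<in> lattice_pts N" for p q
    unfolding c_def
  proof (rule grid_connected[OF _ that, where f = "\<lambda>p q. (1 - u) * ga (pt p q) + u * gb (pt p q) - \<phi> p q"])
    fix m n assume mn: "(m, n) \<in> up_cells N"
    show "(1 - u) * ga (pt (m + 1) n) + u * gb (pt (m + 1) n) - \<phi> (m + 1) n =
        (1 - u) * ga (pt m n) + u * gb (pt m n) - \<phi> m n \<and>
      (1 - u) * ga (pt m (n + 1)) + u * gb (pt m (n + 1)) - \<phi> m (n + 1) =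
        (1 - u) * ga (pt m n) + u * gb (pt m n) - \<phi> m n"
      using step[OF parcsI(1)[OF mn]] step[OF parcsI(3)[OF mn]]
      by (simp add: interpolant_pt[OF phi] algebra_simps)
  qed
  define D where "D p q = ga (pt p q) - gb (pt p q) - (ga (pt 0 0) - gb (pt 0 0))" for p q
  have "affine_fun_on X D" if X: "X \<subseteq> lattice_pts N" "has_unit_triangle X" "affine_fun_on X \<phi>" for X
  proof -
    have "affine_fun_on X (\<lambda>p q. \<phi> p q - (- c))" by (rule affine_fun_on_diff_const[OF X(3)])
    then have "affine_fun_on X (\<lambda>p q. ga (pt p q) - gb (pt p q))"
      by (rule affine_on_contact_set[OF N ga gb u _ X(1,2), rotated]) (use avg in force)
    then show ?thesis unfolding D_def by (rule affine_fun_on_diff_const)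
  qed
  moreover have "D 0 q = 0" if "(0, q) \<in> lattice_pts N" for q
  proof -
    have "D 0 (int j) = 0" if "int j \<le> int N" for j
      using that
    proof (induction j)
      case (Suc j)
      let ?e = "(pt 0 (int j + 1), pt 0 (int j))"
      have "?e \<in> left_side N" using Suc(2) by (auto simp: left_side_def)
      then have "?l a ?e = ?l b ?e" using a b by (auto simp: cocirc_polyhedron_def)
      moreover have "?e \<in> parcs (tgrid N)" by (rule parcsI) (use Suc(2) in \<open>simp add: up_cells_def\<close>)
      ultimately show ?case using Suc la lb by (simp add: D_def add.commute)
    qed (simp add: D_def)
    from this[of "nat q"] show ?thesis using that by (simp add: lattice_pts_def)
  qed
  moreover have "D p 0 = 0" if "(p, 0) \<in> lattice_pts N" for p
  proof -
    have "D (int j) 0 = 0" if "int j \<le> int N" for j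
      using that
    proof (induction j)
      case (Suc j)
      let ?e = "(pt (int j) 0, pt (int j + 1) 0)"
      have "?e \<in> bottom_side N" using Suc(2) by (auto simp: bottom_side_def)
      then have "?l a ?e = ?l b ?e" using a b by (auto simp: cocirc_polyhedron_def)
      moreover have "?e \<in> parcs (tgrid N)" by (rule parcsI) (use Suc(2) in \<open>simp add: up_cells_def\<close>)
      ultimately show ?case using Suc la lb by (simp add: D_def add.commute)
    qed (simp add: D_def)
    from this[of "nat p"] show ?thesis using that by (simp add: lattice_pts_def)
  qed
  ultimately have D: "D p q = 0" if "(p, q) \<in> lattice_pts N" for p q
    using rigid that unfolding rigid_def by blast
  have "?l a e = ?l b e" for e
  proof (cases "e \<in> parcs (tgrid N)")
    case True
    interpret pair_fin_digraph "tgrid N" by (rule pair_fin_digraph_tgrid)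
    obtain x y where e: "e = (x, y)" by fastforce
    have const: "ga z - gb z = ga (pt 0 0) - gb (pt 0 0)" if "z \<in> pverts (tgrid N)" for z
      using that D by (auto simp: pverts_tgrid D_def)
    have "x \<in> pverts (tgrid N)" "y \<in> pverts (tgrid N)" using True e in_arcsD1 in_arcsD2 by auto
    then show ?thesis using la[of x y] lb[of x y] True const[of x] const[of y] unfolding e by simp
  next
    case False
    then have "e \<notin> Poly_Mapping.keys a" "e \<notin> Poly_Mapping.keys b"
      using a b by (auto simp: cocirc_polyhedron_def concave_cocirculation_def cocirculation_def edge_functions_def)
    then show ?thesis by (simp add: in_keys_iff)
  qed
  then show False using ab by (simp add: poly_mapping_eqI)
qed

section \<open>The hexagonal spiral\<close>

definition triang :: "int \<Rightarrow> real" where "triang w = of_int w * (of_int w - 1) / 2"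

text \<open>
  The slopes of \<open>triang\<close> are the integers \<open>w\<close>; here they are clamped
  to the interval from \<open>- a\<close> to \<open>b\<close>.
\<close>

definition capped :: "nat \<Rightarrow> nat \<Rightarrow> int \<Rightarrow> real" where
  "capped a b w = (let m = max (- int a) (min w (int b)) in triang m + of_int m * of_int (w - m))"

lemma triang_Suc: "triang (w + 1) = triang w + of_int w"
  by (simp add: triang_def field_simps)

lemma triang_reflect: "triang (1 - w) = triang w"
  by (simp add: triang_def field_simps)

lemma capped_step: "capped a b (w + 1) = capped a b w + of_int (max (- int a) (min w (int b)))"
proof -
  let ?m = "\<lambda>w. max (- int a) (min w (int b))"
  consider "?m (w + 1) = ?m w" | "?m w = w" "?m (w + 1) = w + 1" by linarith
  then show ?thesis
  proof cases
    case 1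
    then show ?thesis unfolding capped_def Let_def 1 by (simp add: algebra_simps)
  next
    case 2
    then show ?thesis unfolding capped_def Let_def 2 by (simp add: triang_Suc)
  qed
qed

lemma capped_eq_triang:
  assumes "- int a \<le> w" "w \<le> int b + 1" shows "capped a b w = triang w"
proof (cases "w = int b + 1")
  case True
  then have "max (- int a) (min w (int b)) = int b" using assms by simp
  then show ?thesis unfolding capped_def Let_def True by (simp add: triang_Suc)
next
  case False
  then have "max (- int a) (min w (int b)) = w" using assms by simp
  then show ?thesis unfolding capped_def Let_def by simp
qed

lemma capped_reflect: "capped a a (1 - w) = capped a a w"
proof -
  have *: "capped a a (1 - w) = capped a a w" if "w < - int a" for w
  proof -
    have "max (- int a) (min w (int a)) = - int a" "max (- int a) (min (1 - w) (int a)) = int a"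
      using that by linarith+
    then show ?thesis unfolding capped_def Let_def by (simp add: triang_def field_simps)
  qed
  consider "w < - int a" | "1 - w < - int a" | "- int a \<le> w" "w \<le> int a + 1" by linarith
  then show ?thesis
  proof cases
    case 2
    then show ?thesis using *[of "1 - w"] by simp
  qed (simp_all add: * capped_eq_triang triang_reflect)
qed

lemma capped_upper_le:
  assumes "w \<le> int b + 1" "b \<le> b'" shows "capped a b w = capped a b' w"
proof (cases "w \<le> - int a")
  case True
  then have "max (- int a) (min w (int b)) = - int a" "max (- int a) (min w (int b')) = - int a" by linarith+
  then show ?thesis unfolding capped_def Let_def by simp
next
  case False
  then show ?thesis using assms by (simp add: capped_eq_triang)
qed

text \<open>
  The two ramps differ in the last slope before clamping: in direction \<open>i\<close> the last
  turn of the spiral is reached one unit later than in direction \<open>j\<close>, because every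
  turn is one unit longer there.
\<close>

definition rampA :: "nat \<Rightarrow> int \<Rightarrow> real" where "rampA k = capped k k"
definition rampB :: "nat \<Rightarrow> int \<Rightarrow> real" where "rampB k = capped k (k - 1)"
definition steep :: "nat \<Rightarrow> real \<Rightarrow> real" where "steep k \<theta> = 1 - \<theta> / k"

text \<open>
  The lattice points are passed along a hexagonal spiral: its \<open>t\<close>-th turn leads
  from \<open>(0, t)\<close> through \<open>(-t, t)\<close>, \<open>(-t, 0)\<close>, \<open>(0,
  -t)\<close>, \<open>(t + 1, -t)\<close> and \<open>(t + 1, 0)\<close> to \<open>(0, t +
  1)\<close>, where the next turn begins. Along the spiral the function changes with a slope
  that depends on the direction only: \<open>- (2 + \<theta>)\<close>, \<open>-1\<close>,
  \<open>1\<close>, \<open>0\<close> and \<open>1 + \<theta>\<close> on the first five sides of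
  a turn, and \<open>\<theta> / k\<close> on the last one. Between two consecutive turns it is
  interpolated linearly on trapezoids of height 1. Summing up the slopes gives a quadratic
  function in each of the six sectors, and these are the six cases. Clamping the ramps stops the
  winding at the \<open>k\<close>-th turn and extends the last trapezoids of five sectors to
  infinity; the last side of the sixth sector is the segment from \<open>(k, 0)\<close> to
  \<open>(0, k)\<close>.

  The slopes are chosen such that the function is concave for \<open>\<theta> = 1\<close> and
  for \<open>\<theta> = - 1\<close> on the half plane \<open>i + j \<le> k\<close>, such that
  all cells of the last turn have integral gradients, and such that the gradients of the two
  cells next to the line \<open>i + j = k\<close> fit together when the spirals for both values
  of \<open>\<theta>\<close> are glued.
\<close>

definition spiral :: "nat \<Rightarrow> real \<Rightarrow> int \<Rightarrow> int \<Rightarrow> real" where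
  "spiral k \<theta> i j =
    (if 0 \<le> j then
      if 0 \<le> i then - steep k \<theta> * rampB k (i + j) + (1 - steep k \<theta>) * j
      else if 0 \<le> i + j then - steep k \<theta> * rampB k j + (1 - steep k \<theta>) * j + (2 + \<theta>) * i
      else - steep k \<theta> * rampA k i + (2 + \<theta>) * i + j
    else
      if i < 0 then - steep k \<theta> * rampB k (i + j) + (2 + \<theta>) * i + (1 + \<theta>) * j
      else if i + j \<le> 1 then - steep k \<theta> * rampB k j + (1 + \<theta>) * j
      else - steep k \<theta> * rampA k i + (1 + \<theta>) * j)"

context
  fixes k :: nat and \<theta> :: real
  assumes k: "k > 0" and \<theta>: "\<theta> \<in> {1, - 1}"
begin

lemma rampA_eq_rampB: "w \<le> int k \<Longrightarrow> rampA k w = rampB k w"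
  unfolding rampA_def rampB_def using k by (intro capped_upper_le[symmetric]) auto

lemma rampA_step: "rampA k (w + 1) = rampA k w + of_int (max (- int k) (min w (int k)))"
  unfolding rampA_def by (rule capped_step)

lemma rampB_step: "rampB k (w + 1) = rampB k w + of_int (max (- int k) (min w (int k - 1)))"
  unfolding rampB_def using capped_step[of k "k - 1"] k by (simp add: of_nat_diff)

lemma rampB_0: "rampB k 0 = 0" and rampB_1: "rampB k 1 = 0" and rampB_minus_1: "rampB k (- 1) = 1"
proof -
  show "rampB k 0 = 0" using k by (simp add: rampB_def capped_eq_triang triang_def)
  then show "rampB k 1 = 0" using rampB_step[of 0] k by simp
  show "rampB k (- 1) = 1" using k by (simp add: rampB_def capped_eq_triang triang_def)
qed

lemma rampB_reflect: "w \<le> 0 \<Longrightarrow> rampB k w = rampA k (1 - w)"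
  using rampA_eq_rampB[of w] capped_reflect[of k w] by (simp add: rampA_def)

lemma rampA_minus: "0 \<le> w \<Longrightarrow> rampA k (- w) = rampB k w + of_int w"
proof -
  have "rampA k (- int n) = rampB k (int n) + n" for n
  proof (induction n)
    case 0 then show ?case using rampA_eq_rampB[of 0] by simp
  next
    case (Suc n)
    have "rampA k (- int n) = rampA k (- int (Suc n)) + of_int (max (- int k) (min (- int (Suc n)) (int k)))"
      using rampA_step[of "- int (Suc n)"] by simp
    moreover have "rampB k (int (Suc n)) = rampB k (int n) + of_int (max (- int k) (min (int n) (int k - 1)))"
      using rampB_step[of "int n"] by (simp add: add.commute)
    moreover have "max (- int k) (min (- int (Suc n)) (int k)) = - max (- int k) (min (int n) (int k - 1)) - 1"
      using k by linarith
    ultimately show ?case using Suc by simp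
  qed
  from this[of "nat w"] show "0 \<le> w \<Longrightarrow> rampA k (- w) = rampB k w + of_int w" by simp
qed

lemma steep_nonneg: "0 \<le> steep k \<theta>"
  using k \<theta> by (auto simp: steep_def field_simps)

lemma steep_plus_theta_nonneg: "0 \<le> steep k \<theta> + \<theta>"
  using k \<theta> by (auto simp: steep_def field_simps)

text \<open>
  The formulas of neighbouring sectors agree on the spoke between them, so each formula may be
  used on the closed sector.
\<close>

lemma
  spiral_sector0: "0 \<le> i \<Longrightarrow> 0 \<le> j \<Longrightarrow> spiral k \<theta> i j = - steep k \<theta> * rampB k (i + j) + (1 - steep k \<theta>) * of_int j" and
  spiral_sector1: "i \<le> 0 \<Longrightarrow> 0 \<le> i + j \<Longrightarrow> spiral k \<theta> i j = - steep k \<theta> * rampB k j + (1 - steep k \<theta>) * of_int j + (2 + \<theta>) * of_int i" and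
  spiral_sector2: "i + j \<le> 0 \<Longrightarrow> 0 \<le> j \<Longrightarrow> spiral k \<theta> i j = - steep k \<theta> * rampA k i + (2 + \<theta>) * of_int i + of_int j" and
  spiral_sector3: "i \<le> 0 \<Longrightarrow> j \<le> 0 \<Longrightarrow> spiral k \<theta> i j = - steep k \<theta> * rampB k (i + j) + (2 + \<theta>) * of_int i + (1 + \<theta>) * of_int j" and
  spiral_sector4: "0 \<le> i \<Longrightarrow> j \<le> 0 \<Longrightarrow> i + j \<le> 1 \<Longrightarrow> spiral k \<theta> i j = - steep k \<theta> * rampB k j + (1 + \<theta>) * of_int j" and
  spiral_sector5: "1 \<le> i \<Longrightarrow> 1 \<le> i + j \<Longrightarrow> j \<le> 0 \<Longrightarrow> i + j \<le> int k \<Longrightarrow> spiral k \<theta> i j = - steep k \<theta> * rampA k i + (1 + \<theta>) * of_int j"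
proof -
  note d = spiral_def
  show spiral_sector0: "spiral k \<theta> i j = - steep k \<theta> * rampB k (i + j) + (1 - steep k \<theta>) * of_int j" if "0 \<le> i" "0 \<le> j"
    using that by (simp add: d)
  show spiral_sector1: "spiral k \<theta> i j = - steep k \<theta> * rampB k j + (1 - steep k \<theta>) * of_int j + (2 + \<theta>) * of_int i" if "i \<le> 0" "0 \<le> i + j"
    using that by (cases "i = 0") (simp_all add: d)
  show "spiral k \<theta> i j = - steep k \<theta> * rampA k i + (2 + \<theta>) * of_int i + of_int j" if "i + j \<le> 0" "0 \<le> j"
  proof (cases "i + j = 0")
    case True
    then have "i = - j" by simp
    then show ?thesis using spiral_sector1 rampA_minus[of j] that by (simp add: algebra_simps)
  next
    case False
    then show ?thesis using that by (simp add: d)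
  qed
  show "spiral k \<theta> i j = - steep k \<theta> * rampB k (i + j) + (2 + \<theta>) * of_int i + (1 + \<theta>) * of_int j" if "i \<le> 0" "j \<le> 0"
    using that rampA_eq_rampB[of i] by (cases "j = 0"; cases "i = 0") (auto simp: d rampB_0)
  show "spiral k \<theta> i j = - steep k \<theta> * rampB k j + (1 + \<theta>) * of_int j" if "0 \<le> i" "j \<le> 0" "i + j \<le> 1"
  proof (cases "j = 0")
    case True
    then have "i = 0 \<or> i = 1" using that by linarith
    then show ?thesis using True by (auto simp: d rampB_0 rampB_1)
  next
    case False
    then show ?thesis using that by (simp add: d)
  qed
  show "spiral k \<theta> i j = - steep k \<theta> * rampA k i + (1 + \<theta>) * of_int j" if "1 \<le> i" "1 \<le> i + j" "j \<le> 0" "i + j \<le> int k"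
  proof (cases "j = 0")
    case True
    then show ?thesis using that rampA_eq_rampB[of i] by (simp add: d)
  next
    case False
    show ?thesis
    proof (cases "i + j = 1")
      case True
      then have "i = 1 - j" by simp
      then show ?thesis using rampB_reflect[of j] False that by (simp add: d)
    next
      case False
      then show ?thesis using that \<open>j \<noteq> 0\<close> by (simp add: d)
    qed
  qed
qed

lemma ramp_convex:
  "2 * (steep k \<theta> * rampB k (w + 1)) \<le> steep k \<theta> * rampB k w + steep k \<theta> * rampB k (w + 2)" "2 * (steep k \<theta> * rampA k (w + 1)) \<le> steep k \<theta> * rampA k w + steep k \<theta> * rampA k (w + 2)"
proof -
  have "max (- int k) (min w (int k - 1)) \<le> max (- int k) (min (w + 1) (int k - 1))"
    "max (- int k) (min w (int k)) \<le> max (- int k) (min (w + 1) (int k))" by linarith+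
  then have "(of_int (max (- int k) (min w (int k - 1))) :: real) \<le> of_int (max (- int k) (min (w + 1) (int k - 1)))"
    "(of_int (max (- int k) (min w (int k))) :: real) \<le> of_int (max (- int k) (min (w + 1) (int k)))"
    by (simp_all only: of_int_le_iff)
  moreover have "rampB k (w + 2) = rampB k (w + 1) + of_int (max (- int k) (min (w + 1) (int k - 1)))"
    "rampA k (w + 2) = rampA k (w + 1) + of_int (max (- int k) (min (w + 1) (int k)))"
    using rampB_step[of "w + 1"] rampA_step[of "w + 1"] by (simp_all add: add.assoc)
  ultimately have "2 * rampB k (w + 1) \<le> rampB k w + rampB k (w + 2)" "2 * rampA k (w + 1) \<le> rampA k w + rampA k (w + 2)"
    using rampB_step[of w] rampA_step[of w] by linarith+
  from this(1)[THEN mult_left_mono, OF steep_nonneg] this(2)[THEN mult_left_mono, OF steep_nonneg]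
  show "2 * (steep k \<theta> * rampB k (w + 1)) \<le> steep k \<theta> * rampB k w + steep k \<theta> * rampB k (w + 2)" "2 * (steep k \<theta> * rampA k (w + 1)) \<le> steep k \<theta> * rampA k w + steep k \<theta> * rampA k (w + 2)"
    by (simp_all add: algebra_simps)
qed

text \<open>
  In the next three lemmas a rhombus lies either in one sector, where it is flat unless its
  short diagonal is parallel to the sides of that sector, or it straddles a spoke. In the first
  case the convexity of the ramp decides, in the second one the difference of two slopes.
\<close>

lemma spiral_rhombus1:
  assumes "i + j + 2 \<le> int k"
  shows "spiral k \<theta> i j + spiral k \<theta> (i + 1) (j + 1) \<le> spiral k \<theta> (i + 1) j + spiral k \<theta> i (j + 1)"
proof -
  consider (0) "0 \<le> i" "0 \<le> j" | (1) "i \<le> - 1" "0 \<le> j" "0 \<le> i + j" | (12) "i \<le> - 1" "0 \<le> j" "i = - 1 - j"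
    | (2) "0 \<le> j" "i + j \<le> - 2" | (3) "j \<le> - 1" "i \<le> - 1" | (4) "j \<le> - 1" "0 \<le> i" "i + j \<le> - 1"
    | (45) "j \<le> - 1" "1 \<le> i" "j = - i" | (5) "j \<le> - 1" "1 \<le> i" "1 \<le> i + j" by linarith
  then show ?thesis
  proof cases
    case 0
    then show ?thesis using ramp_convex(1)[of "i + j"] by (simp add: spiral_sector0 algebra_simps)
  next
    case 1
    then show ?thesis by (simp add: spiral_sector1 algebra_simps)
  next
    case 12
    have i: "- (j + 1) = i" using 12 by simp
    have "rampA k i = rampB k j + of_int (max (- int k) (min j (int k - 1))) + of_int j + 1"
      using rampA_minus[of "j + 1", unfolded i] 12 rampB_step[of j] by simp
    moreover have "0 \<le> steep k \<theta> * (of_int (max (- int k) (min j (int k - 1))) + 1)"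
      using steep_nonneg 12 k by simp
    moreover have "spiral k \<theta> i j = - steep k \<theta> * rampA k i + (2 + \<theta>) * of_int i + of_int j"
      "spiral k \<theta> (i + 1) j = - steep k \<theta> * rampB k j + (1 - steep k \<theta>) * of_int j + (2 + \<theta>) * of_int (i + 1)"
      "spiral k \<theta> i (j + 1) = - steep k \<theta> * rampB k (j + 1) + (1 - steep k \<theta>) * of_int (j + 1) + (2 + \<theta>) * of_int i"
      "spiral k \<theta> (i + 1) (j + 1) = - steep k \<theta> * rampB k (j + 1) + (1 - steep k \<theta>) * of_int (j + 1) + (2 + \<theta>) * of_int (i + 1)"
      using 12 by (intro spiral_sector2 spiral_sector1; simp)+
    ultimately show ?thesis by (simp add: algebra_simps)
  next
    case 2
    then show ?thesis by (simp add: spiral_sector2 algebra_simps)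
  next
    case 3
    then show ?thesis using ramp_convex(1)[of "i + j"] by (simp add: spiral_sector3 algebra_simps)
  next
    case 4
    then show ?thesis by (simp add: spiral_sector4 algebra_simps)
  next
    case 45
    have "steep k \<theta> * rampB k j - steep k \<theta> * rampA k i = steep k \<theta> * of_int (max (- int k) (min i (int k)))"
      using rampB_reflect[of j] rampA_step[of i] 45 by (simp add: algebra_simps)
    moreover have "0 \<le> steep k \<theta> * of_int (max (- int k) (min i (int k)))"
      using steep_nonneg 45 by simp
    ultimately show ?thesis using 45 assms spiral_sector4[of i j] spiral_sector5[of "i + 1" j] spiral_sector5[of i "j + 1"] spiral_sector5[of "i + 1" "j + 1"]
      by (simp add: algebra_simps)
  next
    case 5
    then show ?thesis using assms by (simp add: spiral_sector5 algebra_simps)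
  qed
qed

lemma spiral_rhombus2:
  assumes "i + j + 1 \<le> int k"
  shows "spiral k \<theta> i (j + 1) + spiral k \<theta> (i + 1) (j - 1) \<le> spiral k \<theta> i j + spiral k \<theta> (i + 1) j"
proof -
  consider (0) "0 \<le> i" "1 \<le> j" | (1) "i \<le> - 1" "1 \<le> j" "0 \<le> i + j"
    | (2) "1 \<le> j" "i + j \<le> - 1" | (3) "j \<le> - 1" "i \<le> - 1" | (4) "j \<le> - 1" "0 \<le> i" "i + j \<le> 0"
    | (5) "j \<le> - 1" "1 \<le> i" "1 \<le> i + j" | (04) "i = 0" "j = 0" | (05) "1 \<le> i" "j = 0"
    | (23) "i \<le> - 1" "j = 0" by linarith
  then show ?thesis
  proof cases
    case 0
    then show ?thesis by (simp add: spiral_sector0 algebra_simps)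
  next
    case 1
    then show ?thesis using ramp_convex(1)[of "j - 1"] by (simp add: spiral_sector1 algebra_simps)
  next
    case 2
    then show ?thesis by (simp add: spiral_sector2 algebra_simps)
  next
    case 3
    then show ?thesis by (simp add: spiral_sector3 algebra_simps)
  next
    case 4
    then show ?thesis using ramp_convex(1)[of "j - 1"] by (simp add: spiral_sector4 algebra_simps)
  next
    case 5
    then show ?thesis using assms by (simp add: spiral_sector5 algebra_simps)
  next
    case 04
    have "1 / real k \<le> 1" using k by simp
    then have "0 \<le> 2 * steep k \<theta> + \<theta>" using \<theta> by (auto simp: steep_def)
    then show ?thesis using 04 by (simp add: spiral_sector0 spiral_sector4 rampB_0 rampB_1 rampB_minus_1 algebra_simps)
  next
    case 05
    have "rampA k (i + 1) = rampB k i + of_int (max (- int k) (min i (int k - 1)))"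
      using rampB_step[of i] rampA_eq_rampB[of "i + 1"] 05 assms by simp
    moreover have "0 \<le> steep k \<theta> * of_int (max (- int k) (min i (int k - 1)))"
      using steep_nonneg 05 k by simp
    ultimately show ?thesis using 05 assms spiral_sector0[of i 1] spiral_sector0[of i 0] spiral_sector0[of "i + 1" 0] spiral_sector5[of "i + 1" "- 1"] steep_plus_theta_nonneg
      by (simp add: algebra_simps)
  next
    case 23
    have "rampA k (i + 1) = rampB k i + of_int (max (- int k) (min i (int k - 1)))"
      using rampB_step[of i] rampA_eq_rampB[of "i + 1"] 23 by simp
    moreover have "steep k \<theta> * 1 \<le> steep k \<theta> * (- of_int (max (- int k) (min i (int k - 1))))"
      using steep_nonneg 23 k by (intro mult_left_mono) auto
    ultimately show ?thesis using 23 spiral_sector2[of i 1] spiral_sector2[of i 0] spiral_sector2[of "i + 1" 0] spiral_sector3[of "i + 1" "- 1"] steep_plus_theta_nonneg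
      by (simp add: algebra_simps)
  qed
qed

lemma spiral_rhombus3:
  assumes "i + j + 1 \<le> int k"
  shows "spiral k \<theta> (i - 1) (j + 1) + spiral k \<theta> (i + 1) j \<le> spiral k \<theta> i j + spiral k \<theta> i (j + 1)"
proof -
  have theta: "0 \<le> 2 + \<theta>" using \<theta> by auto
  consider (0) "1 \<le> i" "0 \<le> j" | (01) "i = 0" "0 \<le> j" | (1) "i \<le> - 1" "0 \<le> j" "0 \<le> i + j"
    | (2) "0 \<le> j" "i + j \<le> - 1" | (3) "j \<le> - 1" "i \<le> - 1" | (34) "j \<le> - 1" "i = 0"
    | (4) "j \<le> - 1" "1 \<le> i" "i + j \<le> 0" | (5) "j \<le> - 1" "2 \<le> i" "1 \<le> i + j" by linarith
  then show ?thesis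
  proof cases
    case 0
    then show ?thesis by (simp add: spiral_sector0 algebra_simps)
  next
    case 01
    have "rampB k (j + 1) = rampB k j + of_int (max (- int k) (min j (int k - 1)))" by (rule rampB_step)
    moreover have "0 \<le> steep k \<theta> * of_int (max (- int k) (min j (int k - 1)))" using steep_nonneg 01 k by simp
    ultimately show ?thesis using 01 theta spiral_sector0[of 0 j] spiral_sector0[of 0 "j + 1"] spiral_sector1[of "- 1" "j + 1"] spiral_sector0[of 1 j]
      by (simp add: algebra_simps)
  next
    case 1
    then show ?thesis by (simp add: spiral_sector1 algebra_simps)
  next
    case 2
    then show ?thesis using ramp_convex(2)[of "i - 1"] by (simp add: spiral_sector2 algebra_simps)
  next
    case 3
    then show ?thesis by (simp add: spiral_sector3 algebra_simps)
  next
    case 34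
    have "rampB k (j + 1) = rampB k j + of_int (max (- int k) (min j (int k - 1)))" by (rule rampB_step)
    moreover have "max (- int k) (min j (int k - 1)) \<le> 0" using 34 k by linarith
    then have "0 \<le> steep k \<theta> * - of_int (max (- int k) (min j (int k - 1)))"
      by (intro mult_nonneg_nonneg steep_nonneg) simp
    ultimately show ?thesis using 34 theta spiral_sector4[of 0 j] spiral_sector4[of 0 "j + 1"] spiral_sector3[of "- 1" "j + 1"] spiral_sector4[of 1 j]
      by (simp add: algebra_simps)
  next
    case 4
    then show ?thesis by (simp add: spiral_sector4 algebra_simps)
  next
    case 5
    then show ?thesis using assms ramp_convex(2)[of "i - 1"] by (simp add: spiral_sector5 algebra_simps)
  qed
qed

end


section \<open>Two spirals glued along a side\<close>

text \<open>
  Beyond the line \<open>i + j = k\<close> the function continues with its point reflection in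
  the midpoint of the segment from \<open>(k, 0)\<close> to \<open>(0, k)\<close>, with
  \<open>\<theta>\<close> replaced by \<open>- \<theta>\<close> since the slope on this segment
  has to be the same when it is traversed backwards. Each spiral decreases away from its centre,
  which would leave a valley along the line; the terms \<open>k * (i + j)\<close> and \<open>k *
  (2 * k - i - j)\<close> add a roof that outweighs it. The last \<open>k\<close> makes the two
  halves agree on the line.
\<close>

definition double_spiral :: "nat \<Rightarrow> int \<Rightarrow> int \<Rightarrow> real" where
  "double_spiral k i j =
    (if i + j \<le> int k then spiral k 1 i j + of_int (int k * (i + j))
     else spiral k (- 1) (int k - i) (int k - j) + of_int (int k * (2 * int k - i - j)) + k)"

lemma rampA_above:
  assumes "int k \<le> w" shows "rampA k w = real k * (real k - 1) / 2 + real k * (of_int w - real k)"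
proof -
  have "max (- int k) (min w (int k)) = int k" using assms by simp
  then show ?thesis unfolding rampA_def capped_def Let_def by (simp add: triang_def)
qed

lemma rampB_above:
  assumes "k > 0" "int k - 1 \<le> w"
  shows "rampB k w = real k * (real k - 1) / 2 + (real k - 1) * (of_int w - real k)"
proof -
  have "max (- int k) (min w (int (k - 1))) = int k - 1" using assms by linarith
  then have "rampB k w = triang (int k - 1) + of_int (int k - 1) * of_int (w - (int k - 1))"
    unfolding rampB_def capped_def Let_def by simp
  then show ?thesis by (simp add: triang_def field_simps)
qed

lemma double_spiral_glue:
  assumes k: "k > 0" and ij: "i + j = int k"
  shows "spiral k 1 i j = spiral k (- 1) j i + k"
proof -
  have j: "of_int j = real k - of_int i" using ij by linarith
  consider "0 \<le> i" "0 \<le> j" | "i \<le> - 1" "int k \<le> j" | "j \<le> - 1" "int k \<le> i" using ij by linarith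
  then show ?thesis
  proof cases
    case 1
    then show ?thesis using k ij spiral_sector0[OF k, of 1 i j] spiral_sector0[OF k, of "- 1" j i]
      by (simp add: steep_def rampB_above j add.commute) (simp add: field_simps)
  next
    case 2
    then show ?thesis using k ij spiral_sector1[OF k, of 1 i j] spiral_sector5[OF k, of "- 1" j i]
      by (simp add: steep_def rampA_above rampB_above j) (simp add: field_simps)
  next
    case 3
    then show ?thesis using k ij spiral_sector5[OF k, of 1 i j] spiral_sector1[OF k, of "- 1" j i]
      by (simp add: steep_def rampA_above rampB_above j) (simp add: field_simps)
  qed
qed

lemma double_spiral_low: "i + j \<le> int k \<Longrightarrow> double_spiral k i j = spiral k 1 i j + of_int (int k * (i + j))"
  by (simp add: double_spiral_def)

lemma double_spiral_high:
  assumes "k > 0" "int k \<le> i + j"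
  shows "double_spiral k i j = spiral k (- 1) (int k - i) (int k - j) + of_int (int k * (2 * int k - i - j)) + k"
proof (cases "i + j = int k")
  case True
  then have e: "int k - i = j" "int k - j = i" "2 * int k - i - j = i + j" by linarith+
  show ?thesis unfolding e using double_spiral_glue[OF assms(1) True] True by (simp add: double_spiral_def)
next
  case False
  then show ?thesis using assms by (simp add: double_spiral_def)
qed

text \<open>
  The rhombi whose short diagonal lies on the line \<open>i + j = k\<close>; all others stay in
  one of the two half planes.
\<close>

lemma double_spiral_rhombus_across:
  assumes "k \<ge> 2" and ij: "i + j = int k - 1"
  shows "spiral k 1 i j + spiral k (- 1) j i \<le> spiral k 1 (i + 1) j + spiral k 1 i (j + 1) + k"
proof -
  have k: "k > 0" using assms(1) by simp
  have j: "of_int j = real k - 1 - of_int i" using ij by linarith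
  have c: "steep k 1 = 1 - 1 / k" "steep k (- 1) = 1 + 1 / k" by (simp_all add: steep_def)
  consider "0 \<le> i" "0 \<le> j" | "i \<le> - 1" "int k \<le> j" | "j \<le> - 1" "int k \<le> i" using ij by linarith
  then show ?thesis
  proof cases
    case 1
    have e: "i + j = int k - 1" "j + i = int k - 1" "i + 1 + j = int k" "i + (j + 1) = int k" using ij by linarith+
    have s: "spiral k 1 i j = - steep k 1 * rampB k (int k - 1) + (1 - steep k 1) * of_int j"
      "spiral k (- 1) j i = - steep k (- 1) * rampB k (int k - 1) + (1 - steep k (- 1)) * of_int i"
      "spiral k 1 (i + 1) j = - steep k 1 * rampB k (int k) + (1 - steep k 1) * of_int j"
      "spiral k 1 i (j + 1) = - steep k 1 * rampB k (int k) + (1 - steep k 1) * (of_int j + 1)"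
      using 1 spiral_sector0[OF k, of 1 i j] spiral_sector0[OF k, of "- 1" j i] spiral_sector0[OF k, of 1 "i + 1" j] spiral_sector0[OF k, of 1 i "j + 1"]
      unfolding e by simp_all
    have r: "rampB k (int k - 1) = real k * (real k - 1) / 2 - (real k - 1)" "rampB k (int k) = real k * (real k - 1) / 2"
      using rampB_above[OF k, of "int k - 1"] rampB_above[OF k, of "int k"] by simp_all
    show ?thesis unfolding s c j r using k by (simp add: field_simps)
  next
    case 2
    have s: "spiral k 1 i j = - steep k 1 * rampB k j + (1 - steep k 1) * of_int j + 3 * of_int i"
      "spiral k 1 (i + 1) j = - steep k 1 * rampB k j + (1 - steep k 1) * of_int j + 3 * (of_int i + 1)"
      "spiral k 1 i (j + 1) = - steep k 1 * rampB k (j + 1) + (1 - steep k 1) * (of_int j + 1) + 3 * of_int i"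
      using 2 k ij spiral_sector1[OF k, of 1 i j] spiral_sector1[OF k, of 1 "i + 1" j] spiral_sector1[OF k, of 1 i "j + 1"] by simp_all
    have "spiral k (- 1) j i = - steep k (- 1) * rampA k j"
      using spiral_sector5[OF k, of "- 1" j i] 2 ij assms(1) by simp
    moreover have "spiral k 1 i j - steep k (- 1) * rampA k j \<le> spiral k 1 (i + 1) j + spiral k 1 i (j + 1) + k"
      using 2 k unfolding s c by (simp add: rampA_above rampB_above j) (simp add: field_simps)
    ultimately show ?thesis by linarith
  next
    case 3
    have s: "spiral k (- 1) j i = - steep k (- 1) * rampB k i + (1 - steep k (- 1)) * of_int i + of_int j"
      "spiral k 1 (i + 1) j = - steep k 1 * rampA k (i + 1) + 2 * of_int j"
      "spiral k 1 i (j + 1) = - steep k 1 * rampA k i + 2 * (of_int j + 1)"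
      using 3 k ij spiral_sector1[OF k, of "- 1" j i] spiral_sector5[OF k, of 1 "i + 1" j] spiral_sector5[OF k, of 1 i "j + 1"] by simp_all
    have "spiral k 1 i j = - steep k 1 * rampA k i + 2 * of_int j"
      using spiral_sector5[OF k, of 1 i j] 3 ij assms(1) by simp
    moreover have "- steep k 1 * rampA k i + 2 * of_int j + spiral k (- 1) j i \<le> spiral k 1 (i + 1) j + spiral k 1 i (j + 1) + k"
      using 3 k unfolding s c by (simp add: rampA_above rampB_above j) (simp add: field_simps)
    ultimately show ?thesis by linarith
  qed
qed

lemma lattice_concave_double_spiral:
  assumes k2: "k \<ge> 2" shows "lattice_concave (double_spiral k)"
  unfolding lattice_concave_def
proof (intro conjI allI)
  fix i j
  have k: "k > 0" using k2 by simp
  show "double_spiral k i j + double_spiral k (i + 1) (j + 1) \<le> double_spiral k (i + 1) j + double_spiral k i (j + 1)"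
  proof -
    consider "i + j + 2 \<le> int k" | "int k \<le> i + j" | "i + j = int k - 1" by linarith
    then show ?thesis
    proof cases
      case 1
      then show ?thesis using spiral_rhombus1[OF k _ 1, of 1] by (simp add: double_spiral_low algebra_simps)
    next
      case 2
      then show ?thesis using k spiral_rhombus1[OF k, of "- 1" "int k - i - 1" "int k - j - 1"]
        by (simp add: double_spiral_high algebra_simps)
    next
      case 3
      have e: "int k - (i + 1) = j" "int k - (j + 1) = i" "i + 1 + j = int k" "i + (j + 1) = int k"
        "2 * int k - (i + 1) - (j + 1) = int k - 1" using 3 by simp_all
      have "double_spiral k i j = spiral k 1 i j + of_int (int k * (int k - 1))"
        "double_spiral k (i + 1) j = spiral k 1 (i + 1) j + of_int (int k * int k)"
        "double_spiral k i (j + 1) = spiral k 1 i (j + 1) + of_int (int k * int k)"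
        "double_spiral k (i + 1) (j + 1) = spiral k (- 1) j i + of_int (int k * (int k - 1)) + k"
        using double_spiral_low[of i j k] double_spiral_low[of "i + 1" j k] double_spiral_low[of i "j + 1" k]
          double_spiral_high[OF k, of "i + 1" "j + 1"] 3 unfolding e by simp_all
      then show ?thesis using double_spiral_rhombus_across[OF k2 3] by (simp add: algebra_simps)
    qed
  qed
  show "double_spiral k i (j + 1) + double_spiral k (i + 1) (j - 1) \<le> double_spiral k i j + double_spiral k (i + 1) j"
  proof (cases "i + j + 1 \<le> int k")
    case True
    then show ?thesis using spiral_rhombus2[OF k _ True, of 1] by (simp add: double_spiral_low algebra_simps)
  next
    case False
    then show ?thesis using k spiral_rhombus2[OF k, of "- 1" "int k - i - 1" "int k - j"]
      by (simp add: double_spiral_high algebra_simps)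
  qed
  show "double_spiral k (i - 1) (j + 1) + double_spiral k (i + 1) j \<le> double_spiral k i j + double_spiral k i (j + 1)"
  proof (cases "i + j + 1 \<le> int k")
    case True
    then show ?thesis using spiral_rhombus3[OF k _ True, of 1] by (simp add: double_spiral_low algebra_simps)
  next
    case False
    then show ?thesis using k spiral_rhombus3[OF k, of "- 1" "int k - i" "int k - j - 1"]
      by (simp add: double_spiral_high algebra_simps)
  qed
qed

section \<open>Unwinding a spiral\<close>

lemma affine_fun_zero:
  assumes "affine_fun_on X E" "(p1, q1) \<in> X" "(p2, q2) \<in> X" "(p3, q3) \<in> X"
    and "E p1 q1 = 0" "E p2 q2 = 0" "E p3 q3 = 0"
    and det: "(p2 - p1) * (q3 - q1) \<noteq> (p3 - p1) * (q2 - q1)" and "(p, q) \<in> X"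
  shows "E p q = 0"
proof -
  obtain a b c where E: "\<And>p q. (p, q) \<in> X \<Longrightarrow> E p q = a * of_int p + b * of_int q + c"
    using assms(1) unfolding affine_fun_on_def by blast
  have 1: "a * of_int p1 + b * of_int q1 + c = 0" using E[OF assms(2)] assms(5) by simp
  have 2: "a * of_int (p2 - p1) + b * of_int (q2 - q1) = 0"
    using E[OF assms(3)] assms(6) 1 by (simp add: algebra_simps)
  have 3: "a * of_int (p3 - p1) + b * of_int (q3 - q1) = 0"
    using E[OF assms(4)] assms(7) 1 by (simp add: algebra_simps)
  define D :: real where "D = of_int ((p2 - p1) * (q3 - q1) - (p3 - p1) * (q2 - q1))"
  have D: "D \<noteq> 0" unfolding D_def of_int_eq_0_iff using det by simp
  have "a * D = (a * of_int (p2 - p1) + b * of_int (q2 - q1)) * of_int (q3 - q1)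
      - (a * of_int (p3 - p1) + b * of_int (q3 - q1)) * of_int (q2 - q1)"
    unfolding D_def of_int_diff of_int_mult by (simp add: algebra_simps)
  then have "a * D = 0" unfolding 2 3 by simp
  moreover have "b * D = (a * of_int (p3 - p1) + b * of_int (q3 - q1)) * of_int (p2 - p1)
      - (a * of_int (p2 - p1) + b * of_int (q2 - q1)) * of_int (p3 - p1)"
    unfolding D_def of_int_diff of_int_mult by (simp add: algebra_simps)
  then have "b * D = 0" unfolding 2 3 by simp
  ultimately have "a = 0" "b = 0" using D by auto
  then show ?thesis using E[OF assms(9)] 1 by simp
qed

text \<open>
  For \<open>rigid\<close> in local form: \<open>E\<close> is affine on the cells of
  \<open>f\<close> inside \<open>Y\<close>.
\<close>

definition inherits :: "(int \<Rightarrow> int \<Rightarrow> real) \<Rightarrow> (int \<times> int) set \<Rightarrow> (int \<Rightarrow> int \<Rightarrow> real) \<Rightarrow> bool" where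
  "inherits f Y E \<longleftrightarrow>
    (\<forall>X. X \<subseteq> Y \<longrightarrow> has_unit_triangle X \<longrightarrow> affine_fun_on X f \<longrightarrow> affine_fun_on X E)"

lemma inherits_zero:
  assumes "inherits f Y E" "X \<subseteq> Y" "affine_fun_on X f"
    and "s \<in> {1, - 1}" "(m, n) \<in> X" "(m + s, n) \<in> X" "(m, n + s) \<in> X"
    and "(p1, q1) \<in> X \<and> E p1 q1 = 0" "(p2, q2) \<in> X \<and> E p2 q2 = 0" "(p3, q3) \<in> X \<and> E p3 q3 = 0"
    and "(p2 - p1) * (q3 - q1) \<noteq> (p3 - p1) * (q2 - q1)"
  shows "\<forall>(p, q) \<in> X. E p q = 0"
proof -
  have "has_unit_triangle X" unfolding has_unit_triangle_def using assms(4-7) by blast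
  then have "affine_fun_on X E" using assms(1-3) unfolding inherits_def by blast
  then show ?thesis using affine_fun_zero assms(8-11) by (smt (verit) case_prodI2)
qed

text \<open>
  On two adjacent levels of an integral linear form every function of the level is affine. This
  covers the trapezoids between consecutive turns of the spiral, whatever the ramp is.
\<close>

lemma affine_fun_on_level:
  assumes "\<And>p q. (p, q) \<in> X \<Longrightarrow> (u * p + v * q = w \<or> u * p + v * q = w + 1) \<and>
      f p q = G (u * p + v * q) + \<alpha> * of_int p + \<beta> * of_int q"
  shows "affine_fun_on X f"
proof -
  define d where "d = G (w + 1) - G w"
  have "f p q = (\<alpha> + d * of_int u) * of_int p + (\<beta> + d * of_int v) * of_int q + (G w - d * of_int w)"
    if "(p, q) \<in> X" for p q
  proof -
    have "G L = G w + d * (of_int L - of_int w)" if "L = w \<or> L = w + 1" for L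
      using that by (auto simp: d_def)
    then have "G (u * p + v * q) = G w + d * (of_int (u * p + v * q) - of_int w)"
      using assms[OF that] by blast
    then show ?thesis using assms[OF that] by (simp add: algebra_simps)
  qed
  then show ?thesis unfolding affine_fun_on_def by blast
qed

definition hexagon :: "nat \<Rightarrow> (int \<times> int) set" where
  "hexagon k = {(i, j). \<bar>i\<bar> \<le> int k \<and> \<bar>j\<bar> \<le> int k \<and> \<bar>i + j\<bar> \<le> int k}"

text \<open>
  The first five sides of the \<open>t\<close>-th turn. The sixth side is treated apart, since
  on the outermost turn it is the common side of the two spirals, about which only the end
  points are known.
\<close>

definition zero_ring :: "(int \<Rightarrow> int \<Rightarrow> real) \<Rightarrow> int \<Rightarrow> bool" where
  "zero_ring E t \<longleftrightarrow> (\<forall>i j.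
     (i \<le> 0 \<and> 0 \<le> i + j \<and> j = t \<longrightarrow> E i j = 0) \<and>
     (0 \<le> j \<and> i + j \<le> 0 \<and> i = - t \<longrightarrow> E i j = 0) \<and>
     (i \<le> 0 \<and> j \<le> 0 \<and> i + j = - t \<longrightarrow> E i j = 0) \<and>
     (0 \<le> i \<and> j \<le> 0 \<and> i + j \<le> 1 \<and> j = - t \<longrightarrow> E i j = 0) \<and>
     (1 \<le> i \<and> j \<le> 0 \<and> 1 \<le> i + j \<and> i = t + 1 \<longrightarrow> E i j = 0))"

lemma zero_ringI:
  assumes "\<And>i j. i \<le> 0 \<Longrightarrow> 0 \<le> i + j \<Longrightarrow> j = t \<Longrightarrow> E i j = 0"
    and "\<And>i j. 0 \<le> j \<Longrightarrow> i + j \<le> 0 \<Longrightarrow> i = - t \<Longrightarrow> E i j = 0"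
    and "\<And>i j. i \<le> 0 \<Longrightarrow> j \<le> 0 \<Longrightarrow> i + j = - t \<Longrightarrow> E i j = 0"
    and "\<And>i j. 0 \<le> i \<Longrightarrow> j \<le> 0 \<Longrightarrow> i + j \<le> 1 \<Longrightarrow> j = - t \<Longrightarrow> E i j = 0"
    and "\<And>i j. 1 \<le> i \<Longrightarrow> j \<le> 0 \<Longrightarrow> 1 \<le> i + j \<Longrightarrow> i = t + 1 \<Longrightarrow> E i j = 0"
  shows "zero_ring E t"
  unfolding zero_ring_def using assms by simp

context
  fixes k :: nat and \<theta> :: real and E :: "int \<Rightarrow> int \<Rightarrow> real"
  assumes k: "k > 0" and \<theta>: "\<theta> \<in> {1, - 1}" and E: "inherits (spiral k \<theta>) (hexagon k) E"
begin

text \<open>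
  The following six lemmas treat one trapezoid each, between the turns \<open>t - 1\<close> and
  \<open>t\<close> or, in this first lemma, the turns ending at \<open>(0, t)\<close> and
  \<open>(0, t + 1)\<close>: if \<open>E\<close> vanishes at two points of the outer base and at
  one point of the inner base, then it vanishes on the whole inner base.
\<close>

lemma zero_front:
  assumes "0 \<le> t" "t + 1 \<le> int k" "E (t + 1) 0 = 0" "E 0 (t + 1) = 0" "E 0 t = 0" "0 \<le> i" "0 \<le> j" "i + j = t \<or> i + j = t + 1"
  shows "E i j = 0"
proof -
  let ?X = "{(i, j). 0 \<le> i \<and> 0 \<le> j \<and> (i + j = t \<or> i + j = t + 1)}"
  have "\<forall>(p, q) \<in> ?X. E p q = 0"
  proof (rule inherits_zero[OF E])
    show "affine_fun_on ?X (spiral k \<theta>)"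
      by (rule affine_fun_on_level[of _ 1 1 t _ "\<lambda>w. - steep k \<theta> * rampB k w" 0 "1 - steep k \<theta>"])
        (auto simp: spiral_sector0[OF k \<theta>])
    show "1 \<in> {1, - 1 :: int}" "(0, t) \<in> ?X" "(0 + 1, t) \<in> ?X" "(0, t + 1) \<in> ?X" using assms(1) by auto
    show "?X \<subseteq> hexagon k" using assms(2) by (auto simp: hexagon_def)
    show "(t + 1, 0) \<in> ?X \<and> E (t + 1) 0 = 0" "(0, t + 1) \<in> ?X \<and> E 0 (t + 1) = 0" "(0, t) \<in> ?X \<and> E 0 t = 0"
      using assms by auto
    show "(0 - (t + 1)) * (t - 0) \<noteq> (0 - (t + 1)) * (t + 1 - 0)" using assms(1) by simp
  qed
  then show ?thesis using assms(6-8) by blast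
qed

lemma zero_sector1:
  assumes "1 \<le> t" "t \<le> int k" "E 0 t = 0" "E (- 1) t = 0" "E (1 - t) (t - 1) = 0" "i \<le> 0" "0 \<le> i + j" "j = t - 1"
  shows "E i j = 0"
proof -
  let ?X = "{(i, j). i \<le> 0 \<and> 0 \<le> i + j \<and> (j = t - 1 \<or> j = t)}"
  have "\<forall>(p, q) \<in> ?X. E p q = 0"
  proof (rule inherits_zero[OF E])
    show "affine_fun_on ?X (spiral k \<theta>)"
      by (rule affine_fun_on_level[of _ 0 1 "t - 1" _ "\<lambda>w. - steep k \<theta> * rampB k w" "2 + \<theta>" "1 - steep k \<theta>"])
        (auto simp: spiral_sector1[OF k \<theta>])
    show "- 1 \<in> {1, - 1 :: int}" "(0, t) \<in> ?X" "(0 + - 1, t) \<in> ?X" "(0, t + - 1) \<in> ?X" using assms(1) by auto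
    show "?X \<subseteq> hexagon k" using assms(2) by (auto simp: hexagon_def)
    show "(0, t) \<in> ?X \<and> E 0 t = 0" "(- 1, t) \<in> ?X \<and> E (- 1) t = 0" "(1 - t, t - 1) \<in> ?X \<and> E (1 - t) (t - 1) = 0"
      using assms by auto
    show "(- 1 - 0) * (t - 1 - t) \<noteq> (1 - t - 0) * (t - t)" by simp
  qed
  then show ?thesis using assms(6-8) by blast
qed

lemma zero_sector2:
  assumes "1 \<le> t" "t \<le> int k" "E (- t) 0 = 0" "E (- t) 1 = 0" "E (1 - t) 0 = 0" "0 \<le> j" "i + j \<le> 0" "i = 1 - t"
  shows "E i j = 0"
proof -
  let ?X = "{(i, j). 0 \<le> j \<and> i + j \<le> 0 \<and> (i = - t \<or> i = 1 - t)}"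
  have "\<forall>(p, q) \<in> ?X. E p q = 0"
  proof (rule inherits_zero[OF E])
    show "affine_fun_on ?X (spiral k \<theta>)"
      by (rule affine_fun_on_level[of _ 1 0 "- t" _ "\<lambda>w. - steep k \<theta> * rampA k w" "2 + \<theta>" 1])
        (auto simp: spiral_sector2[OF k \<theta>])
    show "1 \<in> {1, - 1 :: int}" "(- t, 0) \<in> ?X" "(- t + 1, 0) \<in> ?X" "(- t, 0 + 1) \<in> ?X" using assms(1) by auto
    show "?X \<subseteq> hexagon k" using assms(2) by (auto simp: hexagon_def)
    show "(- t, 0) \<in> ?X \<and> E (- t) 0 = 0" "(- t, 1) \<in> ?X \<and> E (- t) 1 = 0" "(1 - t, 0) \<in> ?X \<and> E (1 - t) 0 = 0"
      using assms by auto
    show "(- t - - t) * (0 - 0) \<noteq> (1 - t - - t) * (1 - 0)" by simp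
  qed
  then show ?thesis using assms(6-8) by blast
qed

lemma zero_sector3:
  assumes "1 \<le> t" "t \<le> int k" "E 0 (- t) = 0" "E (- 1) (1 - t) = 0" "E 0 (1 - t) = 0" "i \<le> 0" "j \<le> 0" "i + j = 1 - t"
  shows "E i j = 0"
proof -
  let ?X = "{(i, j). i \<le> 0 \<and> j \<le> 0 \<and> (i + j = - t \<or> i + j = 1 - t)}"
  have "\<forall>(p, q) \<in> ?X. E p q = 0"
  proof (rule inherits_zero[OF E])
    show "affine_fun_on ?X (spiral k \<theta>)"
      by (rule affine_fun_on_level[of _ 1 1 "- t" _ "\<lambda>w. - steep k \<theta> * rampB k w" "2 + \<theta>" "1 + \<theta>"])
        (auto simp: spiral_sector3[OF k \<theta>])
    show "- 1 \<in> {1, - 1 :: int}" "(0, 1 - t) \<in> ?X" "(0 + - 1, 1 - t) \<in> ?X" "(0, 1 - t + - 1) \<in> ?X" using assms(1) by auto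
    show "?X \<subseteq> hexagon k" using assms(2) by (auto simp: hexagon_def)
    show "(0, - t) \<in> ?X \<and> E 0 (- t) = 0" "(- 1, 1 - t) \<in> ?X \<and> E (- 1) (1 - t) = 0" "(0, 1 - t) \<in> ?X \<and> E 0 (1 - t) = 0"
      using assms by auto
    show "(- 1 - 0) * (1 - t - - t) \<noteq> (0 - 0) * (1 - t - - t)" by simp
  qed
  then show ?thesis using assms(6-8) by blast
qed

lemma zero_sector4:
  assumes "1 \<le> t" "t \<le> int k - 1" "E 0 (- t) = 0" "E 1 (- t) = 0" "E t (1 - t) = 0" "0 \<le> i" "j \<le> 0" "i + j \<le> 1" "j = 1 - t"
  shows "E i j = 0"
proof -
  let ?X = "{(i, j). 0 \<le> i \<and> j \<le> 0 \<and> i + j \<le> 1 \<and> (j = - t \<or> j = 1 - t)}"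
  have "\<forall>(p, q) \<in> ?X. E p q = 0"
  proof (rule inherits_zero[OF E])
    show "affine_fun_on ?X (spiral k \<theta>)"
      by (rule affine_fun_on_level[of _ 0 1 "- t" _ "\<lambda>w. - steep k \<theta> * rampB k w" 0 "1 + \<theta>"])
        (auto simp: spiral_sector4[OF k \<theta>])
    show "1 \<in> {1, - 1 :: int}" "(0, - t) \<in> ?X" "(0 + 1, - t) \<in> ?X" "(0, - t + 1) \<in> ?X" using assms(1) by auto
    show "?X \<subseteq> hexagon k" using assms(2) by (auto simp: hexagon_def)
    show "(0, - t) \<in> ?X \<and> E 0 (- t) = 0" "(1, - t) \<in> ?X \<and> E 1 (- t) = 0" "(t, 1 - t) \<in> ?X \<and> E t (1 - t) = 0"
      using assms by auto
    show "(1 - 0) * (1 - t - - t) \<noteq> (t - 0) * (- t - - t)" by simp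
  qed
  then show ?thesis using assms(6-9) by blast
qed

lemma zero_sector5:
  assumes "1 \<le> t" "t \<le> int k - 1" "E (t + 1) 0 = 0" "E (t + 1) (- 1) = 0" "E t 0 = 0" "1 \<le> i" "j \<le> 0" "1 \<le> i + j" "i = t"
  shows "E i j = 0"
proof -
  let ?X = "{(i, j). 1 \<le> i \<and> j \<le> 0 \<and> 1 \<le> i + j \<and> (i = t \<or> i = t + 1)}"
  have "\<forall>(p, q) \<in> ?X. E p q = 0"
  proof (rule inherits_zero[OF E])
    show "affine_fun_on ?X (spiral k \<theta>)"
      by (rule affine_fun_on_level[of _ 1 0 t _ "\<lambda>w. - steep k \<theta> * rampA k w" 0 "1 + \<theta>"])
        (use assms(2) in \<open>auto simp: spiral_sector5[OF k \<theta>]\<close>)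
    show "- 1 \<in> {1, - 1 :: int}" "(t + 1, 0) \<in> ?X" "(t + 1 + - 1, 0) \<in> ?X" "(t + 1, 0 + - 1) \<in> ?X" using assms(1) by auto
    show "?X \<subseteq> hexagon k" using assms(2) by (auto simp: hexagon_def)
    show "(t + 1, 0) \<in> ?X \<and> E (t + 1) 0 = 0" "(t + 1, - 1) \<in> ?X \<and> E (t + 1) (- 1) = 0" "(t, 0) \<in> ?X \<and> E t 0 = 0"
      using assms by auto
    show "(t + 1 - (t + 1)) * (0 - 0) \<noteq> (t - (t + 1)) * (- 1 - 0)" by simp
  qed
  then show ?thesis using assms(6-9) by blast
qed

text \<open>
  The spiral is run through backwards: the end of one inner base is the beginning of the next
  one, so every trapezoid has a known point on its inner base when its turn comes.
\<close>

lemma zero_ring_step: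
  assumes t: "1 \<le> t" "t \<le> int k - 1" and ring: "zero_ring E t" and ends: "E (t + 1) 0 = 0" "E 0 (t + 1) = 0"
  shows "zero_ring E (t - 1) \<and> (\<forall>i j. 0 \<le> i \<and> 0 \<le> j \<and> i + j = t \<longrightarrow> E i j = 0)"
proof -
  have r1: "E i j = 0" if "i \<le> 0" "0 \<le> i + j" "j = t" for i j
    using ring that unfolding zero_ring_def by blast
  have r2: "E i j = 0" if "0 \<le> j" "i + j \<le> 0" "i = - t" for i j
    using ring that unfolding zero_ring_def by blast
  have r3: "E i j = 0" if "i \<le> 0" "j \<le> 0" "i + j = - t" for i j
    using ring that unfolding zero_ring_def by blast
  have r4: "E i j = 0" if "0 \<le> i" "j \<le> 0" "i + j \<le> 1" "j = - t" for i j
    using ring that unfolding zero_ring_def by blast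
  have r5: "E i j = 0" if "1 \<le> i" "j \<le> 0" "1 \<le> i + j" "i = t + 1" for i j
    using ring that unfolding zero_ring_def by blast
  have 0: "E i j = 0" if "0 \<le> i" "0 \<le> j" "i + j = t" for i j
    by (rule zero_front[of t]) (use t ends r1[of 0 t] that in auto)
  have 5: "E i j = 0" if "1 \<le> i" "j \<le> 0" "1 \<le> i + j" "i = t" for i j
    by (rule zero_sector5[of t]) (use t ends r5[of "t + 1" "- 1"] 0[of t 0] that in auto)
  have 4: "E i j = 0" if "0 \<le> i" "j \<le> 0" "i + j \<le> 1" "j = 1 - t" for i j
    by (rule zero_sector4[of t]) (use t r4[of 0 "- t"] r4[of 1 "- t"] 5[of t "1 - t"] that in auto)
  have 3: "E i j = 0" if "i \<le> 0" "j \<le> 0" "i + j = 1 - t" for i j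
    by (rule zero_sector3[of t]) (use t r3[of 0 "- t"] r3[of "- 1" "1 - t"] 4[of 0 "1 - t"] that in auto)
  have 2: "E i j = 0" if "0 \<le> j" "i + j \<le> 0" "i = 1 - t" for i j
    by (rule zero_sector2[of t]) (use t r2[of 0 "- t"] r2[of 1 "- t"] 3[of "1 - t" 0] that in auto)
  have 1: "E i j = 0" if "i \<le> 0" "0 \<le> i + j" "j = t - 1" for i j
    by (rule zero_sector1[of t]) (use t r1[of 0 t] r1[of "- 1" t] 2[of "t - 1" "1 - t"] that in auto)
  have "zero_ring E (t - 1)"
    by (rule zero_ringI) (use 1 2 3 4 5 in simp_all)
  then show ?thesis using 0 by blast
qed

lemma spiral_unwinds:
  assumes ring: "zero_ring E (int k - 1)" and ends: "E (int k) 0 = 0" "E 0 (int k) = 0"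
  shows "\<forall>t. 0 \<le> t \<and> t \<le> int k - 1 \<longrightarrow> zero_ring E t" "0 \<le> i \<Longrightarrow> 0 \<le> j \<Longrightarrow> i + j \<le> int k \<Longrightarrow> E i j = 0"
proof -
  have main: "zero_ring E (int k - 1 - int n) \<and> (\<forall>i j. 0 \<le> i \<and> 0 \<le> j \<and> i + j = int k - int n \<longrightarrow> E i j = 0)"
    if "int n \<le> int k - 1" for n
    using that
  proof (induction n)
    case 0
    have "E i j = 0" if "0 \<le> i" "0 \<le> j" "i + j = int k" for i j
    proof (rule zero_front[of "int k - 1"])
      show "E 0 (int k - 1) = 0"
        using ring[unfolded zero_ring_def, rule_format, THEN conjunct1, of 0 "int k - 1"] k by simp
    qed (use k ends that in auto)
    then show ?case using ring by simp
  next
    case (Suc n)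
    have e: "int k - 1 - int n = int k - int (Suc n)" "int k - 1 - int (Suc n) = int k - int (Suc n) - 1"
      by simp_all
    have "zero_ring E (int k - 1 - int n - 1) \<and> (\<forall>i j. 0 \<le> i \<and> 0 \<le> j \<and> i + j = int k - 1 - int n \<longrightarrow> E i j = 0)"
      by (rule zero_ring_step) (use Suc in auto)
    then show ?case unfolding e .
  qed
  have *: "zero_ring E t" if "0 \<le> t" "t \<le> int k - 1" for t
    using main[of "nat (int k - 1 - t)"] that by simp
  then show "\<forall>t. 0 \<le> t \<and> t \<le> int k - 1 \<longrightarrow> zero_ring E t" by blast
  show "E i j = 0" if ij: "0 \<le> i" "0 \<le> j" "i + j \<le> int k"
  proof (cases "i + j = 0")
    case True
    then show ?thesis using *[of 0] k ij by (auto simp: zero_ring_def)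
  next
    case False
    then show ?thesis using main[of "nat (int k - (i + j))"] ij by simp
  qed
qed

end

section \<open>The cells outside of the spirals\<close>

text \<open>
  The five unbounded cells of the last turn, numbered by their sectors. The sixth sector has
  none, as it ends at the line where the spirals are glued.
\<close>

definition outer :: "nat \<Rightarrow> int \<Rightarrow> (int \<times> int) set" where
  "outer k m =
    (if m = 1 then {(i, j). i \<le> 0 \<and> 0 \<le> i + j \<and> i + j \<le> int k \<and> int k - 1 \<le> j}
     else if m = 2 then {(i, j). 0 \<le> j \<and> i + j \<le> 0 \<and> i \<le> 1 - int k}
     else if m = 3 then {(i, j). i \<le> 0 \<and> j \<le> 0 \<and> i + j \<le> 1 - int k}
     else if m = 4 then {(i, j). 0 \<le> i \<and> j \<le> 0 \<and> i + j \<le> 1 \<and> j \<le> 1 - int k}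
     else {(i, j). int k \<le> i \<and> j \<le> 0 \<and> 1 \<le> i + j \<and> i + j \<le> int k})"

lemma mem_outer:
  "(i, j) \<in> outer k 1 \<longleftrightarrow> i \<le> 0 \<and> 0 \<le> i + j \<and> i + j \<le> int k \<and> int k - 1 \<le> j"
  "(i, j) \<in> outer k 2 \<longleftrightarrow> 0 \<le> j \<and> i + j \<le> 0 \<and> i \<le> 1 - int k"
  "(i, j) \<in> outer k 3 \<longleftrightarrow> i \<le> 0 \<and> j \<le> 0 \<and> i + j \<le> 1 - int k"
  "(i, j) \<in> outer k 4 \<longleftrightarrow> 0 \<le> i \<and> j \<le> 0 \<and> i + j \<le> 1 \<and> j \<le> 1 - int k"
  "(i, j) \<in> outer k 5 \<longleftrightarrow> int k \<le> i \<and> j \<le> 0 \<and> 1 \<le> i + j \<and> i + j \<le> int k"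
  by (simp_all add: outer_def)

lemma affine_fun_onI:
  assumes "\<And>p q. (p, q) \<in> X \<Longrightarrow> f p q = \<alpha> * of_int p + \<beta> * of_int q + \<gamma>"
  shows "affine_fun_on X f"
  using assms unfolding affine_fun_on_def by blast

text \<open>
  All gradients are integral: the terms \<open>\<theta> / k\<close> enter the slope of the
  \<open>k\<close>-th turn with the factor \<open>k\<close>. This is how the fraction \<open>1 /
  k\<close> is hidden from the boundary.
\<close>

lemma spiral_outer:
  assumes k: "k > 0" and \<theta>: "\<theta> \<in> {1, - 1}"
  defines "\<gamma> \<equiv> \<theta> * (real k - 1) / 2 - real k * (real k - 1) / 2"
  shows "(i, j) \<in> outer k 1 \<Longrightarrow> spiral k \<theta> i j = (2 + \<theta>) * of_int i + (\<theta> - real k + 1) * of_int j + (\<gamma> + (real k - 1) * (real k - \<theta>))"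
    "(i, j) \<in> outer k 2 \<Longrightarrow> spiral k \<theta> i j = (2 + real k) * of_int i + 1 * of_int j + (\<gamma> + (real k - 1) * (real k - \<theta>))"
    "(i, j) \<in> outer k 3 \<Longrightarrow> spiral k \<theta> i j = (2 + real k) * of_int i + (1 + real k) * of_int j + (\<gamma> + (real k - 1) * (real k - \<theta>))"
    "(i, j) \<in> outer k 4 \<Longrightarrow> spiral k \<theta> i j = 0 * of_int i + (1 + real k) * of_int j + (\<gamma> + (real k - 1) * (real k - \<theta>))"
    "(i, j) \<in> outer k 5 \<Longrightarrow> spiral k \<theta> i j = (\<theta> - real k) * of_int i + (1 + \<theta>) * of_int j + (\<gamma> + real k * (real k - \<theta>))"
proof -
  show "spiral k \<theta> i j = (2 + \<theta>) * of_int i + (\<theta> - real k + 1) * of_int j + (\<gamma> + (real k - 1) * (real k - \<theta>))" if "(i, j) \<in> outer k 1"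
  proof -
    have s: "spiral k \<theta> i j = - steep k \<theta> * rampB k j + (1 - steep k \<theta>) * of_int j + (2 + \<theta>) * of_int i"
      using that spiral_sector1[OF k \<theta>] by (simp add: mem_outer)
    have r: "rampB k j = real k * (real k - 1) / 2 + (real k - 1) * (of_int j - real k)"
      using that rampB_above[OF k] by (simp add: mem_outer)
    show ?thesis unfolding s r steep_def \<gamma>_def using k by (simp add: field_simps)
  qed
  have A: "rampA k w = real k * (real k - 1) / 2 + real k * (1 - of_int w - real k)" if "w \<le> 1 - int k" for w
    using capped_reflect[of k w] rampA_above[of k "1 - w"] that by (simp add: rampA_def)
  have B: "rampB k w = real k * (real k - 1) / 2 + real k * (1 - of_int w - real k)" if "w \<le> 1 - int k" for w
    using rampB_reflect[OF k \<theta>, of w] rampA_above[of k "1 - w"] that k by simp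
  show "spiral k \<theta> i j = (2 + real k) * of_int i + 1 * of_int j + (\<gamma> + (real k - 1) * (real k - \<theta>))" if "(i, j) \<in> outer k 2"
  proof -
    have s: "spiral k \<theta> i j = - steep k \<theta> * rampA k i + (2 + \<theta>) * of_int i + of_int j"
      using that spiral_sector2[OF k \<theta>] by (simp add: mem_outer)
    show ?thesis unfolding s steep_def \<gamma>_def using k A[of i] that by (simp add: mem_outer) (simp add: field_simps)
  qed
  show "spiral k \<theta> i j = (2 + real k) * of_int i + (1 + real k) * of_int j + (\<gamma> + (real k - 1) * (real k - \<theta>))" if "(i, j) \<in> outer k 3"
  proof -
    have s: "spiral k \<theta> i j = - steep k \<theta> * rampB k (i + j) + (2 + \<theta>) * of_int i + (1 + \<theta>) * of_int j"
      using that spiral_sector3[OF k \<theta>] by (simp add: mem_outer)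
    show ?thesis unfolding s steep_def \<gamma>_def using k B[of "i + j"] that by (simp add: mem_outer) (simp add: field_simps)
  qed
  show "spiral k \<theta> i j = 0 * of_int i + (1 + real k) * of_int j + (\<gamma> + (real k - 1) * (real k - \<theta>))" if "(i, j) \<in> outer k 4"
  proof -
    have s: "spiral k \<theta> i j = - steep k \<theta> * rampB k j + (1 + \<theta>) * of_int j"
      using that spiral_sector4[OF k \<theta>] by (simp add: mem_outer)
    show ?thesis unfolding s steep_def \<gamma>_def using k B[of j] that by (simp add: mem_outer) (simp add: field_simps)
  qed
  show "spiral k \<theta> i j = (\<theta> - real k) * of_int i + (1 + \<theta>) * of_int j + (\<gamma> + real k * (real k - \<theta>))" if "(i, j) \<in> outer k 5"
  proof -
    have s: "spiral k \<theta> i j = - steep k \<theta> * rampA k i + (1 + \<theta>) * of_int j"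
      using that spiral_sector5[OF k \<theta>] k by (simp add: mem_outer)
    show ?thesis unfolding s steep_def \<gamma>_def using k rampA_above[of k i] that by (simp add: mem_outer) (simp add: field_simps)
  qed
qed

lemma affine_fun_on_subset: "affine_fun_on X f \<Longrightarrow> Y \<subseteq> X \<Longrightarrow> affine_fun_on Y f"
  unfolding affine_fun_on_def by blast

lemma affine_on_outer:
  assumes k: "k > 0" and \<theta>: "\<theta> \<in> {1, - 1}" and "m \<in> {1, 2, 3, 4, 5}"
  shows "affine_fun_on (outer k m \<inter> Y) (spiral k \<theta>)"
proof -
  have "affine_fun_on (outer k m) (spiral k \<theta>)"
    using assms(3) by (elim insertE emptyE; simp only:; intro affine_fun_onI) (erule spiral_outer[OF k \<theta>])+
  then show ?thesis by (rule affine_fun_on_subset) simp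
qed

text \<open>
  The values on all outer cells are congruent modulo 1 to the same multiple of \<open>1 /
  2\<close>, so their differences are integral.
\<close>

lemma spiral_outer_integral:
  assumes k: "k > 0" and \<theta>: "\<theta> \<in> {1, - 1}" and "m \<in> {1, 2, 3, 4, 5}" "(i, j) \<in> outer k m"
  shows "spiral k \<theta> i j + (real k - 1) / 2 \<in> \<int>"
proof -
  have th: "\<theta> \<in> \<int>" using \<theta> by auto
  have half: "\<theta> * (real k - 1) / 2 - real k * (real k - 1) / 2 + (real k - 1) / 2 \<in> \<int>"
  proof -
    have tri: "real k * (real k - 1) / 2 \<in> \<int>"
    proof -
      have "even (int k * (int k - 1))" by simp
      then obtain d where "int k * (int k - 1) = 2 * d" by (elim evenE)
      then have "real k * (real k - 1) = 2 * of_int d" by (metis of_int_mult of_int_diff of_int_1 of_int_numeral of_int_of_nat_eq)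
      then show ?thesis by simp
    qed
    have "\<theta> * (real k - 1) / 2 + (real k - 1) / 2 = (if \<theta> = 1 then real k - 1 else 0)"
      using \<theta> by (auto simp flip: add_divide_distrib)
    then have "\<theta> * (real k - 1) / 2 + (real k - 1) / 2 \<in> \<int>" by simp
    then have "\<theta> * (real k - 1) / 2 + (real k - 1) / 2 - real k * (real k - 1) / 2 \<in> \<int>" using tri by (rule Ints_diff)
    then show ?thesis by (simp add: algebra_simps)
  qed
  obtain z where z: "z \<in> \<int>" "spiral k \<theta> i j = z + (\<theta> * (real k - 1) / 2 - real k * (real k - 1) / 2)"
  proof -
    have ints: "of_int i \<in> (\<int> :: real set)" "of_int j \<in> (\<int> :: real set)" "real k \<in> \<int>" by simp_all
    show ?thesis
      using assms(3,4) spiral_outer[OF k \<theta>, of i j]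
      apply (elim insertE emptyE; simp only:)
      subgoal by (rule that[of "(2 + \<theta>) * of_int i + (\<theta> - real k + 1) * of_int j + (real k - 1) * (real k - \<theta>)"])
          (use th ints in \<open>auto intro!: Ints_add Ints_mult Ints_diff simp: algebra_simps\<close>)
      subgoal by (rule that[of "(2 + real k) * of_int i + of_int j + (real k - 1) * (real k - \<theta>)"])
          (use th ints in \<open>auto intro!: Ints_add Ints_mult Ints_diff\<close>)
      subgoal by (rule that[of "(2 + real k) * of_int i + (1 + real k) * of_int j + (real k - 1) * (real k - \<theta>)"])
          (use th ints in \<open>auto intro!: Ints_add Ints_mult Ints_diff\<close>)
      subgoal by (rule that[of "(1 + real k) * of_int j + (real k - 1) * (real k - \<theta>)"])
          (use th ints in \<open>auto intro!: Ints_add Ints_mult Ints_diff\<close>)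
      subgoal by (rule that[of "(\<theta> - real k) * of_int i + (1 + \<theta>) * of_int j + real k * (real k - \<theta>)"])
          (use th ints in \<open>auto intro!: Ints_add Ints_mult Ints_diff\<close>)
      done
  qed
  show ?thesis using Ints_add[OF z(1) half] by (simp add: z(2) algebra_simps)
qed

lemma outerI:
  assumes "i + j \<le> int k" "i \<le> - int k \<or> j \<le> - int k \<or> 2 * int k \<le> i \<or> 2 * int k \<le> j \<or> i + j \<le> - int k"
  shows "\<exists>m \<in> {1, 2, 3, 4, 5}. (i, j) \<in> outer k m"
proof -
  have "(i, j) \<in> outer k 1 \<or> (i, j) \<in> outer k 2 \<or> (i, j) \<in> outer k 3 \<or> (i, j) \<in> outer k 4 \<or> (i, j) \<in> outer k 5"
    using assms unfolding mem_outer by linarith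
  then show ?thesis by blast
qed

text \<open>
  The outer cells contain the first five sides of the outermost turn and both ends of the sixth
  one; from there the spiral unwinds.
\<close>

lemma zero_if_zero_outer:
  assumes k: "k > 0" and \<theta>: "\<theta> \<in> {1, - 1}" and E: "inherits (spiral k \<theta>) Y E" and Y: "hexagon k \<subseteq> Y"
    and out: "\<And>m i j. m \<in> {1, 2, 3, 4, 5} \<Longrightarrow> (i, j) \<in> outer k m \<inter> Y \<Longrightarrow> E i j = 0"
    and ij: "(i, j) \<in> Y" "i + j \<le> int k"
  shows "E i j = 0"
proof -
  have H: "inherits (spiral k \<theta>) (hexagon k) E" using E Y unfolding inherits_def by blast
  have o: "E i j = 0" if "(i, j) \<in> outer k m" "m \<in> {1, 2, 3, 4, 5}" "(i, j) \<in> hexagon k" for i j m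
    using out that Y by blast
  have "zero_ring E (int k - 1)"
  proof (rule zero_ringI, goal_cases)
    case (1 i j) then show ?case using k by (intro o[of i j 1]) (auto simp: mem_outer hexagon_def)
  next
    case (2 i j) then show ?case using k by (intro o[of i j 2]) (auto simp: mem_outer hexagon_def)
  next
    case (3 i j) then show ?case using k by (intro o[of i j 3]) (auto simp: mem_outer hexagon_def)
  next
    case (4 i j) then show ?case using k by (intro o[of i j 4]) (auto simp: mem_outer hexagon_def)
  next
    case (5 i j) then show ?case using k by (intro o[of i j 5]) (auto simp: mem_outer hexagon_def)
  qed
  moreover have "E (int k) 0 = 0" by (rule o[of _ _ 5]) (use k in \<open>auto simp: mem_outer hexagon_def\<close>)
  moreover have "E 0 (int k) = 0" by (rule o[of _ _ 1]) (use k in \<open>auto simp: mem_outer hexagon_def\<close>)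
  ultimately have rings: "\<And>t. 0 \<le> t \<Longrightarrow> t \<le> int k - 1 \<Longrightarrow> zero_ring E t"
    and front: "\<And>i j. 0 \<le> i \<Longrightarrow> 0 \<le> j \<Longrightarrow> i + j \<le> int k \<Longrightarrow> E i j = 0"
    using spiral_unwinds[OF k \<theta> H] by blast+
  consider "0 \<le> i" "0 \<le> j" | "i \<le> 0" "0 \<le> i + j" "0 \<le> j" | "0 \<le> j" "i + j \<le> 0" "i \<le> 0" | "i \<le> 0" "j \<le> 0" "i + j \<le> 0"
    | "0 \<le> i" "j \<le> 0" "i + j \<le> 1" | "1 \<le> i" "j \<le> 0" "1 \<le> i + j" by linarith
  then show ?thesis
  proof cases
    case 1
    then show ?thesis using front ij by blast
  next
    case 2
    show ?thesis
    proof (cases "int k - 1 \<le> j")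
      case True
      then show ?thesis using out[of 1 i j] ij 2 unfolding Int_iff mem_outer by simp
    next
      case False
      then show ?thesis using rings[of j] 2 unfolding zero_ring_def by simp
    qed
  next
    case 3
    show ?thesis
    proof (cases "i \<le> 1 - int k")
      case True
      then show ?thesis using out[of 2 i j] ij 3 unfolding Int_iff mem_outer by simp
    next
      case False
      then show ?thesis using rings[of "- i"] 3 unfolding zero_ring_def by simp
    qed
  next
    case 4
    show ?thesis
    proof (cases "i + j \<le> 1 - int k")
      case True
      then show ?thesis using out[of 3 i j] ij 4 unfolding Int_iff mem_outer by simp
    next
      case False
      then show ?thesis using rings[of "- (i + j)"] 4 unfolding zero_ring_def by simp
    qed
  next
    case 5
    show ?thesis
    proof (cases "j \<le> 1 - int k")
      case True
      then show ?thesis using out[of 4 i j] ij 5 unfolding Int_iff mem_outer by simp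
    next
      case False
      then show ?thesis using rings[of "- j"] 5 unfolding zero_ring_def by simp
    qed
  next
    case 6
    show ?thesis
    proof (cases "int k \<le> i")
      case True
      then show ?thesis using out[of 5 i j] ij 6 unfolding Int_iff mem_outer by simp
    next
      case False
      then have "zero_ring E (i - 1)" using rings 6 by simp
      then show ?thesis using 6 unfolding zero_ring_def by (elim allE[of _ i] allE[of _ j]) simp
    qed
  qed
qed

section \<open>Rigidity of the double spiral\<close>

text \<open>
  The grid of size \<open>5 * k\<close> in the coordinates of the first spiral, whose centre is
  the grid point \<open>(k, k)\<close>. This is large enough for each outer cell which is used
  below to reach the fixed sides along at least one edge.
\<close>

definition shifted_pts :: "nat \<Rightarrow> (int \<times> int) set" where
  "shifted_pts k = {(i, j). - int k \<le> i \<and> - int k \<le> j \<and> i + j \<le> 3 * int k}"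

lemma inherits_low:
  assumes "inherits (double_spiral k) (shifted_pts k) E"
  shows "inherits (spiral k 1) {(i, j). i + j \<le> int k \<and> - int k \<le> i \<and> - int k \<le> j} E"
  unfolding inherits_def
proof (intro allI impI)
  fix X assume X: "X \<subseteq> {(i, j). i + j \<le> int k \<and> - int k \<le> i \<and> - int k \<le> j}" "has_unit_triangle X"
    "affine_fun_on X (spiral k 1)"
  obtain \<alpha> \<beta> \<gamma> where a: "\<And>i j. (i, j) \<in> X \<Longrightarrow> spiral k 1 i j = \<alpha> * of_int i + \<beta> * of_int j + \<gamma>"
    using X(3) unfolding affine_fun_on_def by blast
  have "double_spiral k i j = (\<alpha> + k) * of_int i + (\<beta> + k) * of_int j + \<gamma>" if "(i, j) \<in> X" for i j
    using a[OF that] X(1) that double_spiral_low[of i j k] by (auto simp: algebra_simps)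
  then have "affine_fun_on X (double_spiral k)" by (rule affine_fun_onI)
  moreover have "X \<subseteq> shifted_pts k" using X(1) by (auto simp: shifted_pts_def)
  ultimately show "affine_fun_on X E" using assms X(2) unfolding inherits_def by blast
qed

lemma inherits_high:
  assumes k: "k > 0" and E: "inherits (double_spiral k) (shifted_pts k) E"
  shows "inherits (spiral k (- 1)) {(i, j). i + j \<le> int k \<and> i \<le> 2 * int k \<and> j \<le> 2 * int k \<and> - int k \<le> i + j}
    (\<lambda>i j. E (int k - i) (int k - j))"
  unfolding inherits_def
proof (intro allI impI)
  fix X assume X: "X \<subseteq> {(i, j). i + j \<le> int k \<and> i \<le> 2 * int k \<and> j \<le> 2 * int k \<and> - int k \<le> i + j}"
    "has_unit_triangle X" "affine_fun_on X (spiral k (- 1))"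
  define X' where "X' = {(i, j). (int k - i, int k - j) \<in> X}"
  obtain \<alpha> \<beta> \<gamma> where a: "\<And>i j. (i, j) \<in> X \<Longrightarrow> spiral k (- 1) i j = \<alpha> * of_int i + \<beta> * of_int j + \<gamma>"
    using X(3) unfolding affine_fun_on_def by blast
  have "double_spiral k i j = (- \<alpha> - k) * of_int i + (- \<beta> - k) * of_int j + (\<gamma> + \<alpha> * k + \<beta> * k + 2 * k * k + k)"
    if "(i, j) \<in> X'" for i j
  proof -
    have m: "(int k - i, int k - j) \<in> X" using that by (simp add: X'_def)
    then have "int k \<le> i + j" using X(1) by auto
    then show ?thesis using a[OF m] double_spiral_high[OF k, of i j] by (simp add: algebra_simps)
  qed
  then have "affine_fun_on X' (double_spiral k)" by (rule affine_fun_onI)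
  moreover have "X' \<subseteq> shifted_pts k" using X(1) by (auto simp: shifted_pts_def X'_def)
  moreover have "has_unit_triangle X'"
  proof -
    obtain s m n where s: "s \<in> {1, - 1}" "{(m, n), (m + s, n), (m, n + s)} \<subseteq> X"
      using X(2) unfolding has_unit_triangle_def by blast
    then have "- s \<in> {1, - 1} \<and> {(int k - m, int k - n), (int k - m + - s, int k - n), (int k - m, int k - n + - s)} \<subseteq> X'"
      by (auto simp: X'_def algebra_simps)
    then show ?thesis unfolding has_unit_triangle_def by blast
  qed
  ultimately have "affine_fun_on X' E" using E unfolding inherits_def by blast
  then obtain \<alpha>' \<beta>' \<gamma>' where b: "\<And>i j. (i, j) \<in> X' \<Longrightarrow> E i j = \<alpha>' * of_int i + \<beta>' * of_int j + \<gamma>'"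
    unfolding affine_fun_on_def by blast
  have "E (int k - i) (int k - j) = (- \<alpha>') * of_int i + (- \<beta>') * of_int j + (\<gamma>' + \<alpha>' * k + \<beta>' * k)" if "(i, j) \<in> X" for i j
    using b[of "int k - i" "int k - j"] that by (simp add: X'_def algebra_simps)
  then show "affine_fun_on X (\<lambda>i j. E (int k - i) (int k - j))" by (rule affine_fun_onI)
qed

lemma zero_on_outer:
  assumes k: "k > 0" and \<theta>: "\<theta> \<in> {1, - 1}" and E: "inherits (spiral k \<theta>) Y E" and m: "m \<in> {1, 2, 3, 4, 5}"
    and unit: "s \<in> {1, - 1}" "(a, b) \<in> outer k m \<inter> Y" "(a + s, b) \<in> outer k m \<inter> Y" "(a, b + s) \<in> outer k m \<inter> Y"
    and zero: "(p1, q1) \<in> outer k m \<inter> Y \<and> E p1 q1 = 0" "(p2, q2) \<in> outer k m \<inter> Y \<and> E p2 q2 = 0"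
      "(p3, q3) \<in> outer k m \<inter> Y \<and> E p3 q3 = 0"
    and det: "(p2 - p1) * (q3 - q1) \<noteq> (p3 - p1) * (q2 - q1)"
    and ij: "(i, j) \<in> outer k m \<inter> Y"
  shows "E i j = 0"
  using inherits_zero[OF E _ affine_on_outer[OF k \<theta> m] unit zero det] ij by blast

text \<open>
  The corner between the two fixed sides lies in one cell, on which \<open>E\<close> vanishes.
  From there on, each further cell contains two points of a fixed side and a point of a cell
  treated before. The only exception is the last cell, which touches just the free side; it
  shares three noncollinear points with its two neighbours. Thus \<open>E\<close> vanishes on
  all ten outer cells, and both spirals unwind.
\<close>

lemma double_spiral_rigid:
  assumes k: "k \<ge> 2" and E: "inherits (double_spiral k) (shifted_pts k) E"
    and left: "\<And>j. (- int k, j) \<in> shifted_pts k \<Longrightarrow> E (- int k) j = 0"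
    and bottom: "\<And>i. (i, - int k) \<in> shifted_pts k \<Longrightarrow> E i (- int k) = 0"
    and ij: "(i, j) \<in> shifted_pts k"
  shows "E i j = 0"
proof -
  define F where "F i j = E (int k - i) (int k - j)" for i j
  define Y Z where "Y = {(i, j). i + j \<le> int k \<and> - int k \<le> i \<and> - int k \<le> j}"
    and "Z = {(i, j). i + j \<le> int k \<and> i \<le> 2 * int k \<and> j \<le> 2 * int k \<and> - int k \<le> i + j}"
  have k0: "k > 0" using k by simp
  have EY: "inherits (spiral k 1) Y E" unfolding Y_def by (rule inherits_low[OF E])
  have FZ: "inherits (spiral k (- 1)) Z F" unfolding Z_def F_def by (rule inherits_high[OF k0 E])
  have l: "E (- int k) j = 0" if "- int k \<le> j" "j \<le> 4 * int k" for j
    using that by (intro left) (simp add: shifted_pts_def)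
  have b: "E i (- int k) = 0" if "- int k \<le> i" "i \<le> 4 * int k" for i
    using that by (intro bottom) (simp add: shifted_pts_def)
  have fl: "F (2 * int k) j = 0" if "- 3 * int k \<le> j" "j \<le> 2 * int k" for j
    using l[of "int k - j"] that by (simp add: F_def)
  have fb: "F i (2 * int k) = 0" if "- 3 * int k \<le> i" "i \<le> 2 * int k" for i
    using b[of "int k - i"] that by (simp add: F_def)
  have FE: "F i j = E (int k - i) (int k - j)" for i j by (simp add: F_def)
  have one: "1 \<in> {1, - 1 :: real}" "- 1 \<in> {1, - 1 :: real}" by simp_all
  note mem = Int_iff mem_outer Y_def Z_def mem_Collect_eq prod.case
  have E3: "E i j = 0" if "(i, j) \<in> outer k 3 \<inter> Y" for i j
    by (rule zero_on_outer[OF k0 one(1) EY _ _ _ _ _ _ _ _ _ that, of 1 "- int k" "- int k"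
          "- int k" "- int k" "1 - int k" "- int k" "- int k" "1 - int k"])
      (use k l b in \<open>auto simp: mem\<close>)
  have E2: "E i j = 0" if "(i, j) \<in> outer k 2 \<inter> Y" for i j
    by (rule zero_on_outer[OF k0 one(1) EY _ _ _ _ _ _ _ _ _ that, of 1 "- int k" 0
          "- int k" 0 "- int k" 1 "1 - int k" 0])
      (use k l E3[of "1 - int k" 0] in \<open>auto simp: mem\<close>)
  have E1: "E i j = 0" if "(i, j) \<in> outer k 1 \<inter> Y" for i j
    by (rule zero_on_outer[OF k0 one(1) EY _ _ _ _ _ _ _ _ _ that, of 1 "- int k" "int k"
          "- int k" "int k" "- int k" "int k + 1" "1 - int k" "int k - 1"])
      (use k l E2[of "1 - int k" "int k - 1"] in \<open>auto simp: mem\<close>)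
  have E4: "E i j = 0" if "(i, j) \<in> outer k 4 \<inter> Y" for i j
    by (rule zero_on_outer[OF k0 one(1) EY _ _ _ _ _ _ _ _ _ that, of 1 0 "- int k"
          0 "- int k" 1 "- int k" 0 "1 - int k"])
      (use k b E3[of 0 "1 - int k"] in \<open>auto simp: mem\<close>)
  have E5: "E i j = 0" if "(i, j) \<in> outer k 5 \<inter> Y" for i j
    by (rule zero_on_outer[OF k0 one(1) EY _ _ _ _ _ _ _ _ _ that, of 1 "int k + 1" "- int k"
          "int k + 1" "- int k" "int k + 2" "- int k" "int k" "1 - int k"])
      (use k b E4[of "int k" "1 - int k"] in \<open>auto simp: mem\<close>)
  have F5: "F i j = 0" if "(i, j) \<in> outer k 5 \<inter> Z" for i j
    by (rule zero_on_outer[OF k0 one(2) FZ _ _ _ _ _ _ _ _ _ that, of "- 1" "2 * int k" "- int k"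
          "2 * int k" "- int k" "2 * int k" "- int k - 1" "2 * int k - 1" "1 - int k"])
      (use k fl E1[of "1 - int k" "2 * int k - 1"] FE[of "2 * int k - 1" "1 - int k"] in \<open>auto simp: mem\<close>)
  have F4: "F i j = 0" if "(i, j) \<in> outer k 4 \<inter> Z" for i j
    by (rule zero_on_outer[OF k0 one(2) FZ _ _ _ _ _ _ _ _ _ that, of "- 1" "2 * int k" "1 - 2 * int k"
          "2 * int k" "1 - 2 * int k" "2 * int k" "- 2 * int k" "2 * int k - 1" "2 - 2 * int k"])
      (use k fl F5[of "2 * int k - 1" "2 - 2 * int k"] in \<open>auto simp: mem\<close>)
  have F1: "F i j = 0" if "(i, j) \<in> outer k 1 \<inter> Z" for i j
    by (rule zero_on_outer[OF k0 one(2) FZ _ _ _ _ _ _ _ _ _ that, of "- 1" "- int k" "2 * int k"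
          "- int k" "2 * int k" "- int k - 1" "2 * int k" "1 - int k" "2 * int k - 1"])
      (use k fb E5[of "2 * int k - 1" "1 - int k"] FE[of "1 - int k" "2 * int k - 1"] in \<open>auto simp: mem\<close>)
  have F2: "F i j = 0" if "(i, j) \<in> outer k 2 \<inter> Z" for i j
    by (rule zero_on_outer[OF k0 one(2) FZ _ _ _ _ _ _ _ _ _ that, of "- 1" "- 2 * int k" "2 * int k"
          "- 2 * int k" "2 * int k" "- 2 * int k - 1" "2 * int k" "1 - 2 * int k" "2 * int k - 1"])
      (use k fb F1[of "1 - 2 * int k" "2 * int k - 1"] in \<open>auto simp: mem\<close>)
  have F3: "F i j = 0" if "(i, j) \<in> outer k 3 \<inter> Z" for i j
    by (rule zero_on_outer[OF k0 one(2) FZ _ _ _ _ _ _ _ _ _ that, of "- 1" "1 - int k" 0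
          "1 - int k" 0 "- int k" 0 0 "1 - int k"])
      (use k F2[of "1 - int k" 0] F2[of "- int k" 0] F4[of 0 "1 - int k"] in \<open>auto simp: mem\<close>)
  show ?thesis
  proof (cases "i + j \<le> int k")
    case True
    show ?thesis
    proof (rule zero_if_zero_outer[OF k0 one(1) EY])
      show "hexagon k \<subseteq> Y" by (auto simp: hexagon_def Y_def)
      show "(i, j) \<in> Y" using ij True by (auto simp: shifted_pts_def Y_def)
    qed (use True E1 E2 E3 E4 E5 in auto)
  next
    case False
    have "F (int k - i) (int k - j) = 0"
    proof (rule zero_if_zero_outer[OF k0 one(2) FZ])
      show "hexagon k \<subseteq> Z" by (auto simp: hexagon_def Z_def)
      show "(int k - i, int k - j) \<in> Z" using ij False by (auto simp: shifted_pts_def Z_def)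
    qed (use False F1 F2 F3 F4 F5 in auto)
    then show ?thesis by (simp add: F_def)
  qed
qed

section \<open>The vertex with denominator k\<close>

definition double_spiral_on_grid :: "nat \<Rightarrow> int \<Rightarrow> int \<Rightarrow> real" where
  "double_spiral_on_grid k a b = double_spiral k (a - int k) (b - int k)"

lemma rigid_double_spiral_on_grid:
  assumes k: "k \<ge> 2" shows "rigid (5 * k) (double_spiral_on_grid k)"
  unfolding rigid_def
proof (intro allI impI ballI, clarify)
  fix D a b
  assume left: "\<forall>q. (0, q) \<in> lattice_pts (5 * k) \<longrightarrow> D 0 q = 0"
    and bottom: "\<forall>p. (p, 0) \<in> lattice_pts (5 * k) \<longrightarrow> D p 0 = 0"
    and aff: "\<forall>X\<subseteq>lattice_pts (5 * k). has_unit_triangle X \<longrightarrow> affine_fun_on X (double_spiral_on_grid k) \<longrightarrow> affine_fun_on X D"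
    and ab: "(a, b) \<in> lattice_pts (5 * k)"
  define E where "E i j = D (i + int k) (j + int k)" for i j
  have "inherits (double_spiral k) (shifted_pts k) E"
    unfolding inherits_def
  proof (intro allI impI)
    fix X assume X: "X \<subseteq> shifted_pts k" "has_unit_triangle X" "affine_fun_on X (double_spiral k)"
    define X' where "X' = {(a, b). (a - int k, b - int k) \<in> X}"
    have "X' \<subseteq> lattice_pts (5 * k)" using X(1) by (auto simp: X'_def shifted_pts_def lattice_pts_def)
    moreover have "has_unit_triangle X'"
    proof -
      obtain s m n where s: "s \<in> {1, - 1}" "{(m, n), (m + s, n), (m, n + s)} \<subseteq> X"
        using X(2) unfolding has_unit_triangle_def by blast
      then have "{(m + int k, n + int k), (m + int k + s, n + int k), (m + int k, n + int k + s)} \<subseteq> X'"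
        by (auto simp: X'_def algebra_simps)
      then show ?thesis using s(1) unfolding has_unit_triangle_def by blast
    qed
    moreover have "affine_fun_on X' (double_spiral_on_grid k)"
    proof -
      obtain \<alpha> \<beta> \<gamma> where f: "\<And>i j. (i, j) \<in> X \<Longrightarrow> double_spiral k i j = \<alpha> * of_int i + \<beta> * of_int j + \<gamma>"
        using X(3) unfolding affine_fun_on_def by blast
      have "double_spiral_on_grid k a b = \<alpha> * of_int a + \<beta> * of_int b + (\<gamma> - \<alpha> * k - \<beta> * k)" if "(a, b) \<in> X'" for a b
        using f[of "a - int k" "b - int k"] that by (simp add: X'_def double_spiral_on_grid_def algebra_simps)
      then show ?thesis by (rule affine_fun_onI)
    qed
    ultimately have "affine_fun_on X' D" using aff by blast
    then obtain \<alpha> \<beta> \<gamma> where f: "\<And>a b. (a, b) \<in> X' \<Longrightarrow> D a b = \<alpha> * of_int a + \<beta> * of_int b + \<gamma>"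
      unfolding affine_fun_on_def by blast
    have "E i j = \<alpha> * of_int i + \<beta> * of_int j + (\<gamma> + \<alpha> * k + \<beta> * k)" if "(i, j) \<in> X" for i j
      using f[of "i + int k" "j + int k"] that by (simp add: X'_def E_def algebra_simps)
    then show "affine_fun_on X E" by (rule affine_fun_onI)
  qed
  then have "E (a - int k) (b - int k) = 0"
  proof (rule double_spiral_rigid[OF k])
    show "E (- int k) j = 0" if "(- int k, j) \<in> shifted_pts k" for j
      using left that by (simp add: E_def shifted_pts_def lattice_pts_def)
    show "E i (- int k) = 0" if "(i, - int k) \<in> shifted_pts k" for i
      using bottom that by (simp add: E_def shifted_pts_def lattice_pts_def)
    show "(a - int k, b - int k) \<in> shifted_pts k" using ab by (simp add: shifted_pts_def lattice_pts_def)
  qed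
  then show "D a b = 0" by (simp add: E_def)
qed

lemma lattice_concave_double_spiral_on_grid: "k \<ge> 2 \<Longrightarrow> lattice_concave (double_spiral_on_grid k)"
  unfolding double_spiral_on_grid_def by (intro lattice_concave_shift lattice_concave_double_spiral)

text \<open>
  The boundary of the grid runs through outer cells only.
\<close>

lemma double_spiral_boundary_values:
  assumes k: "k \<ge> 2" and ab: "(a, b) \<in> lattice_pts (5 * k)" "a = 0 \<or> b = 0 \<or> a + b = 5 * int k"
  shows "double_spiral_on_grid k a b + (real k - 1) / 2 \<in> \<int>"
proof -
  have k0: "k > 0" using k by simp
  define i j where "i = a - int k" and "j = b - int k"
  have ij: "- int k \<le> i" "- int k \<le> j" "i + j \<le> 3 * int k" "i = - int k \<or> j = - int k \<or> i + j = 3 * int k"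
    using ab by (auto simp: i_def j_def lattice_pts_def)
  have "double_spiral k i j + (real k - 1) / 2 \<in> \<int>"
  proof (cases "i + j \<le> int k")
    case True
    then obtain m where "m \<in> {1, 2, 3, 4, 5}" "(i, j) \<in> outer k m" using outerI[of i j k] ij k by auto
    then have "spiral k 1 i j + (real k - 1) / 2 \<in> \<int>" by (rule spiral_outer_integral[OF k0, rotated]) simp
    then have "spiral k 1 i j + (real k - 1) / 2 + of_int (int k * (i + j)) \<in> \<int>"
      by (rule Ints_add[OF _ Ints_of_int])
    then show ?thesis unfolding double_spiral_low[OF True] by (simp only: add_ac)
  next
    case False
    define i' j' where "i' = int k - i" and "j' = int k - j"
    have "i' + j' \<le> int k" "2 * int k \<le> i' \<or> 2 * int k \<le> j' \<or> i' + j' \<le> - int k"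
      using False ij by (auto simp: i'_def j'_def)
    then obtain m where "m \<in> {1, 2, 3, 4, 5}" "(i', j') \<in> outer k m" using outerI[of i' j' k] by blast
    then have "spiral k (- 1) i' j' + (real k - 1) / 2 \<in> \<int>" by (rule spiral_outer_integral[OF k0, rotated]) simp
    then have "spiral k (- 1) i' j' + (real k - 1) / 2 + (of_int (int k * (2 * int k - i - j)) + of_int (int k)) \<in> \<int>"
      by (rule Ints_add[OF _ Ints_add[OF Ints_of_int Ints_of_int]])
    moreover have "int k \<le> i + j" using False by simp
    ultimately show ?thesis unfolding double_spiral_high[OF k0 \<open>int k \<le> i + j\<close>] i'_def j'_def
      by (simp only: add_ac of_int_of_nat_eq)
  qed
  then show ?thesis by (simp add: double_spiral_on_grid_def i_def j_def)
qed

text \<open>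
  The edge is the sixth side of the innermost turn of the first spiral.
\<close>

lemma double_spiral_fractional_edge:
  assumes k: "k \<ge> 2" shows "double_spiral_on_grid k (int k) (int k + 1) - double_spiral_on_grid k (int k + 1) (int k) = 1 / k"
proof -
  have k0: "k > 0" using k by simp
  have "spiral k 1 0 1 - spiral k 1 1 0 = 1 / k"
    using spiral_sector0[OF k0, of 1 0 1] spiral_sector0[OF k0, of 1 1 0] by (simp add: steep_def)
  then show ?thesis using k by (simp add: double_spiral_on_grid_def double_spiral_low)
qed

lemma has_denominator_inverse: "k > 0 \<Longrightarrow> has_denominator (1 / real k) k"
  unfolding has_denominator_def
  by (rule exI[of _ "Fract 1 (int k)"]) (simp add: of_rat_rat quotient_of_Fract normalize_def)

lemma has_denominator_Int:
  assumes "x \<in> \<int>" shows "has_denominator x 1"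
proof -
  obtain z where "x = of_int z" using assms by (rule Ints_cases)
  then show ?thesis unfolding has_denominator_def by (intro exI[of _ "of_int z"]) simp
qed

theorem theorem1p3:
  shows "\<exists>C::real. \<forall>k::nat. k > 0 \<longrightarrow>
    (\<exists>G S1 S2. \<exists>h0 :: edge \<Rightarrow> int.
       three_side_grid G \<and> real (grid_size G) \<le> C * real k \<and>
       S1 \<in> sides G \<and> S2 \<in> sides G \<and> S1 \<noteq> S2 \<and>
       (\<exists>h. h extreme_point_of (cocirc_polyhedron G (S1 \<union> S2) (\<lambda>e. real_of_int (h0 e))) \<and>
            (\<exists>e\<in>parcs G. has_denominator (Poly_Mapping.lookup h e) k) \<and>
            (\<forall>e\<in>boundary_edges G. Poly_Mapping.lookup h e \<in> \<int>)))"
proof (intro exI[of _ 10] allI impI)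
  fix k :: nat assume "k > 0"
  \<comment> \<open>For \<open>k = 1\<close> one of the ten cells would be degenerate. Any boundary edge for \<open>K = 2\<close> has denominator 1.\<close>
  define K where "K = (if k = 1 then 2 else k)"
  have K: "K \<ge> 2" "K \<le> 2 * k" "k = 1 \<or> K = k" using \<open>k > 0\<close> by (auto simp: K_def)
  define N where "N = 5 * K"
  have N: "N > 0" using K(1) by (simp add: N_def)
  define h where "h = coboundary N (interpolant (double_spiral_on_grid K))"
  define h0 where "h0 e = \<lfloor>Poly_Mapping.lookup h e\<rfloor>" for e
  have lh: "Poly_Mapping.lookup h (pt m n, pt p q) = double_spiral_on_grid K p q - double_spiral_on_grid K m n"
    if "(pt m n, pt p q) \<in> parcs (tgrid N)" for m n p q
    using that by (simp add: h_def lookup_coboundary interpolant_pt lattice_concave_double_spiral_on_grid K)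
  have sides: "sides (tgrid N) = {left_side N, bottom_side N, right_side N}" by (rule sides_tgrid[OF N])
  have bd: "Poly_Mapping.lookup h e \<in> \<int>" if e: "e \<in> left_side N \<union> bottom_side N \<union> right_side N" for e
  proof -
    have diff: "x - y \<in> \<int>" if "x + (real K - 1) / 2 \<in> \<int>" "y + (real K - 1) / 2 \<in> \<int>" for x y
      using Ints_diff[OF that] by simp
    have "left_side N \<union> bottom_side N \<union> right_side N \<subseteq> parcs (tgrid N)"
      using edges_on_left[OF N] edges_on_bottom[OF N] edges_on_right[OF N] by blast
    then have "e \<in> parcs (tgrid N)" using e by blast
    with e show ?thesis
      by (auto simp: left_side_def bottom_side_def right_side_def lh N_def lattice_pts_def
          intro!: diff double_spiral_boundary_values K(1))
  qed
  have extreme: "h extreme_point_of cocirc_polyhedron (tgrid N) (left_side N \<union> bottom_side N) (\<lambda>e. real_of_int (h0 e))"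
    unfolding h_def
  proof (rule rigid_extreme_point[OF N lattice_concave_double_spiral_on_grid[OF K(1)]])
    show "rigid N (double_spiral_on_grid K)" unfolding N_def by (rule rigid_double_spiral_on_grid[OF K(1)])
    show "Poly_Mapping.lookup (coboundary N (interpolant (double_spiral_on_grid K))) e = real_of_int (h0 e)"
      if "e \<in> left_side N \<union> bottom_side N" for e
      using bd[of e] that unfolding h_def[symmetric] h0_def by auto
  qed
  have denom: "\<exists>e\<in>parcs (tgrid N). has_denominator (Poly_Mapping.lookup h e) k"
  proof (cases "k = 1")
    case True
    have "(0, 0) \<in> up_cells N" using N by (simp add: up_cells_def)
    then have "(pt 0 (0 + 1), pt 0 0) \<in> parcs (tgrid N)" by (rule parcsI)
    moreover have "(pt 0 (0 + 1), pt 0 0) \<in> left_side N"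
      unfolding left_side_def by (rule image_eqI[of _ _ 0]) (use N in auto)
    ultimately show ?thesis using has_denominator_Int[OF bd] True by blast
  next
    case False
    then have "K = k" using K by simp
    have "(int K, int K) \<in> up_cells N" using K by (simp add: up_cells_def N_def)
    then have e: "(pt (int K + 1) (int K), pt (int K) (int K + 1)) \<in> parcs (tgrid N)" by (rule parcsI)
    have "Poly_Mapping.lookup h (pt (int K + 1) (int K), pt (int K) (int K + 1)) = 1 / real k"
      using lh[OF e] double_spiral_fractional_edge[OF K(1)] \<open>K = k\<close> by simp
    then show ?thesis using e has_denominator_inverse[OF \<open>k > 0\<close>] by metis
  qed
  have size: "real (grid_size (tgrid N)) \<le> 10 * real k"
    using grid_size_tgrid[OF N] K(2) by (simp add: N_def)
  have distinct: "left_side N \<noteq> bottom_side N"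
  proof
    assume "left_side N = bottom_side N"
    moreover have "(pt 0 (0 + 1), pt 0 0) \<in> left_side N"
      unfolding left_side_def by (rule image_eqI[of _ _ 0]) (use N in auto)
    ultimately show False by (auto simp: bottom_side_def)
  qed
  have boundary: "\<forall>e\<in>boundary_edges (tgrid N). Poly_Mapping.lookup h e \<in> \<int>"
    using boundary_edges_tgrid[OF N] bd by blast
  show "\<exists>G S1 S2. \<exists>h0 :: edge \<Rightarrow> int.
       three_side_grid G \<and> real (grid_size G) \<le> 10 * real k \<and>
       S1 \<in> sides G \<and> S2 \<in> sides G \<and> S1 \<noteq> S2 \<and>
       (\<exists>h. h extreme_point_of (cocirc_polyhedron G (S1 \<union> S2) (\<lambda>e. real_of_int (h0 e))) \<and>
            (\<exists>e\<in>parcs G. has_denominator (Poly_Mapping.lookup h e) k) \<and>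
            (\<forall>e\<in>boundary_edges G. Poly_Mapping.lookup h e \<in> \<int>))"
    by (rule exI[of _ "tgrid N"], rule exI[of _ "left_side N"], rule exI[of _ "bottom_side N"], rule exI[of _ h0],
        intro conjI exI[of _ h] three_side_grid_tgrid N size distinct extreme denom boundary)
      (simp_all add: sides)
qed

end
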